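(* For all real $x\le c$ and all $\beta\in[0,\infty)$, $$\mathbb E_x\bigl[e^{-\beta I_{\mathsf e}}\mathbf 1_{\{\tau_c^+\ge\mathsf e\}}\bigr]=\mathcal M^{p,\alpha}_\beta(e^x,e^c).$$
   Context: Conventions: $\mathbb N=\{1,2,\dots\}$, $\mathbb N_0=\mathbb N\cup\{0\}$, $\inf\emptyset=\infty$, empty products equal $1$. The process $X$. $X=(X_t)_{t\in[0,\infty)}$ is a spectrally negative Lévy process under probabilities $(P_x)_{x\in\mathbb R}$ in a filtration $\mathcal F=(\mathcal F_t)_{t\in[0,\infty)}$: it is càdlàg, real-valued, $\mathcal F$-adapted, with stationary independent increments relative to $\mathcal F$, no positive jumps and non-monotone paths; $X_0=0$ a.s. under $P_0$; and for each $x\in\mathbb R$ the law of $X$ under $P_x$ is that of $x+X$ under $P_0$. $\mathbb E_x$ is expectation under $P_x$. $\mathsf e$ is an a.s. strictly positive $\mathcal F$-stopping time such that for some $p\in[0,\infty)$, for all $x\in\mathbb R$, $s,t\in[0,\infty)$ and Borel $g:\mathbb R\to[0,\infty]$, $\mathbb E_x[g(X_{t+s}-X_t)\mathbf 1_{\{\mathsf e>t+s\}}\mid\mathcal F_t]=\mathbb E_0[g(X_s)]e^{-ps}\mathbf 1_{\{t<\mathsf e\}}$ $P_x$-a.s. (so $\mathsf e$ is exponential of rate $p$, independent of $X$; $\mathsf e=\infty$ a.s. if $p=0$). Let $\alpha\in(0,\infty)$. Let $\psi(\lambda):=\log\mathbb E_0[e^{\lambda X_1}]$, $\lambda\in[0,\infty)$,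 and $\Phi(q):=\inf\{\lambda\in[0,\infty):\psi(\lambda)>q\}$ for $q\in[0,\infty)$. Standing assumption: if $p=0$, then $X$ drifts to $-\infty$; equivalently $\Phi(p)>0$. Put $I_t:=\int_0^te^{\alpha X_u}du$ for $t\in[0,\infty]$ (so $I_{\mathsf e}=\int_0^{\mathsf e}e^{\alpha X_u}du$ is the absorption time at $0$ of the positive self-similar Markov process associated to $X$, $\mathsf e$, $\alpha$ by the Lamperti transform) and $\tau_c^+:=\inf\{t\in(0,\infty):X_t>c\}$. Power series. For $z\in[0,\infty)$, $\mathcal I^{p,\alpha}(z):=\sum_{k=0}^\infty b_kz^k$ with $b_k:=\bigl(\prod_{l=1}^k(\psi(\Phi(p)+l\alpha)-p)\bigr)^{-1}$; and, if $\Phi(p)\notin\alpha\mathbb N$, $\mathcal J^{p,\alpha}(z):=\sum_{k=0}^\infty a_kz^k$ with $a_k:=\bigl(\prod_{l=1}^k(\psi(l\alpha)-p)\bigr)^{-1}$. For $\Phi(p)\notin\alpha\mathbb N$, $\beta\in[0,\infty)$ and $0<y\le d$, $$\mathcal M^{p,\alpha}_\beta(y,d):=\mathcal J^{p,\alpha}(\beta y^\alpha)-\left(\frac yd\right)^{\Phi(p)}\frac{\mathcal I^{p,\alpha}(\beta y^\alpha)}{\mathcal I^{p,\alpha}(\beta d^\alpha)}\mathcal J^{p,\alpha}(\beta d^\alpha).$$ If $\Phi(p)=m\alpha$ for some $m\in\mathbb N$, then $\mathcal M^{p,\alpha}_\beta(y,d):=\lim_{\alpha'\to\alpha}\mathcal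 M^{p,\alpha'}_\beta(y,d)$, the limit being over $\alpha'\neq\alpha$ (so $\Phi(p)\notin\alpha'\mathbb N$ for $\alpha'$ near $\alpha$) with everything else fixed; this limit exists. *)

theory Defs
  imports "HOL-Probability.Probability"
begin

text \<open>
  Time-indexed families have index type \<^typ>\<open>real\<close>; only nonnegative times are ever constrained or used.
  The measures \<^term>\<open>P x\<close> live on one measurable space, whose \<open>\<sigma>\<close>-algebra is that of \<^term>\<open>P 0\<close>.
  Path properties qualified by ``almost surely'' are required under every \<^term>\<open>P x\<close>.
\<close>

definition cadlag :: "(real \<Rightarrow> real) \<Rightarrow> bool" where
  "cadlag f \<longleftrightarrow> (\<forall>t\<ge>0. (f \<longlongrightarrow> f t) (at_right t)) \<and> (\<forall>t>0. \<exists>l. (f \<longlongrightarrow> l) (at_left t))"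

definition no_positive_jumps :: "(real \<Rightarrow> real) \<Rightarrow> bool" where
  "no_positive_jumps f \<longleftrightarrow> (\<forall>t>0. \<forall>l. (f \<longlongrightarrow> l) (at_left t) \<longrightarrow> f t \<le> l)"

definition nonmonotone :: "(real \<Rightarrow> real) \<Rightarrow> bool" where
  "nonmonotone f \<longleftrightarrow> \<not> monotone_on {0..} (\<le>) (\<le>) f \<and> \<not> monotone_on {0..} (\<le>) (\<ge>) f"

locale spectrally_negative_Levy =
  fixes P :: "real \<Rightarrow> 'a measure"
    and F :: "real \<Rightarrow> 'a measure"
    and X :: "real \<Rightarrow> 'a \<Rightarrow> real"
  assumes prob: "\<And>x. prob_space (P x)"
    and sets_P: "\<And>x. sets (P x) = sets (P 0)"
    and filtration_sub: "\<And>t. 0 \<le> t \<Longrightarrow> subalgebra (P 0) (F t)"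
    and filtration_mono: "\<And>s t. 0 \<le> s \<Longrightarrow> s \<le> t \<Longrightarrow> subalgebra (F t) (F s)"
    and adapted: "\<And>t. 0 \<le> t \<Longrightarrow> X t \<in> borel_measurable (F t)"
    and cadlag_paths: "\<And>\<omega>. \<omega> \<in> space (P 0) \<Longrightarrow> cadlag (\<lambda>t. X t \<omega>)"
    and independent_increments:
      "\<And>x s t. 0 \<le> s \<Longrightarrow> s \<le> t \<Longrightarrow>
        prob_space.indep_set (P x) (sets (F s))
          (sets (vimage_algebra (space (P x)) (\<lambda>\<omega>. X t \<omega> - X s \<omega>) borel))"
    and stationary_increments:
      "\<And>x s t. 0 \<le> s \<Longrightarrow> 0 \<le> t \<Longrightarrow>
        distr (P x) borel (\<lambda>\<omega>. X (s + t) \<omega> - X s \<omega>) = distr (P x) borel (\<lambda>\<omega>. X t \<omega> - X 0 \<omega>)"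
    and no_pos_jumps: "\<And>x. AE \<omega> in P x. no_positive_jumps (\<lambda>t. X t \<omega>)"
    and nonmonotone_paths: "\<And>x. AE \<omega> in P x. nonmonotone (\<lambda>t. X t \<omega>)"
    and start: "AE \<omega> in P 0. X 0 \<omega> = 0"
    and law_translate:
      "\<And>x. distr (P x) (PiM {0..} (\<lambda>_. borel)) (\<lambda>\<omega>. \<lambda>t\<in>{0..}. X t \<omega>) =
            distr (P 0) (PiM {0..} (\<lambda>_. borel)) (\<lambda>\<omega>. \<lambda>t\<in>{0..}. x + X t \<omega>)"

text \<open>
  The killing time takes values in \<open>[0, \<infinity>]\<close>, so the library predicate \<^const>\<open>stopping_time\<close>, which
  makes the index type of the filtration the range type of the time, does not apply.
\<close>

definition extended_stopping_time :: "(real \<Rightarrow> 'a measure) \<Rightarrow> ('a \<Rightarrow> ennreal) \<Rightarrow> bool" where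
  "extended_stopping_time F T \<longleftrightarrow> (\<forall>t\<ge>0. Measurable.pred (F t) (\<lambda>\<omega>. T \<omega> \<le> ennreal t))"

locale killed_spectrally_negative_Levy = spectrally_negative_Levy P F X
  for P :: "real \<Rightarrow> 'a measure"
    and F :: "real \<Rightarrow> 'a measure"
    and X :: "real \<Rightarrow> 'a \<Rightarrow> real" +
  fixes e :: "'a \<Rightarrow> ennreal"
    and p :: real
  assumes rate_nonneg: "0 \<le> p"
    and e_stopping: "extended_stopping_time F e"
    and e_pos: "\<And>x. AE \<omega> in P x. 0 < e \<omega>"
    and e_memoryless:
      "\<And>x s t (g :: real \<Rightarrow> ennreal). 0 \<le> s \<Longrightarrow> 0 \<le> t \<Longrightarrow> g \<in> borel_measurable borel \<Longrightarrow>
        AE \<omega> in P x.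
          nn_cond_exp (P x) (F t)
            (\<lambda>\<omega>. g (X (t + s) \<omega> - X t \<omega>) * indicator {\<omega>. ennreal (t + s) < e \<omega>} \<omega>) \<omega> =
          (\<integral>\<^sup>+\<omega>'. g (X s \<omega>') \<partial>P 0) * ennreal (exp (- p * s)) * indicator {\<omega>. ennreal t < e \<omega>} \<omega>"
    and drift_to_minus_infinity:
      "\<And>x. p = 0 \<Longrightarrow> AE \<omega> in P x. filterlim (\<lambda>t. X t \<omega>) at_bot at_top"

definition laplace_exponent :: "(real \<Rightarrow> 'a measure) \<Rightarrow> (real \<Rightarrow> 'a \<Rightarrow> real) \<Rightarrow> real \<Rightarrow> real" where
  "laplace_exponent P X l = ln (\<integral>\<omega>. exp (l * X 1 \<omega>) \<partial>P 0)"

text \<open>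
  For \<open>\<lambda> \<ge> 0\<close> the exponential moment above is finite. Since \<open>X\<close> is not monotone,
  its Laplace exponent is unbounded above, so the set below is nonempty and the infimum
  in \<^typ>\<open>real\<close> is the intended one.
\<close>

definition laplace_exponent_inverse ::
    "(real \<Rightarrow> 'a measure) \<Rightarrow> (real \<Rightarrow> 'a \<Rightarrow> real) \<Rightarrow> real \<Rightarrow> real" where
  "laplace_exponent_inverse P X q = Inf {l. 0 \<le> l \<and> laplace_exponent P X l > q}"

definition exp_functional :: "real \<Rightarrow> (real \<Rightarrow> 'a \<Rightarrow> real) \<Rightarrow> ennreal \<Rightarrow> 'a \<Rightarrow> ennreal" where
  "exp_functional \<alpha> X t \<omega> =
    (\<integral>\<^sup>+u\<in>{u. 0 \<le> u \<and> ennreal u \<le> t}. ennreal (exp (\<alpha> * X u \<omega>)) \<partial>lborel)"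

definition first_passage_above :: "(real \<Rightarrow> 'a \<Rightarrow> real) \<Rightarrow> real \<Rightarrow> 'a \<Rightarrow> ennreal" where
  "first_passage_above X c \<omega> = Inf {ennreal t | t. 0 < t \<and> X t \<omega> > c}"

text \<open>\<open>exp_neg z\<close> is \<open>e\<^bsup>-z\<^esup>\<close> for \<open>z \<in> [0, \<infinity>]\<close>, with \<open>e\<^bsup>-\<infinity>\<^esup> = 0\<close>.\<close>

definition exp_neg :: "ennreal \<Rightarrow> real" where
  "exp_neg z = (if z = \<top> then 0 else exp (- enn2real z))"

text \<open>
  In the power series and in \<open>\<M>\<close> the parameters \<open>\<psi>\<close> and \<open>\<phi>\<close> stand for the Laplace exponent and
  for \<open>\<Phi>(p)\<close>; they are kept fixed when \<open>\<alpha>\<close> varies in the limit defining \<open>\<M>\<close>.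
  The series \<open>\<J>\<close> is meaningful only for \<open>\<phi>\<close> outside \<open>\<alpha>\<nat>\<close>.
\<close>

definition I_series :: "(real \<Rightarrow> real) \<Rightarrow> real \<Rightarrow> real \<Rightarrow> real \<Rightarrow> real \<Rightarrow> real" where
  "I_series \<psi> \<phi> p \<alpha> z = (\<Sum>k. inverse (\<Prod>l=1..k. \<psi> (\<phi> + real l * \<alpha>) - p) * z ^ k)"

definition J_series :: "(real \<Rightarrow> real) \<Rightarrow> real \<Rightarrow> real \<Rightarrow> real \<Rightarrow> real" where
  "J_series \<psi> p \<alpha> z = (\<Sum>k. inverse (\<Prod>l=1..k. \<psi> (real l * \<alpha>) - p) * z ^ k)"

definition M_nonresonant ::
    "(real \<Rightarrow> real) \<Rightarrow> real \<Rightarrow> real \<Rightarrow> real \<Rightarrow> real \<Rightarrow> real \<Rightarrow> real \<Rightarrow> real" where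
  "M_nonresonant \<psi> \<phi> p \<alpha> \<beta> y d =
    J_series \<psi> p \<alpha> (\<beta> * y powr \<alpha>) -
    (y / d) powr \<phi> * (I_series \<psi> \<phi> p \<alpha> (\<beta> * y powr \<alpha>) / I_series \<psi> \<phi> p \<alpha> (\<beta> * d powr \<alpha>)) *
      J_series \<psi> p \<alpha> (\<beta> * d powr \<alpha>)"

definition M_function ::
    "(real \<Rightarrow> real) \<Rightarrow> real \<Rightarrow> real \<Rightarrow> real \<Rightarrow> real \<Rightarrow> real \<Rightarrow> real \<Rightarrow> real" where
  "M_function \<psi> \<phi> p \<alpha> \<beta> y d =
    (if \<exists>m::nat. m \<ge> 1 \<and> \<phi> = real m * \<alpha>
     then Lim (at \<alpha>) (\<lambda>\<alpha>'. M_nonresonant \<psi> \<phi> p \<alpha>' \<beta> y d)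
     else M_nonresonant \<psi> \<phi> p \<alpha> \<beta> y d)"

end

theory Submission
  imports Defs
begin

text \<open>
  Write \<open>K\<^sub>t\<close> for the indicator of \<open>t < e\<close>, \<open>I\<^sub>t\<close> for the integral of \<open>exp (\<alpha> X)\<close> over \<open>[0, t]\<close>, \<open>\<tau>\<close> for the first
  passage above \<open>c\<close> and \<open>T = min t \<tau>\<close>. By the Markov property of the killed process and Duhamel's
  formula, \<open>e\<^bsup>l X\<^esup> K e\<^bsup>-\<beta> I\<^esup>\<close> plus the time integral of \<open>(\<beta> e\<^bsup>\<alpha> X\<^esup> - (\<psi> l - p)) e\<^bsup>l X\<^esup> K e\<^bsup>-\<beta> I\<^esup>\<close>
  is a martingale for every \<open>l \<ge> 0\<close>, and it may be stopped at \<open>T\<close>, before which \<open>X \<le> c\<close>. Summing these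
  identities over \<open>l = k \<alpha>\<close> and over \<open>l = \<Phi>(p) + k \<alpha>\<close> with the coefficients of the two power series makes
  all time integrals cancel, except for \<open>p\<close> times that of \<open>K e\<^bsup>-\<beta> I\<^esup>\<close>, which is the expectation of
  \<open>e\<^bsup>-\<beta> I\<^esup>\<close> at time \<open>e\<close> on the event \<open>e \<le> T\<close>. The combination of the two series that
  vanishes at \<open>c\<close> has value \<open>\<M>\<close> at \<open>x\<close>; as \<open>X = c\<close> at time \<open>\<tau>\<close> by the absence of positive jumps,
  letting \<open>t\<close> tend to \<open>\<infinity>\<close> gives the claim. In the resonant case the left-hand side is continuous in \<open>\<alpha>\<close>, so the limit defining \<open>\<M>\<close>
  can be taken in the nonresonant identity.
\<close>

section \<open>Right-continuous paths\<close>

text \<open>The main identities use exponentials as their only test functions: for these the law of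
  an increment gives the evolution exactly, so neither a generator nor stochastic calculus is
  needed. The factor exp (\<alpha> X) produced by the discount moves the exponent l to l + \<alpha>,
  so identities along an arithmetic progression of exponents close up; the starting points 0 and
  \<Phi>(p) are chosen because \<psi> - p equals -p and 0 there. Two facts have to be earned.
  Finiteness of the moments of exp (l X) for l \<ge> 0 is not a hypothesis; it follows from the
  absence of positive jumps through geometric tails. And the first passage time \<tau> is known only
  through the events \<tau> < s in F s, the filtration not being assumed right-continuous, so
  stopping is carried out by hand along grid times strictly to the right of \<tau>. In the resonant
  case a denominator in the second series vanishes. Continuity in \<alpha> then needs an integrable
  majorant over an infinite time horizon, which comes from an exponent \<delta> < \<Phi>(p), where
  \<psi> - p is negative.\<close>

lemma cadlag_bounded:
  assumes "cadlag f" and "0 \<le> t"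
  obtains B where "\<And>u. 0 \<le> u \<Longrightarrow> u \<le> t \<Longrightarrow> \<bar>f u\<bar> \<le> B"
proof -
  have right: "\<exists>B d. 0 < d \<and> (\<forall>u. x \<le> u \<and> u < x + d \<longrightarrow> \<bar>f u\<bar> \<le> B)" if "0 \<le> x" for x
  proof -
    have "(f \<longlongrightarrow> f x) (at_right x)"
      using assms(1) that by (auto simp: cadlag_def)
    then have "\<forall>\<^sub>F u in at_right x. dist (f u) (f x) < 1"
      by (rule tendstoD) simp
    then obtain b where b: "b > x" "\<And>u. x < u \<Longrightarrow> u < b \<Longrightarrow> dist (f u) (f x) < 1"
      by (auto simp: eventually_at_right_field)
    have "\<bar>f u\<bar> \<le> \<bar>f x\<bar> + 1" if "x \<le> u" "u < x + (b - x)" for u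
      using b(2)[of u] that by (cases "u = x") (auto simp: dist_real_def)
    then show ?thesis using b(1) by (intro exI[of _ "\<bar>f x\<bar> + 1"] exI[of _ "b - x"]) auto
  qed
  have left: "\<exists>B d. 0 < d \<and> (\<forall>u. 0 \<le> u \<and> x - d < u \<and> u < x \<longrightarrow> \<bar>f u\<bar> \<le> B)" if "0 \<le> x" for x
  proof (cases "x = 0")
    case True
    then show ?thesis by (intro exI[of _ 1]) auto
  next
    case False
    then obtain l where "(f \<longlongrightarrow> l) (at_left x)"
      using assms(1) \<open>0 \<le> x\<close> unfolding cadlag_def by (metis order_le_less)
    then have "\<forall>\<^sub>F u in at_left x. dist (f u) l < 1"
      by (rule tendstoD) simp
    then obtain b where b: "b < x" "\<And>u. b < u \<Longrightarrow> u < x \<Longrightarrow> dist (f u) l < 1"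
      by (auto simp: eventually_at_left_field)
    have "\<bar>f u\<bar> \<le> \<bar>l\<bar> + 1" if "x - (x - b) < u" "u < x" for u
      using b(2)[of u] that by (auto simp: dist_real_def)
    then show ?thesis using b(1) by (intro exI[of _ "\<bar>l\<bar> + 1"] exI[of _ "x - b"]) auto
  qed
  \<comment> \<open>Bisection instead of a covering argument: having a bound passes to adjacent
    intervals and holds on short intervals around each point. The first \<open>0 \<le> u\<close>
    stays in the predicate because short intervals around 0 reach negative times, where
    \<open>f\<close> is arbitrary; the second one is the left end point of the interval.\<close>
  have "\<exists>B. \<forall>u. 0 \<le> u \<and> 0 \<le> u \<and> u \<le> t \<longrightarrow> \<bar>f u\<bar> \<le> B"
  proof (rule Bolzano[where P="\<lambda>a b. \<exists>B. \<forall>u. 0 \<le> u \<and> a \<le> u \<and> u \<le> b \<longrightarrow> \<bar>f u\<bar> \<le> B", OF \<open>0 \<le> t\<close>])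
    fix a b c
    assume "\<exists>B. \<forall>u. 0 \<le> u \<and> a \<le> u \<and> u \<le> b \<longrightarrow> \<bar>f u\<bar> \<le> B"
      and "\<exists>B. \<forall>u. 0 \<le> u \<and> b \<le> u \<and> u \<le> c \<longrightarrow> \<bar>f u\<bar> \<le> B"
    then obtain B B' where B: "\<forall>u. 0 \<le> u \<and> a \<le> u \<and> u \<le> b \<longrightarrow> \<bar>f u\<bar> \<le> B"
      "\<forall>u. 0 \<le> u \<and> b \<le> u \<and> u \<le> c \<longrightarrow> \<bar>f u\<bar> \<le> B'" by blast
    have "\<bar>f u\<bar> \<le> max B B'" if "0 \<le> u" "a \<le> u" "u \<le> c" for u
      using B(1)[rule_format, of u] B(2)[rule_format, of u] that by (cases "u \<le> b") (auto simp: le_max_iff_disj)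
    then show "\<exists>B. \<forall>u. 0 \<le> u \<and> a \<le> u \<and> u \<le> c \<longrightarrow> \<bar>f u\<bar> \<le> B" by blast
  next
    fix x :: real assume x: "0 \<le> x" "x \<le> t"
    obtain B d where B: "0 < d" "\<forall>u. x \<le> u \<and> u < x + d \<longrightarrow> \<bar>f u\<bar> \<le> B"
      using right[of x] x by blast
    obtain B' d' where B': "0 < d'" "\<forall>u. 0 \<le> u \<and> x - d' < u \<and> u < x \<longrightarrow> \<bar>f u\<bar> \<le> B'"
      using left[of x] x by blast
    have "\<bar>f u\<bar> \<le> max B B'" if "0 \<le> u" "a \<le> u" "u \<le> b" "a \<le> x" "x \<le> b" "b - a < min d d'" for a b u
      using B(2)[rule_format, of u] B'(2)[rule_format, of u] that by (cases "x \<le> u") (auto simp: le_max_iff_disj)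
    then show "\<exists>d>0. \<forall>a b. a \<le> x \<and> x \<le> b \<and> b - a < d \<longrightarrow>
        (\<exists>B. \<forall>u. 0 \<le> u \<and> a \<le> u \<and> u \<le> b \<longrightarrow> \<bar>f u\<bar> \<le> B)"
      using B(1) B'(1) by (intro exI[of _ "min d d'"] conjI allI impI exI[of _ "max B B'"]) auto
  qed
  then show ?thesis using that by auto
qed

text \<open>Floor plus one, rather than the ceiling, gives a point strictly to the right of
  \<open>u\<close> even when \<open>u\<close> is itself a grid point. The approximating times
  therefore converge within \<open>at_right u\<close>, and the one-sided limit is enough.\<close>

lemma ceiling_approx_at_right:
  fixes u :: real
  assumes "(f \<longlongrightarrow> f u) (at_right u)"
  shows "(\<lambda>n. f ((of_int \<lfloor>real (Suc n) * u\<rfloor> + 1) / real (Suc n))) \<longlonglongrightarrow> f u"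
proof -
  have gt: "u < (of_int \<lfloor>real (Suc n) * u\<rfloor> + 1) / real (Suc n)" for n
    by (simp add: less_divide_eq mult.commute del: of_nat_Suc)
  have le: "(of_int \<lfloor>real (Suc n) * u\<rfloor> + 1) / real (Suc n) \<le> u + 1 / real (Suc n)" for n
    by (simp add: divide_simps mult.commute del: of_nat_Suc)
  have "(\<lambda>n. (of_int \<lfloor>real (Suc n) * u\<rfloor> + 1) / real (Suc n)) \<longlonglongrightarrow> u"
  proof (rule tendsto_sandwich[of "\<lambda>_. u" _ _ "\<lambda>n. u + 1 / real (Suc n)"])
    show "(\<lambda>n. u + 1 / real (Suc n)) \<longlonglongrightarrow> u"
      using tendsto_add[OF tendsto_const[of u] lim_1_over_n[THEN LIMSEQ_Suc]] by simp
  qed (use gt le in \<open>auto intro!: always_eventually less_imp_le simp del: of_nat_Suc\<close>)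
  then have "filterlim (\<lambda>n. (of_int \<lfloor>real (Suc n) * u\<rfloor> + 1) / real (Suc n)) (at_right u) sequentially"
    unfolding filterlim_at using gt by (auto simp: less_imp_neq[symmetric] simp del: of_nat_Suc)
  then show ?thesis using assms by (rule filterlim_compose[rotated])
qed

text \<open>Rounding time up to a grid leaves countably many values, and right continuity recovers
  the process in the limit. Clipping the time to \<open>{0..t}\<close> keeps the rounded times from
  running past \<open>t\<close>, so \<open>N\<close> may be the sigma-algebra of the past at
  \<open>t\<close>.\<close>

lemma progressive_measurable:
  fixes Z :: "real \<Rightarrow> 'a \<Rightarrow> real"
  assumes meas: "\<And>u. 0 \<le> u \<Longrightarrow> u \<le> t \<Longrightarrow> Z u \<in> borel_measurable N"
    and right: "\<And>u \<omega>. \<omega> \<in> space N \<Longrightarrow> 0 \<le> u \<Longrightarrow> ((\<lambda>s. Z s \<omega>) \<longlongrightarrow> Z u \<omega>) (at_right u)"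
    and t: "0 \<le> t"
  shows "(\<lambda>(u, \<omega>). Z (max 0 (min t u)) \<omega>) \<in> borel_measurable (borel \<Otimes>\<^sub>M N)"
proof -
  let ?d = "\<lambda>n k. max 0 (min t ((of_int k + 1) / real (Suc n)))"
  have "(\<lambda>x. Z (?d n (\<lfloor>real (Suc n) * fst x\<rfloor>)) (snd x)) \<in> borel_measurable (borel \<Otimes>\<^sub>M N)" for n
  proof (rule measurable_compose_countable[where f="\<lambda>k x. Z (?d n k) (snd x)"])
    show "(\<lambda>x. Z (?d n k) (snd x)) \<in> borel_measurable (borel \<Otimes>\<^sub>M N)" for k
      by (rule measurable_compose[OF measurable_snd meas]) (use t in auto)
    show "(\<lambda>x. \<lfloor>real (Suc n) * fst x\<rfloor>) \<in> borel \<Otimes>\<^sub>M N \<rightarrow>\<^sub>M count_space UNIV"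
      by measurable
  qed
  moreover have "(\<lambda>n. Z (?d n (\<lfloor>real (Suc n) * fst x\<rfloor>)) (snd x)) \<longlonglongrightarrow> Z (max 0 (min t (fst x))) (snd x)"
    if "x \<in> space (borel \<Otimes>\<^sub>M N)" for x
  proof -
    obtain u \<omega> where x: "x = (u, \<omega>)" by (cases x)
    then have \<omega>: "\<omega> \<in> space N" using that by (simp add: space_pair_measure)
    have "((\<lambda>s. Z (max 0 (min t s)) \<omega>) \<longlongrightarrow> Z (max 0 (min t u)) \<omega>) (at_right u)"
    proof -
      consider "u < 0" | "0 \<le> u" "u < t" | "t \<le> u" by linarith
      then show ?thesis
      proof cases
        case 1
        have "\<forall>\<^sub>F s in at_right u. Z (max 0 (min t s)) \<omega> = Z (max 0 (min t u)) \<omega>"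
          using eventually_at_right_less[of u] eventually_at_right[OF 1] 1 t
          unfolding eventually_at_right_field by (intro exI[of _ 0]) (auto simp: max_def min_def)
        then show ?thesis by (rule tendsto_eventually)
      next
        case 2
        have "\<forall>\<^sub>F s in at_right u. Z s \<omega> = Z (max 0 (min t s)) \<omega>"
          unfolding eventually_at_right_field using 2 by (intro exI[of _ t]) auto
        from Lim_transform_eventually[OF right[OF \<omega> 2(1)] this] 2
        show ?thesis by simp
      next
        case 3
        have "\<forall>\<^sub>F s in at_right u. Z (max 0 (min t s)) \<omega> = Z (max 0 (min t u)) \<omega>"
          unfolding eventually_at_right_field using 3 by (intro exI[of _ "u+1"]) auto
        then show ?thesis by (rule tendsto_eventually)
      qed
    qed
    from ceiling_approx_at_right[of "\<lambda>s. Z (max 0 (min t s)) \<omega>" u, OF this]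
    show ?thesis by (simp add: x)
  qed
  ultimately have "(\<lambda>x. Z (max 0 (min t (fst x))) (snd x)) \<in> borel_measurable (borel \<Otimes>\<^sub>M N)"
    by (rule borel_measurable_LIMSEQ_real[rotated])
  then show ?thesis by (simp add: case_prod_beta')
qed

lemma jointly_measurable:
  fixes Z :: "real \<Rightarrow> 'a \<Rightarrow> real"
  assumes meas: "\<And>u. 0 \<le> u \<Longrightarrow> Z u \<in> borel_measurable N"
    and right: "\<And>u \<omega>. \<omega> \<in> space N \<Longrightarrow> 0 \<le> u \<Longrightarrow> ((\<lambda>s. Z s \<omega>) \<longlongrightarrow> Z u \<omega>) (at_right u)"
  shows "(\<lambda>(u, \<omega>). Z (max 0 u) \<omega>) \<in> borel_measurable (borel \<Otimes>\<^sub>M N)"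
proof -
  have "(\<lambda>(u, \<omega>). Z (max 0 (min (real n) u)) \<omega>) \<in> borel_measurable (borel \<Otimes>\<^sub>M N)" for n
    by (rule progressive_measurable) (use assms in auto)
  moreover have "(\<lambda>n. (\<lambda>(u, \<omega>). Z (max 0 (min (real n) u)) \<omega>) x) \<longlonglongrightarrow> (\<lambda>(u, \<omega>). Z (max 0 u) \<omega>) x" for x
  proof -
    have "\<forall>\<^sub>F n in sequentially. fst x \<le> real n"
      using eventually_ge_at_top[of "nat \<lceil>fst x\<rceil>"] by eventually_elim linarith
    then show ?thesis
      by (intro tendsto_eventually) (auto elim!: eventually_mono simp: case_prod_beta' min_def)
  qed
  ultimately show ?thesis by (rule borel_measurable_LIMSEQ_real[rotated])
qed

text \<open>The difference of the two sides, as a function of \<open>t\<close>, is additive over intervals and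
  quadratically small on short ones.\<close>

lemma integral_exp_neg_primitive_HK:
  fixes a :: "real \<Rightarrow> real"
  assumes int: "a integrable_on {0..t}"
    and meas: "a \<in> borel_measurable (lebesgue_on {0..t})"
    and bound: "\<And>u. 0 \<le> u \<Longrightarrow> u \<le> t \<Longrightarrow> 0 \<le> a u \<and> a u \<le> C"
    and t: "0 \<le> t"
  defines "A \<equiv> \<lambda>u. integral {0..u} a"
  shows "((\<lambda>u. a u * exp (- A u)) has_integral (1 - exp (- A t))) {0..t}"
proof -
  have int': "a integrable_on {s..s'}" if "0 \<le> s" "s' \<le> t" for s s'
    using int that by (metis atLeastatMost_subset_iff integrable_on_subinterval)
  have A_diff: "A s' - A s = integral {s..s'} a" if "0 \<le> s" "s \<le> s'" "s' \<le> t" for s s'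
    using Henstock_Kurzweil_Integration.integral_combine[OF that(1,2) int'] that unfolding A_def by force
  have A_mono: "A s \<le> A s'" if "0 \<le> s" "s \<le> s'" "s' \<le> t" for s s'
    using A_diff[OF that] integral_nonneg[OF int'[of s s']] bound that by force
  have A_lip: "A s' - A s \<le> C * (s' - s)" if "0 \<le> s" "s \<le> s'" "s' \<le> t" for s s'
  proof -
    have "integral {s..s'} a \<le> integral {s..s'} (\<lambda>_. C)"
      using that bound by (intro integral_le int') auto
    then show ?thesis using A_diff[OF that] that by (simp add: mult.commute)
  qed
  have A0: "A 0 = 0" by (simp add: A_def)
  have A_nonneg: "0 \<le> A s" if "0 \<le> s" "s \<le> t" for s
    using A_mono[of 0 s] that A0 by simp
  let ?g = "\<lambda>u. a u * exp (- A u)"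
  have A_cont: "continuous_on {0..t} A"
    unfolding A_def by (rule indefinite_integral_continuous_1[OF int])
  have g_meas: "?g \<in> borel_measurable (lebesgue_on {0..t})"
    by (intro borel_measurable_times meas continuous_imp_measurable_on_sets_lebesgue
        continuous_intros A_cont) auto
  have C: "0 \<le> C" using bound[of 0] t by simp
  have g_int: "?g integrable_on {0..t}"
  proof (rule measurable_bounded_by_integrable_imp_integrable[OF g_meas])
    show "norm (?g u) \<le> C" if "u \<in> {0..t}" for u
      using bound[of u] that A_nonneg[of u] mult_mono[of "a u" C "exp (- A u)" 1]
      by auto
  qed auto
  have g_int': "?g integrable_on {s..s'}" if "0 \<le> s" "s' \<le> t" for s s'
    using g_int that by (metis atLeastatMost_subset_iff integrable_on_subinterval)
  define D where "D = (\<lambda>u. 1 - exp (- A u) - integral {0..u} ?g)"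
  have D_small: "\<bar>D s' - D s\<bar> \<le> C\<^sup>2 * (s' - s)\<^sup>2" if s: "0 \<le> s" "s \<le> s'" "s' \<le> t" for s s'
  proof -
    define h where "h = A s' - A s"
    have h: "0 \<le> h" "h \<le> C * (s' - s)" using A_mono[OF s] A_lip[OF s] by (auto simp: h_def)
    have *: "integral {0..s'} ?g = integral {0..s} ?g + integral {s..s'} ?g"
      using Henstock_Kurzweil_Integration.integral_combine[OF s(1,2) g_int'] s by force
    have lo: "h * exp (- A s') \<le> integral {s..s'} ?g"
    proof -
      have "integral {s..s'} (\<lambda>u. a u * exp (- A s')) \<le> integral {s..s'} ?g"
        using s bound A_mono by (intro integral_le g_int' integrable_on_mult_left int') (auto intro!: mult_left_mono)
      then show ?thesis using A_diff[OF s] by (simp add: h_def)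
    qed
    have hi: "integral {s..s'} ?g \<le> h * exp (- A s)"
    proof -
      have "integral {s..s'} ?g \<le> integral {s..s'} (\<lambda>u. a u * exp (- A s))"
        using s bound A_mono by (intro integral_le g_int' integrable_on_mult_left int') (auto intro!: mult_left_mono)
      then show ?thesis using A_diff[OF s] by (simp add: h_def)
    qed
    have es': "exp (- A s') = exp (- A s) * exp (- h)" by (simp add: h_def exp_add[symmetric])
    have e1: "1 - h \<le> exp (- h)" using exp_ge_add_one_self[of "-h"] by simp
    have e2: "(1 + h) * exp (- h) \<le> 1"
      using exp_ge_add_one_self[of h] by (simp add: exp_minus field_simps)
    have lo': "h * exp (- A s') \<le> exp (- A s) - exp (- A s')"
      using mult_left_mono[OF e2, of "exp (- A s)"] by (simp add: es' algebra_simps)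
    have hi': "exp (- A s) - exp (- A s') \<le> h * exp (- A s)"
      using mult_left_mono[OF e1, of "exp (- A s)"] by (simp add: es' algebra_simps)
    \<comment> \<open>The increment of \<open>1 - exp (- A u)\<close> and the integral of
      \<open>?g\<close> both lie between \<open>h * exp (- A s')\<close> and
      \<open>h * exp (- A s)\<close>, so they differ by at most the length of that interval.\<close>
    have "\<bar>D s' - D s\<bar> \<le> h * exp (- A s) - h * exp (- A s')"
      using lo hi lo' hi' unfolding D_def * by linarith
    also have "\<dots> \<le> h * (h * exp (- A s))"
      using mult_left_mono[OF hi' h(1)] by (simp add: algebra_simps)
    also have "\<dots> \<le> h * (h * 1)"
      using h A_nonneg[of s] s by (intro mult_left_mono) auto
    also have "\<dots> \<le> (C * (s' - s)) * (C * (s' - s))"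
      using mult_mono[OF h(2) h(2)] h by simp
    finally show ?thesis by (simp add: power2_eq_square algebra_simps)
  qed
  have "(D has_field_derivative 0) (at s within {0..t})" if s: "s \<in> {0..t}" for s
    unfolding has_field_derivative_iff
  proof (rule Lim_null_comparison)
    show "\<forall>\<^sub>F y in at s within {0..t}. norm ((D y - D s) / (y - s)) \<le> C\<^sup>2 * \<bar>y - s\<bar>"
      unfolding eventually_at_filter
    proof (intro always_eventually allI impI)
      fix y assume y: "y \<noteq> s" "y \<in> {0..t}"
      have "\<bar>D y - D s\<bar> \<le> C\<^sup>2 * \<bar>y - s\<bar>\<^sup>2"
        using D_small[of s y] D_small[of y s] s y by (cases "s \<le> y") (auto simp: abs_minus_commute power2_commute)
      then show "norm ((D y - D s) / (y - s)) \<le> C\<^sup>2 * \<bar>y - s\<bar>"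
        using y by (simp add: divide_le_eq power2_eq_square mult.assoc)
    qed
    show "((\<lambda>y. C\<^sup>2 * \<bar>y - s\<bar>) \<longlongrightarrow> 0) (at s within {0..t})"
      by (intro tendsto_eq_intros | simp)+
  qed
  then obtain k where "\<And>s. s \<in> {0..t} \<Longrightarrow> D s = k"
    using has_field_derivative_zero_constant[of "{0..t}" D] by auto
  from this[of 0] this[of t] have "D t = 0" using t by (simp add: D_def A0)
  then show ?thesis using g_int by (simp add: D_def has_integral_iff)
qed

lemma integral_exp_neg_primitive:
  fixes a :: "real \<Rightarrow> real"
  assumes meas [measurable]: "a \<in> borel_measurable borel"
    and bound: "\<And>u. 0 \<le> u \<Longrightarrow> u \<le> t \<Longrightarrow> 0 \<le> a u \<and> a u \<le> C"
    and t: "0 \<le> t"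
  shows "set_integrable lborel {0..t} (\<lambda>u. a u * exp (- (LBINT v:{0..u}. a v)))" (is ?I)
    and "(LBINT u:{0..t}. a u * exp (- (LBINT v:{0..u}. a v))) = 1 - exp (- (LBINT v:{0..t}. a v))" (is ?E)
proof -
  have int: "set_integrable lborel {0..u} a" if "u \<le> t" for u
    unfolding set_integrable_def
    by (rule integrableI_bounded_set_indicator[where B=C])
      (use bound that in \<open>auto simp: emeasure_lborel_Icc_eq less_top[symmetric]\<close>)
  have eq: "(LBINT v:{0..u}. a v) = integral {0..u} a" if "u \<le> t" for u
    using set_borel_integral_eq_integral[OF int[OF that]] by simp
  have nonneg: "0 \<le> (LBINT v:{0..u}. a v)" if "u \<le> t" for u
    unfolding set_lebesgue_integral_def by (rule Bochner_Integration.integral_nonneg)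
      (use bound that in \<open>auto simp: indicator_def\<close>)
  have m: "(\<lambda>u. LBINT v:{0..u}. a v) \<in> borel_measurable borel"
  proof -
    have "(\<lambda>u. \<integral>v. indicator {x::real\<times>real. 0 \<le> snd x \<and> snd x \<le> fst x} (u, v) *\<^sub>R a v \<partial>lborel) \<in> borel_measurable borel"
      by measurable
    then show ?thesis by (simp add: set_lebesgue_integral_def indicator_def)
  qed
  show I: ?I
    unfolding set_integrable_def
  proof (rule integrableI_bounded_set_indicator[where B=C])
    show "AE u in lborel. u \<in> {0..t} \<longrightarrow> norm (a u * exp (- (LBINT v:{0..u}. a v))) \<le> C"
    proof (intro AE_I2 impI)
      fix u assume "u \<in> {0..t}"
      then show "norm (a u * exp (- (LBINT v:{0..u}. a v))) \<le> C"
        using bound[of u] nonneg[of u] mult_mono[of "a u" C "exp (- (LBINT v:{0..u}. a v))" 1] by auto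
    qed
  qed (use m in \<open>auto simp: emeasure_lborel_Icc_eq less_top[symmetric]\<close>)
  have "((\<lambda>u. a u * exp (- integral {0..u} a)) has_integral (1 - exp (- integral {0..t} a))) {0..t}"
    by (rule integral_exp_neg_primitive_HK[OF set_borel_integral_eq_integral(1)[OF int] _ bound t])
      (auto intro!: measurable_restrict_space1 measurable_completion)
  then have "((\<lambda>u. a u * exp (- (LBINT v:{0..u}. a v))) has_integral (1 - exp (- (LBINT v:{0..t}. a v)))) {0..t}"
    by (subst has_integral_cong[OF _ ]) (use eq in auto)
  then show ?E
    using set_borel_integral_eq_integral[OF I] by (simp add: has_integral_iff)
qed

section \<open>The killed process and its first passage times\<close>

context killed_spectrally_negative_Levy
begin

sublocale prob_space "P x" for x by (rule prob)

lemma space_P: "space (P x) = space (P 0)"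
  using sets_P by (rule sets_eq_imp_space_eq)

lemma space_F: "0 \<le> t \<Longrightarrow> space (F t) = space (P 0)"
  using filtration_sub by (simp add: subalgebra_def)

lemma subalgebra_P: "0 \<le> t \<Longrightarrow> subalgebra (P x) (F t)"
  using filtration_sub[of t] sets_P[of x] space_P[of x] by (simp add: subalgebra_def)

lemma measurable_P: "f \<in> F t \<rightarrow>\<^sub>M N \<Longrightarrow> 0 \<le> t \<Longrightarrow> f \<in> P x \<rightarrow>\<^sub>M N"
  using subalgebra_P by (rule measurable_from_subalg)

lemma measurable_F_mono: "f \<in> F s \<rightarrow>\<^sub>M N \<Longrightarrow> 0 \<le> s \<Longrightarrow> s \<le> t \<Longrightarrow> f \<in> F t \<rightarrow>\<^sub>M N"
  using filtration_mono by (rule measurable_from_subalg)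

lemma X_F: "0 \<le> s \<Longrightarrow> s \<le> t \<Longrightarrow> X s \<in> borel_measurable (F t)"
  by (rule measurable_F_mono[OF adapted])

lemma X_P [measurable]: "0 \<le> s \<Longrightarrow> X s \<in> borel_measurable (P x)"
  by (rule measurable_P[OF adapted])

lemma X_right: "\<omega> \<in> space (P x) \<Longrightarrow> 0 \<le> t \<Longrightarrow> ((\<lambda>t. X t \<omega>) \<longlongrightarrow> X t \<omega>) (at_right t)"
  using cadlag_paths[of \<omega>] space_P[of x] by (auto simp: cadlag_def)

lemma X_bounded:
  assumes "\<omega> \<in> space (P x)" "0 \<le> t"
  obtains B where "\<And>u. 0 \<le> u \<Longrightarrow> u \<le> t \<Longrightarrow> \<bar>X u \<omega>\<bar> \<le> B"
  using cadlag_bounded[OF cadlag_paths[of \<omega>]] assms space_P[of x] by metis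

text \<open>The strict inequality makes this indicator right-continuous in \<open>t\<close>, which
  the joint measurability arguments rely on.\<close>

definition alive :: "real \<Rightarrow> 'a \<Rightarrow> real" where
  "alive t \<omega> = indicator {\<omega>. ennreal t < e \<omega>} \<omega>"

lemma alive_F: "0 \<le> s \<Longrightarrow> s \<le> t \<Longrightarrow> alive s \<in> borel_measurable (F t)"
proof (rule measurable_F_mono[of _ s])
  assume s: "0 \<le> s"
  then have "Measurable.pred (F s) (\<lambda>\<omega>. e \<omega> \<le> ennreal s)"
    using e_stopping by (simp add: extended_stopping_time_def)
  then have [measurable]: "Measurable.pred (F s) (\<lambda>\<omega>. \<not> e \<omega> \<le> ennreal s)"
    by simp
  have "(\<lambda>\<omega>. of_bool (\<not> e \<omega> \<le> ennreal s) :: real) \<in> borel_measurable (F s)"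
    by measurable
  moreover have "(\<lambda>\<omega>. of_bool (\<not> e \<omega> \<le> ennreal s)) = alive s"
    by (auto simp: alive_def fun_eq_iff not_le)
  ultimately show "alive s \<in> borel_measurable (F s)"
    by simp
qed

lemma alive_P [measurable]: "0 \<le> s \<Longrightarrow> alive s \<in> borel_measurable (P x)"
  by (rule measurable_P[OF alive_F[OF _ order_refl]])

lemma alive_nonneg [simp]: "0 \<le> alive t \<omega>" and alive_le_1 [simp]: "alive t \<omega> \<le> 1"
  by (auto simp: alive_def)

lemma alive_right: "0 \<le> t \<Longrightarrow> ((\<lambda>t. alive t \<omega>) \<longlongrightarrow> alive t \<omega>) (at_right t)"
proof -
  assume t: "0 \<le> t"
  have "\<forall>\<^sub>F s in at_right t. alive s \<omega> = alive t \<omega>"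
  proof (cases "ennreal t < e \<omega>")
    case True
    obtain b where b: "t < b" "ennreal b \<le> e \<omega>"
    proof (cases "e \<omega>")
      case (real r)
      then show ?thesis using True t that[of r] by (simp add: ennreal_less_iff)
    next
      case top
      then show ?thesis using that[of "t + 1"] by simp
    qed
    have "alive s \<omega> = 1" if "t < s" "s < b" for s
    proof -
      have "ennreal s < ennreal b" using that t by (simp add: ennreal_lessI)
      then have "ennreal s < e \<omega>" using b(2) by (rule order_less_le_trans)
      then show ?thesis by (simp add: alive_def)
    qed
    moreover have "alive t \<omega> = 1" using True by (simp add: alive_def)
    ultimately show ?thesis
      unfolding eventually_at_right_field using b by auto
  next
    case False
    then have "alive s \<omega> = 0" if "t \<le> s" for s
      using that t order_trans[of "e \<omega>" "ennreal t" "ennreal s"] by (auto simp: alive_def indicator_def not_less ennreal_leI)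
    then show ?thesis
      unfolding eventually_at_right_field by (intro exI[of _ "t + 1"]) auto
  qed
  then show ?thesis by (rule tendsto_eventually)
qed

lemma e_P [measurable]: "e \<in> borel_measurable (P x)"
proof (rule borel_measurableI_le)
  fix y :: ennreal
  show "{\<omega> \<in> space (P x). e \<omega> \<le> y} \<in> sets (P x)"
  proof (cases y)
    case (real r)
    then have "Measurable.pred (F r) (\<lambda>\<omega>. e \<omega> \<le> ennreal r)"
      using e_stopping by (simp add: extended_stopping_time_def)
    then have "Measurable.pred (P x) (\<lambda>\<omega>. e \<omega> \<le> ennreal r)"
      using real by (intro measurable_P[of _ r]) auto
    then show ?thesis using real by (simp add: pred_def)
  qed simp
qed

text \<open>The killed Markov property in integrated form: a weight \<open>G\<close> from the past
  is moved inside the conditional expectation. Later arguments test against such weights, so that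
  conditional expectations do not occur again.\<close>

lemma e_memoryless_nn_integral:
  assumes "0 \<le> s" "0 \<le> t" and g: "g \<in> borel_measurable borel" and G: "G \<in> borel_measurable (F t)"
  shows "(\<integral>\<^sup>+\<omega>. G \<omega> * (g (X (t + s) \<omega> - X t \<omega>) * ennreal (alive (t + s) \<omega>)) \<partial>P x) =
    (\<integral>\<^sup>+\<omega>. G \<omega> * ennreal (alive t \<omega>) \<partial>P x) * ((\<integral>\<^sup>+\<omega>. g (X s \<omega>) \<partial>P 0) * ennreal (exp (- p * s)))"
proof -
  interpret S: finite_measure_subalgebra "P x" "F t"
    by (intro finite_measure_subalgebra.intro finite_measure_subalgebra_axioms.intro subalgebra_P assms)
      (use prob_space_axioms[of x] in \<open>simp add: prob_space.finite_measure\<close>)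
  define f where "f = (\<lambda>\<omega>. g (X (t + s) \<omega> - X t \<omega>) * indicator {\<omega>. ennreal (t + s) < e \<omega>} \<omega>)"
  have [measurable]: "X (t + s) \<in> borel_measurable (P x)" "X t \<in> borel_measurable (P x)"
    using assms by auto
  note [measurable] = g G alive_F[OF \<open>0 \<le> t\<close> order_refl]
  have "Measurable.pred (P x) (\<lambda>\<omega>. ennreal (t + s) < e \<omega>)" by measurable
  then have [measurable]: "f \<in> borel_measurable (P x)"
    unfolding f_def by measurable
  have fe: "f \<omega> = g (X (t + s) \<omega> - X t \<omega>) * ennreal (alive (t + s) \<omega>)" for \<omega>
    by (simp add: f_def alive_def indicator_def)
  have "(\<integral>\<^sup>+\<omega>. G \<omega> * f \<omega> \<partial>P x) = (\<integral>\<^sup>+\<omega>. G \<omega> * nn_cond_exp (P x) (F t) f \<omega> \<partial>P x)"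
    by (rule S.nn_cond_exp_intg[symmetric]) auto
  also have "\<dots> = (\<integral>\<^sup>+\<omega>. G \<omega> * ((\<integral>\<^sup>+\<omega>'. g (X s \<omega>') \<partial>P 0) * ennreal (exp (- p * s)) * indicator {\<omega>. ennreal t < e \<omega>} \<omega>) \<partial>P x)"
    by (rule nn_integral_cong_AE)
      (use e_memoryless[of s t g x] assms in \<open>auto simp: f_def elim!: eventually_mono\<close>)
  also have "\<dots> = (\<integral>\<^sup>+\<omega>. (G \<omega> * ennreal (alive t \<omega>)) * ((\<integral>\<^sup>+\<omega>. g (X s \<omega>) \<partial>P 0) * ennreal (exp (- p * s))) \<partial>P x)"
    by (rule nn_integral_cong) (simp add: alive_def indicator_def mult_ac)
  also have "\<dots> = (\<integral>\<^sup>+\<omega>. G \<omega> * ennreal (alive t \<omega>) \<partial>P x) * ((\<integral>\<^sup>+\<omega>. g (X s \<omega>) \<partial>P 0) * ennreal (exp (- p * s)))"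
    by (rule nn_integral_multc) (use measurable_P[OF G \<open>0 \<le> t\<close>] alive_P[OF \<open>0 \<le> t\<close>] in auto)
  finally show ?thesis by (simp only: fe)
qed

lemma X_0: "AE \<omega> in P x. X 0 \<omega> = x"
proof -
  let ?PM = "PiM {0..} (\<lambda>_. borel) :: (real \<Rightarrow> real) measure"
  have comp: "(\<lambda>f. f 0) \<in> borel_measurable ?PM"
    by (rule measurable_component_singleton) auto
  have m1: "(\<lambda>\<omega>. \<lambda>t\<in>{0..}. X t \<omega>) \<in> P x \<rightarrow>\<^sub>M ?PM"
    by (rule measurable_restrict) auto
  have m2: "(\<lambda>\<omega>. \<lambda>t\<in>{0..}. x + X t \<omega>) \<in> P 0 \<rightarrow>\<^sub>M ?PM"
    by (rule measurable_restrict) auto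
  have set: "{f \<in> space ?PM. f 0 = x} \<in> sets ?PM"
    using comp by measurable
  have "AE \<omega> in P 0. (\<lambda>t\<in>{0..}. x + X t \<omega>) (0::real) = x"
    using start by eventually_elim simp
  then have "AE f in distr (P 0) ?PM (\<lambda>\<omega>. \<lambda>t\<in>{0..}. x + X t \<omega>). f 0 = x"
    using AE_distr_iff[OF m2 set] by simp
  then have "AE f in distr (P x) ?PM (\<lambda>\<omega>. \<lambda>t\<in>{0..}. X t \<omega>). f 0 = x"
    by (simp only: law_translate)
  then show ?thesis
    using AE_distr_iff[OF m1 set] by simp
qed

lemma alive_0: "AE \<omega> in P x. alive 0 \<omega> = 1"
  using e_pos[of x] by eventually_elim (simp add: alive_def)

text \<open>The memoryless identity at time 0, where \<open>X 0 = x\<close> and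
  \<open>alive 0 = 1\<close> almost surely. It carries one-time laws from \<open>P x\<close> to
  \<open>P 0\<close>, and in the other direction it lets the killing be divided out through the
  factor \<open>exp (- p * s)\<close>.\<close>

lemma nn_integral_alive:
  assumes "0 \<le> s" and g: "g \<in> borel_measurable borel"
  shows "(\<integral>\<^sup>+\<omega>. g (X s \<omega>) * ennreal (alive s \<omega>) \<partial>P x) = (\<integral>\<^sup>+\<omega>. g (x + X s \<omega>) \<partial>P 0) * ennreal (exp (- p * s))"
proof -
  have "(\<integral>\<^sup>+\<omega>. g (X s \<omega>) * ennreal (alive s \<omega>) \<partial>P x) =
    (\<integral>\<^sup>+\<omega>. 1 * (g (x + (X (0 + s) \<omega> - X 0 \<omega>)) * ennreal (alive (0 + s) \<omega>)) \<partial>P x)"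
    by (rule nn_integral_cong_AE) (use X_0[of x] in \<open>eventually_elim, simp\<close>)
  also have "\<dots> = (\<integral>\<^sup>+\<omega>. 1 * ennreal (alive 0 \<omega>) \<partial>P x) * ((\<integral>\<^sup>+\<omega>. g (x + X s \<omega>) \<partial>P 0) * ennreal (exp (- p * s)))"
    by (rule e_memoryless_nn_integral) (use assms in measurable)
  also have "(\<integral>\<^sup>+\<omega>. 1 * ennreal (alive 0 \<omega>) \<partial>P x) = (\<integral>\<^sup>+\<omega>. 1 \<partial>P x)"
    by (rule nn_integral_cong_AE) (use alive_0[of x] in \<open>eventually_elim, simp\<close>)
  finally show ?thesis by (simp add: emeasure_space_1)
qed

lemma prob_alive: "0 \<le> s \<Longrightarrow> (\<integral>\<^sup>+\<omega>. ennreal (alive s \<omega>) \<partial>P x) = ennreal (exp (- p * s))"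
  using nn_integral_alive[of s "\<lambda>_. 1" x] by (simp add: emeasure_space_1)


section \<open>First passage above a level and its approximation by grid times\<close>

definition grid :: "real \<Rightarrow> nat \<Rightarrow> nat \<Rightarrow> real" where
  "grid t n k = real k * t / real (Suc n)"

text \<open>Cells are closed on the left and open on the right. So the grid point
  \<open>grid t n k\<close> lies strictly after the passage, and the event belongs to the past at
  that point, because \<tau> < s is decided by time s while \<tau> \<le> s need not be.\<close>

definition passage_in_cell :: "real \<Rightarrow> real \<Rightarrow> nat \<Rightarrow> nat \<Rightarrow> 'a set" where
  "passage_in_cell c t n k =
    {\<omega>. ennreal (grid t n (k - 1)) \<le> first_passage_above X c \<omega> \<and> first_passage_above X c \<omega> < ennreal (grid t n k)}"

lemma grid_nonneg: "0 \<le> t \<Longrightarrow> 0 \<le> grid t n k"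
  by (simp add: grid_def)

lemma grid_le: "0 \<le> t \<Longrightarrow> k \<le> Suc n \<Longrightarrow> grid t n k \<le> t"
  using mult_right_mono[of "real k" "real (Suc n)" t] by (simp add: grid_def divide_le_eq del: of_nat_Suc) (simp add: mult.commute)

lemma first_passage_less_iff:
  "first_passage_above X c \<omega> < ennreal t \<longleftrightarrow> (\<exists>s. 0 < s \<and> s < t \<and> X s \<omega> > c)"
proof
  assume "first_passage_above X c \<omega> < ennreal t"
  then obtain s where "0 < s" "X s \<omega> > c" "ennreal s < ennreal t"
    unfolding first_passage_above_def Inf_less_iff by auto
  then show "\<exists>s. 0 < s \<and> s < t \<and> X s \<omega> > c"
    by (metis ennreal_leI not_less)
next
  assume "\<exists>s. 0 < s \<and> s < t \<and> X s \<omega> > c"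
  then obtain s where s: "0 < s" "s < t" "X s \<omega> > c" by auto
  then have "ennreal s < ennreal t" by (simp add: ennreal_lessI)
  then show "first_passage_above X c \<omega> < ennreal t"
    unfolding first_passage_above_def Inf_less_iff using s by auto
qed

lemma before_first_passage: "0 < s \<Longrightarrow> ennreal s < first_passage_above X c \<omega> \<Longrightarrow> X s \<omega> \<le> c"
  using Inf_lower[of "ennreal s" "{ennreal t | t. 0 < t \<and> X t \<omega> > c}"]
  unfolding first_passage_above_def by (force simp: not_less)

text \<open>By right continuity, a path that exceeds \<open>c\<close> at some time before
  \<open>s\<close> does so at a rational time before \<open>s\<close>. Clipping the rational time to
  \<open>{0..t}\<close> only makes each member of the countable union measurable with respect to
  \<open>F t\<close>.\<close>

lemma first_passage_F: "0 \<le> t \<Longrightarrow> s \<le> t \<Longrightarrow> Measurable.pred (F t) (\<lambda>\<omega>. first_passage_above X c \<omega> < ennreal s)"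
proof -
  assume t: "0 \<le> t" "s \<le> t"
  have eq: "first_passage_above X c \<omega> < ennreal s \<longleftrightarrow> (\<exists>q::rat. (0 < q \<and> real_of_rat q < s) \<and> X (max 0 (min t (of_rat q))) \<omega> > c)"
    if \<omega>: "\<omega> \<in> space (F t)" for \<omega>
    unfolding first_passage_less_iff
  proof
    assume "\<exists>u>0. u < s \<and> c < X u \<omega>"
    then obtain u where u: "0 < u" "u < s" "c < X u \<omega>" by auto
    have "\<forall>\<^sub>F v in at_right u. c < X v \<omega>"
      by (rule order_tendstoD(1)[OF X_right u(3)]) (use \<omega> space_F[OF t(1)] u in auto)
    then obtain b where b: "b > u" "\<And>v. u < v \<Longrightarrow> v < b \<Longrightarrow> c < X v \<omega>"
      by (auto simp: eventually_at_right_field)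
    obtain q where q: "u < real_of_rat q" "real_of_rat q < min b s"
      using of_rat_dense[of u "min b s"] b u by auto
    with b(2)[of "real_of_rat q"] u t show "\<exists>q::rat. (0 < q \<and> real_of_rat q < s) \<and> X (max 0 (min t (of_rat q))) \<omega> > c"
      by (intro exI[of _ q]) (auto simp: zero_less_of_rat_iff[symmetric, where 'a=real] simp del: zero_less_of_rat_iff)
  next
    assume "\<exists>q::rat. (0 < q \<and> real_of_rat q < s) \<and> X (max 0 (min t (of_rat q))) \<omega> > c"
    then obtain q :: rat where "0 < q" "real_of_rat q < s" "X (max 0 (min t (of_rat q))) \<omega> > c" by auto
    then show "\<exists>u>0. u < s \<and> c < X u \<omega>"
      using t by (intro exI[of _ "real_of_rat q"]) auto
  qed
  moreover have "Measurable.pred (F t) (\<lambda>\<omega>. \<exists>q::rat. (0 < q \<and> real_of_rat q < s) \<and> X (max 0 (min t (of_rat q))) \<omega> > c)"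
    
  proof (rule pred_intros_countable)
    fix q
    have [measurable]: "X (max 0 (min t (of_rat q))) \<in> borel_measurable (F t)"
      using t by (intro X_F) auto
    show "Measurable.pred (F t) (\<lambda>\<omega>. (0 < q \<and> real_of_rat q < s) \<and> X (max 0 (min t (of_rat q))) \<omega> > c)"
      by measurable
  qed
  ultimately show ?thesis
    by (simp only: measurable_cong[OF eq])
qed

lemma first_passage_P [measurable]: "first_passage_above X c \<in> borel_measurable (P x)"
proof (rule borel_measurableI_less)
  fix y :: ennreal
  show "{\<omega> \<in> space (P x). first_passage_above X c \<omega> < y} \<in> sets (P x)"
  proof (cases y)
    case (real r)
    then show ?thesis using measurable_P[OF first_passage_F[of r r c], of x]
      by (simp add: pred_def)
  next
    case top
    have "first_passage_above X c \<omega> < y \<longleftrightarrow> (\<exists>n. first_passage_above X c \<omega> < ennreal (real n))" for \<omega>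
      using top by (cases "first_passage_above X c \<omega>") (auto simp: ennreal_less_iff reals_Archimedean2)
    moreover have "{\<omega> \<in> space (P x). \<exists>n. first_passage_above X c \<omega> < ennreal (real n)} \<in> sets (P x)"
    proof -
      have "Measurable.pred (P x) (\<lambda>\<omega>. first_passage_above X c \<omega> < ennreal (real n))" for n
        by (rule measurable_P[OF first_passage_F[of "real n" "real n" c]]) auto
      then have "Measurable.pred (P x) (\<lambda>\<omega>. \<exists>n. first_passage_above X c \<omega> < ennreal (real n))"
        by (rule pred_intros_countable)
      then show ?thesis by (simp add: pred_def)
    qed
    ultimately show ?thesis by simp
  qed
qed

lemma passage_in_cell_F:
  assumes "0 \<le> t"
  shows "(\<lambda>\<omega>. indicator (passage_in_cell c t n k) \<omega> :: real) \<in> borel_measurable (F (grid t n k))"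
proof -
  have le: "grid t n (k - 1) \<le> grid t n k"
    using assms by (auto simp: grid_def intro!: divide_right_mono mult_right_mono)
  have "Measurable.pred (F (grid t n k)) (\<lambda>\<omega>. \<not> first_passage_above X c \<omega> < ennreal (grid t n (k - 1)) \<and> first_passage_above X c \<omega> < ennreal (grid t n k))"
    by (intro pred_intros_logic first_passage_F grid_nonneg assms le order_refl)
  then have "(\<lambda>\<omega>. of_bool (\<not> first_passage_above X c \<omega> < ennreal (grid t n (k - 1)) \<and> first_passage_above X c \<omega> < ennreal (grid t n k)) :: real)
    \<in> borel_measurable (F (grid t n k))"
    by (rule measurable_compose[where N="count_space UNIV"]) simp
  moreover have "(\<lambda>\<omega>. of_bool (\<not> first_passage_above X c \<omega> < ennreal (grid t n (k - 1)) \<and> first_passage_above X c \<omega> < ennreal (grid t n k)))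
    = (\<lambda>\<omega>. indicator (passage_in_cell c t n k) \<omega> :: real)"
    by (auto simp: passage_in_cell_def indicator_def not_less fun_eq_iff)
  ultimately show ?thesis by simp
qed

definition stopped_time :: "real \<Rightarrow> real \<Rightarrow> 'a \<Rightarrow> real" where
  "stopped_time c t \<omega> = enn2real (min (ennreal t) (first_passage_above X c \<omega>))"

lemma stopped_time_P [measurable]: "stopped_time c t \<in> borel_measurable (P x)"
  unfolding stopped_time_def by measurable

lemma stopped_time_bounds:
  assumes "0 \<le> t" shows "0 \<le> stopped_time c t \<omega>" "stopped_time c t \<omega> \<le> t"
proof -
  show "stopped_time c t \<omega> \<le> t"
    unfolding stopped_time_def by (rule enn2real_leI) (use assms in auto)
qed (simp add: stopped_time_def)

lemma ennreal_stopped_time: "0 \<le> t \<Longrightarrow> ennreal (stopped_time c t \<omega>) = min (ennreal t) (first_passage_above X c \<omega>)"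
  unfolding stopped_time_def by (simp add: ennreal_enn2real_if min_def)

lemma stopped_time_eq: "0 \<le> t \<Longrightarrow> ennreal t \<le> first_passage_above X c \<omega> \<Longrightarrow> stopped_time c t \<omega> = t"
  by (simp add: stopped_time_def min_def)

lemma X_before_stopped:
  assumes "0 \<le> t" "0 \<le> u" "u < stopped_time c t \<omega>" "X 0 \<omega> \<le> c" shows "X u \<omega> \<le> c"
proof (cases "u = 0")
  case False
  have "ennreal u < ennreal (stopped_time c t \<omega>)" using assms by (simp add: ennreal_lessI)
  then show ?thesis using before_first_passage[of u c \<omega>] False assms(1,2) by (simp add: ennreal_stopped_time)
qed (use assms in simp)

text \<open>The path is at most \<open>c\<close> before the stopped time, hence so is its left limit
  there, and the path cannot jump upwards from that limit.\<close>

lemma X_stopped_le: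
  assumes \<omega>: "\<omega> \<in> space (P x)" and npj: "no_positive_jumps (\<lambda>t. X t \<omega>)"
    and X0: "X 0 \<omega> \<le> c" and t: "0 \<le> t"
  shows "X (stopped_time c t \<omega>) \<omega> \<le> c"
proof (cases "stopped_time c t \<omega> = 0")
  case False
  then have pos: "0 < stopped_time c t \<omega>" (is "0 < ?T") using stopped_time_bounds[OF t, of c \<omega>] by simp
  then obtain l where l: "((\<lambda>t. X t \<omega>) \<longlongrightarrow> l) (at_left ?T)"
    using cadlag_paths[of \<omega>] \<omega> space_P[of x] by (auto simp: cadlag_def)
  have "\<forall>\<^sub>F u in at_left ?T. X u \<omega> \<le> c"
    unfolding eventually_at_left_field
    using X_before_stopped[OF t _ _ X0] pos by (intro exI[of _ 0]) auto
  then have "l \<le> c" by (rule tendsto_upperbound[OF l]) simp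
  moreover have "X ?T \<omega> \<le> l" using npj l pos by (auto simp: no_positive_jumps_def)
  ultimately show ?thesis by simp
qed (use X0 in simp)

text \<open>No overshoot. A value below \<open>c\<close> at the passage time would, by right
  continuity, persist for a while, and then the infimum defining the passage time would be
  larger.\<close>

lemma X_stopped_eq:
  assumes \<omega>: "\<omega> \<in> space (P x)" and npj: "no_positive_jumps (\<lambda>t. X t \<omega>)"
    and X0: "X 0 \<omega> \<le> c" and t: "0 \<le> t" and less: "first_passage_above X c \<omega> < ennreal t"
  shows "X (stopped_time c t \<omega>) \<omega> = c"
proof -
  let ?T = "stopped_time c t \<omega>"
  have T: "first_passage_above X c \<omega> = ennreal ?T"
    using less t by (simp add: ennreal_stopped_time min.absorb2 less_imp_le)
  have "\<not> X ?T \<omega> < c"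
  proof
    assume "X ?T \<omega> < c"
    then have "\<forall>\<^sub>F u in at_right ?T. X u \<omega> < c"
      by (rule order_tendstoD(2)[OF X_right[OF \<omega> stopped_time_bounds(1)[OF t]]])
    then obtain b where b: "b > ?T" "\<And>u. ?T < u \<Longrightarrow> u < b \<Longrightarrow> X u \<omega> < c"
      by (auto simp: eventually_at_right_field)
    have "first_passage_above X c \<omega> < ennreal b"
      using b stopped_time_bounds(1)[OF t, of c \<omega>] by (simp add: T ennreal_lessI)
    then obtain s where s: "0 < s" "s < b" "X s \<omega> > c" by (auto simp: first_passage_less_iff)
    show False
    proof (cases "s < ?T")
      case True
      then show ?thesis using X_before_stopped[OF t _ True X0] s by simp
    next
      case False
      then show ?thesis using b(2)[of s] s \<open>X ?T \<omega> < c\<close> by (cases "s = ?T") auto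
    qed
  qed
  with X_stopped_le[OF \<omega> npj X0 t] show ?thesis by simp
qed

text \<open>Exactly one cell contains the passage time. Its right end point lies strictly to the
  right of that time, at distance at most \<open>t / real (Suc n)\<close>, so the sum is the value
  of \<open>\<Psi>\<close> at a point tending to the passage time from the right.\<close>

lemma grid_limit:
  fixes \<Psi> :: "real \<Rightarrow> real"
  assumes t: "0 < t" and less: "first_passage_above X c \<omega> < ennreal t"
    and lim: "(\<Psi> \<longlongrightarrow> L) (at_right (stopped_time c t \<omega>))"
  shows "(\<lambda>n. \<Sum>k=1..Suc n. indicator (passage_in_cell c t n k) \<omega> * \<Psi> (grid t n k)) \<longlonglongrightarrow> L"
proof -
  define T where "T = stopped_time c t \<omega>"
  have T: "first_passage_above X c \<omega> = ennreal T" and T0: "0 \<le> T"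
    using less t stopped_time_bounds(1)[of t c \<omega>] by (auto simp: T_def ennreal_stopped_time min_def)
  have Tt: "T < t" using less T T0 t by (simp add: ennreal_less_iff)
  \<comment> \<open>\<open>N n\<close> complete cells precede the passage time; the cell containing
    it is number \<open>N n + 1\<close>, cells being counted from 1.\<close>
  define N where "N n = nat \<lfloor>real (Suc n) * T / t\<rfloor>" for n
  define K where "K n = N n + 1" for n
  have fl: "real (N n) \<le> real (Suc n) * T / t" "real (Suc n) * T / t < real (N n) + 1" for n
    unfolding N_def using T0 t by (auto simp del: of_nat_Suc)
  have cell: "\<omega> \<in> passage_in_cell c t n k \<longleftrightarrow> k = K n" if "1 \<le> k" for n k
  proof -
    have "\<omega> \<in> passage_in_cell c t n k \<longleftrightarrow> grid t n (k - 1) \<le> T \<and> T < grid t n k"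
      using T0 t by (simp add: passage_in_cell_def T ennreal_le_iff ennreal_less_iff grid_nonneg)
    also have "\<dots> \<longleftrightarrow> real (k - 1) \<le> real (Suc n) * T / t \<and> real (Suc n) * T / t < real k"
      using t by (simp add: grid_def field_simps del: of_nat_Suc)
    also have "\<dots> \<longleftrightarrow> k = K n"
    proof
      assume h: "real (k - 1) \<le> real (Suc n) * T / t \<and> real (Suc n) * T / t < real k"
      have "real (k - 1) < real (N n + 1)" using h fl(2)[of n] unfolding K_def by linarith
      moreover have "real (K n - 1) < real k" using h fl(1)[of n] unfolding K_def by simp
      ultimately show "k = K n" using that unfolding K_def by (simp only: of_nat_less_iff)
    next
      assume "k = K n"
      then show "real (k - 1) \<le> real (Suc n) * T / t \<and> real (Suc n) * T / t < real k"
        using fl[of n] unfolding K_def by simp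
    qed
    finally show ?thesis .
  qed
  have K_le: "K n \<le> Suc n" for n
  proof -
    have "real (Suc n) * T / t < real (Suc n)" using Tt T0 t by (simp add: divide_less_eq del: of_nat_Suc)
    then have "real (N n) < real (Suc n)" using fl(1)[of n] by linarith
    then show ?thesis unfolding K_def by simp
  qed
  have sum: "(\<Sum>k=1..Suc n. indicator (passage_in_cell c t n k) \<omega> * \<Psi> (grid t n k)) = \<Psi> (grid t n (K n))" for n
  proof -
    have "(\<Sum>k=1..Suc n. indicator (passage_in_cell c t n k) \<omega> * \<Psi> (grid t n k)) =
      (\<Sum>k=1..Suc n. if k = K n then \<Psi> (grid t n k) else 0)"
      by (rule sum.cong) (auto simp: indicator_def cell)
    then show ?thesis using K_le[of n] by (simp add: K_def)
  qed
  have KN: "real (K n) = real (N n) + 1" for n by (simp add: K_def)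
  have gt: "T < grid t n (K n)" and ub: "grid t n (K n) \<le> T + t / real (Suc n)" for n
    using fl[of n] t by (simp_all add: grid_def KN field_simps del: of_nat_Suc)
  have "(\<lambda>n. T + t / real (Suc n)) \<longlonglongrightarrow> T"
    using tendsto_add[OF tendsto_const[of T] tendsto_mult[OF tendsto_const[of t] lim_1_over_n[THEN LIMSEQ_Suc]]]
    by simp
  then have "(\<lambda>n. grid t n (K n)) \<longlonglongrightarrow> T"
    by (rule tendsto_sandwich[rotated 2, OF tendsto_const]) (use gt ub in \<open>auto intro!: always_eventually less_imp_le\<close>)
  then have "filterlim (\<lambda>n. grid t n (K n)) (at_right T) sequentially"
    unfolding filterlim_at using gt by (auto simp: less_imp_neq[symmetric])
  then have "(\<lambda>n. \<Psi> (grid t n (K n))) \<longlonglongrightarrow> L"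
    using lim unfolding T_def[symmetric] by (rule filterlim_compose[rotated])
  then show ?thesis by (simp only: sum)
qed

lemma grid_sum_eq_0:
  assumes "0 \<le> t" "ennreal t \<le> first_passage_above X c \<omega>"
  shows "(\<Sum>k=1..Suc n. indicator (passage_in_cell c t n k) \<omega> * \<Psi> k) = (0::real)"
proof (rule sum.neutral, intro ballI)
  fix k assume "k \<in> {1..Suc n}"
  then have "ennreal (grid t n k) \<le> ennreal t" using grid_le[of t k n] assms by (intro ennreal_leI) auto
  then have "ennreal (grid t n k) \<le> first_passage_above X c \<omega>" using assms(2) by (rule order_trans)
  then show "indicator (passage_in_cell c t n k) \<omega> * \<Psi> k = 0"
    by (simp add: passage_in_cell_def indicator_def not_less)
qed

text \<open>The cells are disjoint, so at most one term is nonzero. The bound does not grow with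
  \<open>n\<close>, which is what dominated convergence asks for.\<close>

lemma grid_sum_le:
  fixes \<Psi> :: "nat \<Rightarrow> real"
  assumes "\<And>k. 1 \<le> k \<Longrightarrow> k \<le> Suc n \<Longrightarrow> \<bar>\<Psi> k\<bar> \<le> B" "0 \<le> B" "0 \<le> t"
  shows "\<bar>\<Sum>k=1..Suc n. indicator (passage_in_cell c t n k) \<omega> * \<Psi> k\<bar> \<le> B"
proof (cases "\<exists>k\<in>{1..Suc n}. \<omega> \<in> passage_in_cell c t n k")
  case True
  then obtain j where j: "j \<in> {1..Suc n}" "\<omega> \<in> passage_in_cell c t n j" by blast
  have uniq: "k = j" if "k \<in> {1..Suc n}" "\<omega> \<in> passage_in_cell c t n k" for k
  proof -
    have False if "k < j" "\<omega> \<in> passage_in_cell c t n j" "\<omega> \<in> passage_in_cell c t n k" for j k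
    proof -
      have "grid t n k \<le> grid t n (j - 1)"
        using that assms by (auto simp: grid_def intro!: divide_right_mono mult_right_mono)
      then have "ennreal (grid t n k) \<le> ennreal (grid t n (j - 1))" by (rule ennreal_leI)
      then show False using that by (auto simp: passage_in_cell_def)
    qed
    then show ?thesis using that(2) j(2) linorder_neqE_nat[of k j] by blast
  qed
  have "(\<Sum>k=1..Suc n. indicator (passage_in_cell c t n k) \<omega> * \<Psi> k) = (\<Sum>k=1..Suc n. if k = j then \<Psi> k else 0)"
  proof (rule sum.cong)
    fix k assume k: "k \<in> {1..Suc n}"
    show "indicator (passage_in_cell c t n k) \<omega> * \<Psi> k = (if k = j then \<Psi> k else 0)"
      using uniq[OF k] j(2) by (cases "\<omega> \<in> passage_in_cell c t n k") auto
  qed simp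
  then show ?thesis using j assms by simp
next
  case False
  then have "(\<Sum>k=1..Suc n. indicator (passage_in_cell c t n k) \<omega> * \<Psi> k) = 0"
    by (intro sum.neutral) (auto simp: indicator_def)
  then show ?thesis using assms by simp
qed

end

section \<open>Exponential moments\<close>

text \<open>Cauchy's functional equation under a one-sided local bound. The function
  \<open>b\<close> vanishes at all multiples of \<open>1 / M\<close>, so its values everywhere are
  values on a short interval and it is bounded above. Then \<open>b (n t) = n b t\<close> forces
  \<open>b \<le> 0\<close>, and \<open>b t + b (N - t) = 0\<close> forces equality.\<close>

lemma additive_bounded_above_imp_linear:
  fixes a :: "real \<Rightarrow> real"
  assumes add: "\<And>s t. 0 \<le> s \<Longrightarrow> 0 \<le> t \<Longrightarrow> a (s + t) = a s + a t"
    and bound: "\<And>t. 0 \<le> t \<Longrightarrow> t \<le> t0 \<Longrightarrow> a t \<le> C" and t0: "0 < t0"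
    and t: "0 \<le> t"
  shows "a t = t * a 1"
proof -
  define b where "b t = a t - t * a 1" for t
  have b_add: "b (s + t) = b s + b t" if "0 \<le> s" "0 \<le> t" for s t
    using add[OF that] by (simp add: b_def algebra_simps)
  have b_0: "b 0 = 0" using b_add[of 0 0] by simp
  have b_mult: "b (real n * t) = real n * b t" if "0 \<le> t" for n t
    by (induction n) (use that in \<open>auto simp: b_0 b_add algebra_simps\<close>)
  have b_1: "b 1 = 0" by (simp add: b_def)
  obtain M :: nat where M: "0 < M" "1 / real M < t0"
    using reals_Archimedean[OF t0] by (metis inverse_eq_divide zero_less_Suc)
  have "real M * b (1 / real M) = 0"
    using b_mult[of "1 / real M" M] b_1 M by simp
  then have b_M: "b (real j * (1 / real M)) = 0" for j
    using b_mult[of "1 / real M" j] M by simp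
  have b_ub: "b t \<le> C + t0 * \<bar>a 1\<bar>" if "0 \<le> t" for t
  proof -
    define r where "r = real (nat \<lfloor>t * real M\<rfloor>) * (1 / real M)"
    have r: "r \<le> t" "t - r \<le> 1 / real M"
      using M that by (auto simp: r_def divide_le_eq diff_le_eq)
        (simp add: add_divide_distrib[symmetric] le_divide_eq, linarith)
    have "b t = b r + b (t - r)" using b_add[of r "t - r"] r by (simp add: r_def)
    also have "\<dots> = b (t - r)" using b_M by (simp add: r_def)
    also have "\<dots> \<le> C + t0 * \<bar>a 1\<bar>"
    proof -
      have "a (t - r) \<le> C" using r M by (intro bound) auto
      moreover have "- ((t - r) * a 1) \<le> t0 * \<bar>a 1\<bar>"
      proof -
        have "- ((t - r) * a 1) \<le> \<bar>(t - r) * a 1\<bar>" by linarith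
        also have "\<dots> = (t - r) * \<bar>a 1\<bar>" using r by (simp add: abs_mult)
        also have "\<dots> \<le> t0 * \<bar>a 1\<bar>" using r M by (intro mult_right_mono) auto
        finally show ?thesis .
      qed
      ultimately show ?thesis by (simp add: b_def)
    qed
    finally show ?thesis .
  qed
  have b_le: "b t \<le> 0" if "0 \<le> t" for t
  proof (rule ccontr)
    assume "\<not> b t \<le> 0"
    then obtain n where "C + t0 * \<bar>a 1\<bar> < real n * b t"
      using reals_Archimedean3[of "b t"] by auto
    then show False using b_ub[of "real n * t"] b_mult[OF that, of n] that by simp
  qed
  obtain N :: nat where N: "t \<le> real N" using real_arch_simple by blast
  have "0 = b t + b (real N - t)"
    using b_add[of t "real N - t"] b_mult[of 1 N] b_1 N t by simp
  then have "b t = 0" using b_le[OF t] b_le[of "real N - t"] N by simp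
  then show ?thesis by (simp add: b_def)
qed

context killed_spectrally_negative_Levy
begin

text \<open>Stochastic continuity at 0, from right continuity of the paths and dominated
  convergence. The uniformity over \<open>s \<le> t0\<close> matters: it is applied to the random
  time remaining after a passage.\<close>

lemma prob_away_from_start:
  assumes "0 < \<delta>" "0 < \<epsilon>"
  obtains t0 where "0 < t0" "\<And>s. 0 \<le> s \<Longrightarrow> s \<le> t0 \<Longrightarrow> measure (P 0) {\<omega> \<in> space (P 0). \<delta> < \<bar>X s \<omega>\<bar>} \<le> \<epsilon>"
proof -
  define \<mu> where "\<mu> s = measure (P 0) {\<omega> \<in> space (P 0). \<delta> < \<bar>X s \<omega>\<bar>}" for s
  have \<mu>: "\<mu> s = (\<integral>\<omega>. indicator {\<delta><..} \<bar>X s \<omega>\<bar> \<partial>P 0)" if "0 \<le> s" for s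
  proof -
    have "\<mu> s = (\<integral>\<omega>. indicator {\<omega> \<in> space (P 0). \<delta> < \<bar>X s \<omega>\<bar>} \<omega> \<partial>P 0)"
      by (simp add: \<mu>_def Int_absorb2 subset_eq)
    also have "\<dots> = (\<integral>\<omega>. indicator {\<delta><..} \<bar>X s \<omega>\<bar> \<partial>P 0)"
      by (rule Bochner_Integration.integral_cong) (auto simp: indicator_def)
    finally show ?thesis .
  qed
  have "(\<mu> \<longlongrightarrow> 0) (at_right 0)"
  proof (rule tendsto_at_right_sequentially[of 0 1])
    fix S :: "nat \<Rightarrow> real" assume S: "\<And>n. 0 < S n" "S \<longlonglongrightarrow> 0"
    have "(\<lambda>n. \<integral>\<omega>. indicator {\<delta><..} \<bar>X (S n) \<omega>\<bar> \<partial>P 0) \<longlonglongrightarrow> (\<integral>\<omega>. 0 \<partial>P 0 :: real)"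
    proof (rule integral_dominated_convergence[where w="\<lambda>_. 1"])
      show "AE \<omega> in P 0. (\<lambda>n. indicator {\<delta><..} \<bar>X (S n) \<omega>\<bar>) \<longlonglongrightarrow> (0::real)"
        using start AE_space
      proof eventually_elim
        case (elim \<omega>)
        have "filterlim S (at_right 0) sequentially"
          unfolding filterlim_at using S by (auto simp: less_imp_neq[symmetric])
        then have "(\<lambda>n. X (S n) \<omega>) \<longlonglongrightarrow> X 0 \<omega>"
          by (rule filterlim_compose[OF X_right[OF elim(2) order_refl]])
        then have "(\<lambda>n. \<bar>X (S n) \<omega>\<bar>) \<longlonglongrightarrow> 0"
          using elim(1) tendsto_rabs_zero_iff by metis
        then have "\<forall>\<^sub>F n in sequentially. \<bar>X (S n) \<omega>\<bar> < \<delta>"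
          by (rule order_tendstoD(2)) (rule assms)
        then show ?case
          by (intro tendsto_eventually) (auto elim!: eventually_mono)
      qed
      have [measurable]: "X (S n) \<in> borel_measurable (P 0)" for n using S(1)[of n] by auto
      show "(\<lambda>\<omega>. indicator {\<delta><..} \<bar>X (S n) \<omega>\<bar> :: real) \<in> borel_measurable (P 0)" for n
        by measurable
    qed auto
    then show "(\<lambda>n. \<mu> (S n)) \<longlonglongrightarrow> 0"
      using S(1) by (simp add: \<mu> less_imp_le)
  qed simp
  then have "\<forall>\<^sub>F s in at_right 0. \<mu> s < \<epsilon>"
    by (rule order_tendstoD(2)) (rule assms)
  then obtain b where b: "0 < b" "\<And>s. 0 < s \<Longrightarrow> s < b \<Longrightarrow> \<mu> s < \<epsilon>"
    by (auto simp: eventually_at_right_field)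
  have "\<mu> 0 = 0"
  proof -
    have "\<mu> 0 = (\<integral>\<omega>. 0 \<partial>P 0)"
      unfolding \<mu>[OF order_refl] using start assms
      by (intro integral_cong_AE) (auto elim!: eventually_mono)
    then show ?thesis by simp
  qed
  then have "\<mu> s \<le> \<epsilon>" if "0 \<le> s" "s \<le> b / 2" for s
    using b(1) b(2)[of s] that assms by (cases "s = 0") auto
  then show ?thesis using b(1) that[of "b / 2"] unfolding \<mu>_def by auto
qed

text \<open>Without an upward jump at \<open>t\<close>, the left limit at \<open>t\<close> is
  already above \<open>c\<close>, so the level is exceeded strictly before \<open>t\<close>. The
  strict inequality is what places the passage in a cell of the grid.\<close>

lemma above_imp_first_passage:
  assumes "\<omega> \<in> space (P x)" "no_positive_jumps (\<lambda>t. X t \<omega>)" "0 < t" "c < X t \<omega>"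
  shows "first_passage_above X c \<omega> < ennreal t"
proof -
  obtain l where l: "((\<lambda>t. X t \<omega>) \<longlongrightarrow> l) (at_left t)"
    using cadlag_paths[of \<omega>] assms space_P[of x] by (auto simp: cadlag_def)
  then have "c < l" using assms(2-4) by (auto simp: no_positive_jumps_def intro: order_less_le_trans)
  then have "\<forall>\<^sub>F u in at_left t. c < X u \<omega>" by (rule order_tendstoD(1)[OF l])
  then obtain b where b: "b < t" "\<And>u. b < u \<Longrightarrow> u < t \<Longrightarrow> c < X u \<omega>"
    by (auto simp: eventually_at_left_field)
  obtain u where "max b 0 < u" "u < t" using dense[of "max b 0" t] b(1) assms(3) by auto
  then show ?thesis unfolding first_passage_less_iff using b(2)[of u] by auto
qed

text \<open>On \<open>X t > a + 1\<close> the path crosses level \<open>a\<close> before \<open>t\<close> and then increases by more than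
  \<open>1/2\<close>, whereas from level \<open>a\<close> it stays above \<open>a - 1\<close> with probability at least \<open>1/2\<close>.\<close>

lemma tail_recursion:
  assumes small: "\<And>s. 0 \<le> s \<Longrightarrow> s \<le> t \<Longrightarrow> measure (P 0) {\<omega> \<in> space (P 0). 1 / 2 < \<bar>X s \<omega>\<bar>} \<le> \<epsilon>"
    and \<epsilon>: "\<epsilon> \<le> 1 / 2" and t: "0 < t" and a: "0 \<le> a"
  shows "(\<integral>\<^sup>+\<omega>. indicator {a + 1<..} (X t \<omega>) \<partial>P 0) \<le> ennreal (2 * \<epsilon>) * (\<integral>\<^sup>+\<omega>. indicator {a - 1<..} (X t \<omega>) \<partial>P 0)"
proof -
  have t': "0 \<le> t" using t by simp
  have \<epsilon>0: "0 \<le> \<epsilon>" using small[of 0] t by (meson measure_nonneg order_trans less_imp_le order_refl)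
  have up: "(\<integral>\<^sup>+\<omega>. indicator {1/2<..} (X s \<omega>) \<partial>P 0) \<le> ennreal \<epsilon>" if s: "0 \<le> s" "s \<le> t" for s
  proof -
    have [measurable]: "X s \<in> borel_measurable (P 0)" using s by auto
    have "(\<integral>\<^sup>+\<omega>. indicator {1/2<..} (X s \<omega>) \<partial>P 0) \<le> (\<integral>\<^sup>+\<omega>. indicator {\<omega> \<in> space (P 0). 1 / 2 < \<bar>X s \<omega>\<bar>} \<omega> \<partial>P 0)"
      by (rule nn_integral_mono) (auto simp: indicator_def)
    also have "\<dots> \<le> ennreal \<epsilon>" using small[OF s] by (simp add: emeasure_eq_measure ennreal_leI)
    finally show ?thesis .
  qed
  have down: "ennreal (1 / 2) \<le> (\<integral>\<^sup>+\<omega>. indicator {-1/2..} (X s \<omega>) \<partial>P 0)" if s: "0 \<le> s" "s \<le> t" for s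
  proof -
    have [measurable]: "X s \<in> borel_measurable (P 0)" using s by auto
    have "1 / 2 \<le> 1 - measure (P 0) {\<omega> \<in> space (P 0). 1 / 2 < \<bar>X s \<omega>\<bar>}"
      using small[OF s] \<epsilon> by simp
    also have "\<dots> = measure (P 0) {\<omega> \<in> space (P 0). \<not> 1 / 2 < \<bar>X s \<omega>\<bar>}"
      by (rule prob_neg[symmetric]) measurable
    finally have "ennreal (1 / 2) \<le> ennreal (measure (P 0) {\<omega> \<in> space (P 0). \<not> 1 / 2 < \<bar>X s \<omega>\<bar>})"
      by (rule ennreal_leI)
    also have "\<dots> = (\<integral>\<^sup>+\<omega>. indicator {\<omega> \<in> space (P 0). \<not> 1 / 2 < \<bar>X s \<omega>\<bar>} \<omega> \<partial>P 0)"
      by (subst nn_integral_indicator) (measurable, simp only: emeasure_eq_measure)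
    also have "\<dots> \<le> (\<integral>\<^sup>+\<omega>. indicator {-1/2..} (X s \<omega>) \<partial>P 0)"
      by (rule nn_integral_mono) (auto simp: indicator_def)
    finally show ?thesis .
  qed
  \<comment> \<open>At the grid time after the passage, \<open>X\<close> is close to
    \<open>a\<close> but need not equal it. The window of radius 1/2 compensates: reaching more than
    \<open>a + 1\<close> from inside it takes an increment above 1/2, and an increment of at least
    -1/2 leaves the path above \<open>a - 1\<close>.\<close>
  define H where "H n k \<omega> = indicator (passage_in_cell a t n k) \<omega> * (indicator {a - 1/2<..<a + 1/2} (X (grid t n k) \<omega>) :: real)" for n k \<omega>
  have H_F: "H n k \<in> borel_measurable (F (grid t n k))" for n k
    unfolding H_def using passage_in_cell_F[OF t', of a n k] X_F[OF grid_nonneg[OF t'] order_refl, of n k]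
    by measurable
  have H_nonneg [simp]: "0 \<le> H n k \<omega>" for n k \<omega> by (simp add: H_def)
  \<comment> \<open>The factor \<open>alive t\<close> is present because the Markov property is
    available only for the killed process; it contributes \<open>exp (- p * t)\<close> to both sides
    of the final inequality, where it cancels.\<close>
  define S where "S g n \<omega> = (\<Sum>k=1..Suc n. indicator (passage_in_cell a t n k) \<omega> *
     (indicator {a - 1/2<..<a + 1/2} (X (grid t n k) \<omega>) * g (X t \<omega> - X (grid t n k) \<omega>) * alive t \<omega>))"
    for g :: "real \<Rightarrow> real" and n \<omega>
  have S_int: "(\<integral>\<^sup>+\<omega>. ennreal (S g n \<omega>) \<partial>P 0) = (\<Sum>k=1..Suc n. (\<integral>\<^sup>+\<omega>. ennreal (H n k \<omega>) * ennreal (alive (grid t n k) \<omega>) \<partial>P 0) *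
      ((\<integral>\<^sup>+\<omega>. ennreal (g (X (t - grid t n k) \<omega>)) \<partial>P 0) * ennreal (exp (- p * (t - grid t n k)))))"
    if g [measurable]: "g \<in> borel_measurable borel" and g0: "\<And>y. 0 \<le> g y" for g n
  proof -
    have "(\<integral>\<^sup>+\<omega>. ennreal (S g n \<omega>) \<partial>P 0) = (\<integral>\<^sup>+\<omega>. (\<Sum>k=1..Suc n. ennreal (H n k \<omega>) * (ennreal (g (X (grid t n k + (t - grid t n k)) \<omega> - X (grid t n k) \<omega>)) * ennreal (alive (grid t n k + (t - grid t n k)) \<omega>))) \<partial>P 0)"
    proof (rule nn_integral_cong)
      fix \<omega>
      have "(\<Sum>k=1..Suc n. ennreal (H n k \<omega>) * (ennreal (g (X (grid t n k + (t - grid t n k)) \<omega> - X (grid t n k) \<omega>)) * ennreal (alive (grid t n k + (t - grid t n k)) \<omega>)))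
        = (\<Sum>k=1..Suc n. ennreal (H n k \<omega> * (g (X t \<omega> - X (grid t n k) \<omega>) * alive t \<omega>)))"
        using g0 by (intro sum.cong) (simp_all add: ennreal_mult')
      also have "\<dots> = ennreal (\<Sum>k=1..Suc n. H n k \<omega> * (g (X t \<omega> - X (grid t n k) \<omega>) * alive t \<omega>))"
        using g0 by (intro sum_ennreal) simp
      also have "\<dots> = ennreal (S g n \<omega>)"
        unfolding S_def H_def by (intro arg_cong[where f=ennreal] sum.cong refl) (simp only: mult.assoc)
      finally show "ennreal (S g n \<omega>) = (\<Sum>k=1..Suc n. ennreal (H n k \<omega>) * (ennreal (g (X (grid t n k + (t - grid t n k)) \<omega> - X (grid t n k) \<omega>)) * ennreal (alive (grid t n k + (t - grid t n k)) \<omega>)))"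
        by (rule sym)
    qed
    also have "\<dots> = (\<Sum>k=1..Suc n. \<integral>\<^sup>+\<omega>. ennreal (H n k \<omega>) * (ennreal (g (X (grid t n k + (t - grid t n k)) \<omega> - X (grid t n k) \<omega>)) * ennreal (alive (grid t n k + (t - grid t n k)) \<omega>)) \<partial>P 0)"
    proof (rule nn_integral_sum)
      fix k assume "k \<in> {1..Suc n}"
      have [measurable]: "H n k \<in> borel_measurable (P 0)"
        by (rule measurable_P[OF H_F grid_nonneg[OF t']])
      have [measurable]: "X t \<in> borel_measurable (P 0)" "X (grid t n k) \<in> borel_measurable (P 0)" "alive t \<in> borel_measurable (P 0)"
        using t' grid_nonneg[OF t'] by auto
      show "(\<lambda>\<omega>. ennreal (H n k \<omega>) * (ennreal (g (X (grid t n k + (t - grid t n k)) \<omega> - X (grid t n k) \<omega>)) * ennreal (alive (grid t n k + (t - grid t n k)) \<omega>))) \<in> borel_measurable (P 0)"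
        by simp
    qed
    also have "\<dots> = (\<Sum>k=1..Suc n. (\<integral>\<^sup>+\<omega>. ennreal (H n k \<omega>) * ennreal (alive (grid t n k) \<omega>) \<partial>P 0) *
      ((\<integral>\<^sup>+\<omega>. ennreal (g (X (t - grid t n k) \<omega>)) \<partial>P 0) * ennreal (exp (- p * (t - grid t n k)))))"
    proof (rule sum.cong)
      fix k assume k: "k \<in> {1..Suc n}"
      show "(\<integral>\<^sup>+\<omega>. ennreal (H n k \<omega>) * (ennreal (g (X (grid t n k + (t - grid t n k)) \<omega> - X (grid t n k) \<omega>)) * ennreal (alive (grid t n k + (t - grid t n k)) \<omega>)) \<partial>P 0) = (\<integral>\<^sup>+\<omega>. ennreal (H n k \<omega>) * ennreal (alive (grid t n k) \<omega>) \<partial>P 0) *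
      ((\<integral>\<^sup>+\<omega>. ennreal (g (X (t - grid t n k) \<omega>)) \<partial>P 0) * ennreal (exp (- p * (t - grid t n k))))"
        by (rule e_memoryless_nn_integral[where g="\<lambda>y. ennreal (g y)" and G="\<lambda>\<omega>. ennreal (H n k \<omega>)"])
          (use grid_nonneg[OF t'] grid_le[OF t', of k n] k H_F in auto)
    qed simp
    finally show ?thesis .
  qed
  let ?up = "indicator {1/2<..} :: real \<Rightarrow> real" and ?down = "indicator {-1/2..} :: real \<Rightarrow> real"
  have up_down: "(\<integral>\<^sup>+\<omega>. ennreal (S ?up n \<omega>) \<partial>P 0) \<le> ennreal (2 * \<epsilon>) * (\<integral>\<^sup>+\<omega>. ennreal (S ?down n \<omega>) \<partial>P 0)" for n
  proof -
    have q: "(\<integral>\<^sup>+\<omega>. ennreal (?up (X s \<omega>)) \<partial>P 0) \<le> ennreal (2 * \<epsilon>) * (\<integral>\<^sup>+\<omega>. ennreal (?down (X s \<omega>)) \<partial>P 0)"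
      if s: "0 \<le> s" "s \<le> t" for s
    proof -
      have "(\<integral>\<^sup>+\<omega>. ennreal (?up (X s \<omega>)) \<partial>P 0) \<le> ennreal \<epsilon>"
        using up[OF s] by (simp add: ennreal_indicator)
      also have "\<dots> = ennreal (2 * \<epsilon>) * ennreal (1 / 2)"
        using \<epsilon>0 by (subst ennreal_mult'[symmetric]) auto
      also have "\<dots> \<le> ennreal (2 * \<epsilon>) * (\<integral>\<^sup>+\<omega>. ennreal (?down (X s \<omega>)) \<partial>P 0)"
        using down[OF s] by (intro mult_left_mono) (auto simp: ennreal_indicator)
      finally show ?thesis .
    qed
    show ?thesis
      unfolding S_int[OF borel_measurable_indicator[OF greaterThan_borel] indicator_pos_le]
        S_int[OF borel_measurable_indicator[OF atLeast_borel] indicator_pos_le] sum_distrib_left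
    proof (intro sum_mono)
      fix k assume k: "k \<in> {1..Suc n}"
      have *: "A * ((\<integral>\<^sup>+\<omega>. ennreal (?up (X (t - grid t n k) \<omega>)) \<partial>P 0) * B) \<le> A * ((ennreal (2 * \<epsilon>) * (\<integral>\<^sup>+\<omega>. ennreal (?down (X (t - grid t n k) \<omega>)) \<partial>P 0)) * B)" for A B
        using grid_nonneg[OF t', of n k] grid_le[OF t', of k n] k by (intro mult_left_mono mult_right_mono q) auto
      have "A * ((\<integral>\<^sup>+\<omega>. ennreal (?up (X (t - grid t n k) \<omega>)) \<partial>P 0) * B) \<le> ennreal (2 * \<epsilon>) * (A * ((\<integral>\<^sup>+\<omega>. ennreal (?down (X (t - grid t n k) \<omega>)) \<partial>P 0) * B))" for A B
        using *[of A B] by (simp only: mult_ac)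
      then show "(\<integral>\<^sup>+\<omega>. ennreal (H n k \<omega>) * ennreal (alive (grid t n k) \<omega>) \<partial>P 0) *
          ((\<integral>\<^sup>+\<omega>. ennreal (?up (X (t - grid t n k) \<omega>)) \<partial>P 0) * ennreal (exp (- p * (t - grid t n k))))
        \<le> ennreal (2 * \<epsilon>) * ((\<integral>\<^sup>+\<omega>. ennreal (H n k \<omega>) * ennreal (alive (grid t n k) \<omega>) \<partial>P 0) *
          ((\<integral>\<^sup>+\<omega>. ennreal (?down (X (t - grid t n k) \<omega>)) \<partial>P 0) * ennreal (exp (- p * (t - grid t n k)))))"
        .
    qed
  qed
  have S_down: "S ?down n \<omega> \<le> indicator {a - 1<..} (X t \<omega>) * alive t \<omega>" for n \<omega>
    unfolding S_def by (rule order_trans[OF abs_ge_self grid_sum_le]) (use t' in \<open>auto simp: indicator_def\<close>)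
  have "(\<integral>\<^sup>+\<omega>. ennreal (S ?down n \<omega>) \<partial>P 0) \<le> (\<integral>\<^sup>+\<omega>. indicator {a - 1<..} (X t \<omega>) * ennreal (alive t \<omega>) \<partial>P 0)" for n
    by (rule nn_integral_mono) (use S_down in \<open>auto intro!: ennreal_leI simp: ennreal_indicator[symmetric] ennreal_mult'[symmetric]\<close>)
  then have S_up: "(\<integral>\<^sup>+\<omega>. ennreal (S ?up n \<omega>) \<partial>P 0) \<le> ennreal (2 * \<epsilon>) * (\<integral>\<^sup>+\<omega>. indicator {a - 1<..} (X t \<omega>) * ennreal (alive t \<omega>) \<partial>P 0)" for n
    by (rule order_trans[OF up_down mult_left_mono]) auto
  have S_meas: "S g n \<in> borel_measurable (P 0)" if [measurable]: "g \<in> borel_measurable borel" for g n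
    unfolding S_def
  proof (rule borel_measurable_sum)
    fix k
    have [measurable]: "(\<lambda>\<omega>. indicator (passage_in_cell a t n k) \<omega> :: real) \<in> borel_measurable (P 0)"
      by (rule measurable_P[OF passage_in_cell_F[OF t'] grid_nonneg[OF t']])
    have [measurable]: "X t \<in> borel_measurable (P 0)" "X (grid t n k) \<in> borel_measurable (P 0)" "alive t \<in> borel_measurable (P 0)"
      using t' grid_nonneg[OF t'] by auto
    show "(\<lambda>\<omega>. indicator (passage_in_cell a t n k) \<omega> * (indicator {a - 1/2<..<a + 1/2} (X (grid t n k) \<omega>) * g (X t \<omega> - X (grid t n k) \<omega>) * alive t \<omega>)) \<in> borel_measurable (P 0)"
      by measurable
  qed
  \<comment> \<open>Off the event \<open>X t > a + 1\<close> nothing is claimed about the limit of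
    the grid sums. This lower bound suffices for Fatou's lemma, which transfers the uniform estimate
    of the integrals.\<close>
  have "AE \<omega> in P 0. indicator {a + 1<..} (X t \<omega>) * ennreal (alive t \<omega>) \<le> liminf (\<lambda>n. ennreal (S ?up n \<omega>))"
    using start no_pos_jumps[of 0] AE_space
  proof eventually_elim
    case (elim \<omega>)
    show ?case
    proof (cases "a + 1 < X t \<omega>")
      case True
      have less: "first_passage_above X a \<omega> < ennreal t"
        using above_imp_first_passage[OF elim(3,2) t, of a] True by simp
      have Xa: "X (stopped_time a t \<omega>) \<omega> = a"
        using X_stopped_eq[OF elim(3,2) _ t' less] elim(1) a by simp
      have R: "((\<lambda>t. X t \<omega>) \<longlongrightarrow> a) (at_right (stopped_time a t \<omega>))"
        using X_right[OF elim(3) stopped_time_bounds(1)[OF t', of a \<omega>]] by (simp add: Xa)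
      have "\<forall>\<^sub>F r in at_right (stopped_time a t \<omega>). a - 1/2 < X r \<omega>" "\<forall>\<^sub>F r in at_right (stopped_time a t \<omega>). X r \<omega> < a + 1/2"
        by (rule order_tendstoD[OF R]; simp)+
      then have "\<forall>\<^sub>F r in at_right (stopped_time a t \<omega>).
          indicator {a - 1/2<..<a + 1/2} (X r \<omega>) * ?up (X t \<omega> - X r \<omega>) * alive t \<omega> = alive t \<omega>"
        by eventually_elim (use True in auto)
      then have "(\<lambda>n. S ?up n \<omega>) \<longlonglongrightarrow> alive t \<omega>"
        unfolding S_def by (intro grid_limit[OF t less] tendsto_eventually)
      then have "(\<lambda>n. ennreal (S ?up n \<omega>)) \<longlonglongrightarrow> ennreal (alive t \<omega>)"
        by (rule tendsto_ennrealI)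
      then have "liminf (\<lambda>n. ennreal (S ?up n \<omega>)) = ennreal (alive t \<omega>)"
        by (rule lim_imp_Liminf[OF sequentially_bot])
      then show ?thesis using True by simp
    qed simp
  qed
  then have "(\<integral>\<^sup>+\<omega>. indicator {a + 1<..} (X t \<omega>) * ennreal (alive t \<omega>) \<partial>P 0) \<le> (\<integral>\<^sup>+\<omega>. liminf (\<lambda>n. ennreal (S ?up n \<omega>)) \<partial>P 0)"
    by (rule nn_integral_mono_AE)
  also have "\<dots> \<le> liminf (\<lambda>n. \<integral>\<^sup>+\<omega>. ennreal (S ?up n \<omega>) \<partial>P 0)"
    by (rule nn_integral_liminf) (use S_meas in auto)
  also have "\<dots> \<le> ennreal (2 * \<epsilon>) * (\<integral>\<^sup>+\<omega>. indicator {a - 1<..} (X t \<omega>) * ennreal (alive t \<omega>) \<partial>P 0)"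
    by (rule Liminf_le) (use S_up in auto)
  finally have "(\<integral>\<^sup>+\<omega>. indicator {a + 1<..} (X t \<omega>) \<partial>P 0) * ennreal (exp (- p * t)) \<le>
      (ennreal (2 * \<epsilon>) * (\<integral>\<^sup>+\<omega>. indicator {a - 1<..} (X t \<omega>) \<partial>P 0)) * ennreal (exp (- p * t))"
    by (subst (asm) (1 2) nn_integral_alive[OF t']) (auto simp: mult.assoc)
  then show ?thesis
    by (subst (asm) (1 2) mult.commute[of _ "ennreal (exp (- p * t))"], subst (asm) ennreal_mult_le_mult_iff) auto
qed

text \<open>Iterating \<open>tail_recursion\<close> gives a geometric tail in steps of 2. The ratio
  can be made as small as required by shortening the time interval, so \<open>t0\<close> depends on
  \<open>l\<close>.\<close>

lemma exp_moment_bound: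
  assumes l: "0 \<le> l"
  obtains t0 C where "0 < t0" "\<And>t. 0 \<le> t \<Longrightarrow> t \<le> t0 \<Longrightarrow> (\<integral>\<^sup>+\<omega>. ennreal (exp (l * X t \<omega>)) \<partial>P 0) \<le> ennreal C"
proof -
  \<comment> \<open>On levels between 2n and 2n + 2 the exponential is at most
    \<open>exp (2 * l) * exp (2 * l) ^ n\<close>, while the tail is at most
    \<open>(2 * \<epsilon>) ^ n\<close>. This choice makes the combined ratio
    \<open>exp (2 * l) * (2 * \<epsilon>)\<close> equal to 1/2; it also keeps
    \<open>\<epsilon> \<le> 1 / 2\<close>.\<close>
  define \<epsilon> where "\<epsilon> = exp (- 2 * l) / 4"
  have \<epsilon>: "0 < \<epsilon>" "\<epsilon> \<le> 1 / 2" using l by (auto simp: \<epsilon>_def intro: order_trans[of _ 1])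
  obtain t0 where t0: "0 < t0" "\<And>s. 0 \<le> s \<Longrightarrow> s \<le> t0 \<Longrightarrow> measure (P 0) {\<omega> \<in> space (P 0). 1 / 2 < \<bar>X s \<omega>\<bar>} \<le> \<epsilon>"
    using prob_away_from_start[of "1 / 2" \<epsilon>] \<epsilon> by auto
  have bound: "(\<integral>\<^sup>+\<omega>. ennreal (exp (l * X t \<omega>)) \<partial>P 0) \<le> ennreal (1 + 2 * exp (2 * l))" if t: "0 < t" "t \<le> t0" for t
  proof -
    have [measurable]: "X t \<in> borel_measurable (P 0)" using t by auto
    have tail: "(\<integral>\<^sup>+\<omega>. indicator {2 * real n<..} (X t \<omega>) \<partial>P 0) \<le> ennreal ((2 * \<epsilon>) ^ n)" for n
    proof (induction n)
      case 0
      have "(\<integral>\<^sup>+\<omega>. indicator {2 * real 0<..} (X t \<omega>) \<partial>P 0) \<le> (\<integral>\<^sup>+\<omega>. 1 \<partial>P 0)"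
        by (rule nn_integral_mono) (auto simp: indicator_def)
      then show ?case by (simp add: emeasure_space_1)
    next
      case (Suc n)
      have "(\<integral>\<^sup>+\<omega>. indicator {2 * real (Suc n)<..} (X t \<omega>) \<partial>P 0) = (\<integral>\<^sup>+\<omega>. indicator {(2 * real n + 1) + 1<..} (X t \<omega>) \<partial>P 0)"
        by (simp add: algebra_simps)
      also have "\<dots> \<le> ennreal (2 * \<epsilon>) * (\<integral>\<^sup>+\<omega>. indicator {(2 * real n + 1) - 1<..} (X t \<omega>) \<partial>P 0)"
        by (rule tail_recursion) (use t0(2) t \<epsilon> in auto)
      also have "\<dots> \<le> ennreal (2 * \<epsilon>) * ennreal ((2 * \<epsilon>) ^ n)"
        using Suc by (intro mult_left_mono) auto
      also have "\<dots> = ennreal ((2 * \<epsilon>) ^ Suc n)"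
        using \<epsilon> by (simp add: ennreal_mult'[symmetric])
      finally show ?case .
    qed
    let ?f = "\<lambda>n \<omega>. ennreal (exp (l * (2 * real n + 2))) * indicator {2 * real n<..} (X t \<omega>)"
    have "ennreal (exp (l * y)) \<le> 1 + (\<Sum>n. ennreal (exp (l * (2 * real n + 2))) * indicator {2 * real n<..} y)" for y
    proof (cases "y \<le> 0")
      case True
      then have "ennreal (exp (l * y)) \<le> 1" using l by (simp add: mult_nonneg_nonpos)
      then show ?thesis by (rule order_trans) simp
    next
      case False
      define n where "n = nat (\<lceil>y / 2\<rceil> - 1)"
      have n: "2 * real n < y" "y \<le> 2 * real n + 2" using False by (auto simp: n_def) linarith+
      have "ennreal (exp (l * y)) \<le> ennreal (exp (l * (2 * real n + 2))) * indicator {2 * real n<..} y"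
        using n l by (auto intro!: ennreal_leI mult_left_mono)
      also have "\<dots> \<le> (\<Sum>n. ennreal (exp (l * (2 * real n + 2))) * indicator {2 * real n<..} y)"
      proof -
        have "f n \<le> suminf f" for f :: "nat \<Rightarrow> ennreal"
          using sum_le_suminf[OF summableI, of "{n}" f] by simp
        then show ?thesis .
      qed
      also have "\<dots> \<le> 1 + \<dots>" by simp
      finally show ?thesis .
    qed
    then have "(\<integral>\<^sup>+\<omega>. ennreal (exp (l * X t \<omega>)) \<partial>P 0) \<le> (\<integral>\<^sup>+\<omega>. 1 + (\<Sum>n. ?f n \<omega>) \<partial>P 0)"
      by (intro nn_integral_mono)
    also have "\<dots> = 1 + (\<Sum>n. \<integral>\<^sup>+\<omega>. ?f n \<omega> \<partial>P 0)"
      by (subst nn_integral_add) (auto simp: emeasure_space_1 nn_integral_suminf)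
    also have "\<dots> \<le> 1 + (\<Sum>n. ennreal (exp (2 * l) * (1 / 2) ^ n))"
    proof (intro add_left_mono suminf_le summableI)
      fix n
      have "(\<integral>\<^sup>+\<omega>. ?f n \<omega> \<partial>P 0) = ennreal (exp (l * (2 * real n + 2))) * (\<integral>\<^sup>+\<omega>. indicator {2 * real n<..} (X t \<omega>) \<partial>P 0)"
        by (rule nn_integral_cmult) measurable
      also have "\<dots> \<le> ennreal (exp (l * (2 * real n + 2))) * ennreal ((2 * \<epsilon>) ^ n)"
        by (intro mult_left_mono tail) auto
      also have "\<dots> = ennreal (exp (2 * l) * (1 / 2) ^ n)"
      proof -
        have "exp (l * (2 * real n + 2)) = exp (2 * l) * exp (2 * l) ^ n"
          by (simp add: exp_add[symmetric] exp_of_nat_mult[symmetric] algebra_simps)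
        moreover have "exp (2 * l) * (2 * \<epsilon>) = 1 / 2"
          by (simp add: \<epsilon>_def exp_minus)
        ultimately have "exp (l * (2 * real n + 2)) * (2 * \<epsilon>) ^ n = exp (2 * l) * (1 / 2) ^ n"
          by (metis mult.assoc power_mult_distrib)
        then show ?thesis using \<epsilon> by (simp add: ennreal_mult'[symmetric])
      qed
      finally show "(\<integral>\<^sup>+\<omega>. ?f n \<omega> \<partial>P 0) \<le> ennreal (exp (2 * l) * (1 / 2) ^ n)" .
    qed
    also have "(\<Sum>n. ennreal (exp (2 * l) * (1 / 2) ^ n)) = ennreal (exp (2 * l) * 2)"
    proof (rule suminf_ennreal_eq)
      show "(\<lambda>n. exp (2 * l) * (1 / 2) ^ n) sums (exp (2 * l) * 2)"
        using sums_mult[OF geometric_sums[of "1/2 :: real"], of "exp (2 * l)"] by simp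
    qed simp
    finally show ?thesis by (subst ennreal_plus) (auto simp: mult.commute)
  qed
  have "(\<integral>\<^sup>+\<omega>. ennreal (exp (l * X 0 \<omega>)) \<partial>P 0) = (\<integral>\<^sup>+\<omega>. 1 \<partial>P 0)"
    by (rule nn_integral_cong_AE) (use start in \<open>eventually_elim, simp\<close>)
  then have "(\<integral>\<^sup>+\<omega>. ennreal (exp (l * X 0 \<omega>)) \<partial>P 0) \<le> ennreal (1 + 2 * exp (2 * l))"
    by (simp add: emeasure_space_1)
  with bound have "(\<integral>\<^sup>+\<omega>. ennreal (exp (l * X t \<omega>)) \<partial>P 0) \<le> ennreal (1 + 2 * exp (2 * l))" if "0 \<le> t" "t \<le> t0" for t
    using that by (cases "t = 0") auto
  then show ?thesis using t0(1) that by blast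
qed

text \<open>The Markov property at \<open>t\<close> is applied to the killed process; the killing
  contributes \<open>exp (- p * (t + s))\<close> on both sides and is divided out. The identity
  holds in \<open>[0, \<infinity>]\<close>, before finiteness is known.\<close>

lemma exp_moment_mult:
  assumes "0 \<le> s" "0 \<le> t"
  shows "(\<integral>\<^sup>+\<omega>. ennreal (exp (l * X (t + s) \<omega>)) \<partial>P 0) =
    (\<integral>\<^sup>+\<omega>. ennreal (exp (l * X t \<omega>)) \<partial>P 0) * (\<integral>\<^sup>+\<omega>. ennreal (exp (l * X s \<omega>)) \<partial>P 0)"
proof -
  let ?m = "\<lambda>t. \<integral>\<^sup>+\<omega>. ennreal (exp (l * X t \<omega>)) \<partial>P 0"
  have [measurable]: "X t \<in> borel_measurable (F t)" using assms by (auto intro: X_F)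
  have "?m (t + s) * ennreal (exp (- p * (t + s))) = (\<integral>\<^sup>+\<omega>. ennreal (exp (l * X (t + s) \<omega>)) * ennreal (alive (t + s) \<omega>) \<partial>P 0)"
    using nn_integral_alive[of "t + s" "\<lambda>y. ennreal (exp (l * y))" 0] assms by simp
  also have "\<dots> = (\<integral>\<^sup>+\<omega>. ennreal (exp (l * X t \<omega>)) * (ennreal (exp (l * (X (t + s) \<omega> - X t \<omega>))) * ennreal (alive (t + s) \<omega>)) \<partial>P 0)"
  proof (rule nn_integral_cong)
    fix \<omega>
    have "exp (l * X (t + s) \<omega>) = exp (l * X t \<omega>) * exp (l * (X (t + s) \<omega> - X t \<omega>))"
      by (simp add: exp_add[symmetric] right_diff_distrib)
    then show "ennreal (exp (l * X (t + s) \<omega>)) * ennreal (alive (t + s) \<omega>) =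
      ennreal (exp (l * X t \<omega>)) * (ennreal (exp (l * (X (t + s) \<omega> - X t \<omega>))) * ennreal (alive (t + s) \<omega>))"
      by (simp only: ennreal_mult' exp_ge_zero mult.assoc)
  qed
  also have "\<dots> = (\<integral>\<^sup>+\<omega>. ennreal (exp (l * X t \<omega>)) * ennreal (alive t \<omega>) \<partial>P 0) * (?m s * ennreal (exp (- p * s)))"
    by (rule e_memoryless_nn_integral[where g="\<lambda>y. ennreal (exp (l * y))"]) (use assms in auto)
  also have "\<dots> = (?m t * ennreal (exp (- p * t))) * (?m s * ennreal (exp (- p * s)))"
    using nn_integral_alive[of t "\<lambda>y. ennreal (exp (l * y))" 0] assms by simp
  also have "\<dots> = (?m t * ?m s) * ennreal (exp (- p * (t + s)))"
  proof -
    have "exp (- p * (t + s)) = exp (- p * t) * exp (- p * s)"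
      by (simp add: exp_add[symmetric] distrib_left)
    then show ?thesis by (simp only: ennreal_mult' exp_ge_zero mult_ac)
  qed
  finally show ?thesis
    by (subst (asm) (1 2) mult.commute[of _ "ennreal (exp (- p * (t + s)))"])
      (simp add: ennreal_mult_cancel_left)
qed

abbreviation \<psi> :: "real \<Rightarrow> real" where "\<psi> \<equiv> laplace_exponent P X"

text \<open>Multiplicativity extends finiteness from short times to all times and makes the
  logarithm of the moment additive in time. With the upper bound near 0 it is therefore linear, and
  its slope is the value at time 1 that defines \<open>\<psi> l\<close>.\<close>

lemma exp_moment:
  assumes l: "0 \<le> l" and t: "0 \<le> t"
  shows "(\<integral>\<^sup>+\<omega>. ennreal (exp (l * X t \<omega>)) \<partial>P 0) = ennreal (exp (t * \<psi> l))"
proof -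
  let ?m = "\<lambda>t. \<integral>\<^sup>+\<omega>. ennreal (exp (l * X t \<omega>)) \<partial>P 0"
  obtain t0 C where t0: "0 < t0" and C: "\<And>t. 0 \<le> t \<Longrightarrow> t \<le> t0 \<Longrightarrow> ?m t \<le> ennreal C"
    using exp_moment_bound[OF l] by blast
  have fin_mult: "?m (real n * t) < \<top>" if "0 \<le> t" "t \<le> t0" for n t
  proof (induction n)
    case 0
    show ?case using order_le_less_trans[OF C[of 0] ennreal_less_top] t0 by simp
  next
    case (Suc n)
    have "?m (real (Suc n) * t) = ?m (t + real n * t)" by (simp add: algebra_simps)
    also have "\<dots> = ?m t * ?m (real n * t)" by (rule exp_moment_mult) (use that in auto)
    also have "\<dots> < \<top>" using Suc order_le_less_trans[OF C[OF that] ennreal_less_top] by (simp add: ennreal_mult_less_top)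
    finally show ?case .
  qed
  have fin: "?m t < \<top>" if "0 \<le> t" for t
  proof -
    obtain n where "t / t0 < real n" using reals_Archimedean2 by blast
    then have "t < t0 * real (Suc n)" using t0 by (simp add: divide_less_eq algebra_simps)
    then have "t / real (Suc n) \<le> t0" using t0 by (simp add: divide_le_eq del: of_nat_Suc)
    then show ?thesis using fin_mult[of "t / real (Suc n)" "Suc n"] that by (simp del: of_nat_Suc)
  qed
  have pos: "0 < ?m t" if "0 \<le> t" for t
  proof (rule ccontr)
    assume "\<not> 0 < ?m t"
    then have "AE \<omega> in P 0. ennreal (exp (l * X t \<omega>)) = 0"
      using that by (simp add: nn_integral_0_iff_AE zero_less_iff_neq_zero)
    then have "AE \<omega> in P 0. False" by eventually_elim simp
    then show False by simp
  qed
  define a where "a t = ln (enn2real (?m t))" for t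
  have m: "0 < enn2real (?m t)" "?m t = ennreal (exp (a t))" if "0 \<le> t" for t
  proof -
    show "0 < enn2real (?m t)" using fin[OF that] pos[OF that] by (simp add: enn2real_positive_iff)
    then show "?m t = ennreal (exp (a t))" using fin[OF that] by (simp add: a_def)
  qed
  have "a t = t * a 1"
  proof (rule additive_bounded_above_imp_linear[OF _ _ t0 t])
    show "a (s + t) = a s + a t" if "0 \<le> s" "0 \<le> t" for s t
    proof -
      have "?m (s + t) = ?m s * ?m t" by (rule exp_moment_mult) (use that in auto)
      then have "enn2real (?m (s + t)) = enn2real (?m s) * enn2real (?m t)" by (simp only: enn2real_mult)
      then show ?thesis unfolding a_def using ln_mult_pos[OF m(1)[OF that(1)] m(1)[OF that(2)]] by (simp only:)
    qed
    show "a t \<le> ln (max 1 C)" if "0 \<le> t" "t \<le> t0" for t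
    proof -
      have "ennreal (exp (a t)) \<le> ennreal C" using C[OF that] m[of t] that by simp
      then have "exp (a t) \<le> max 1 C" by (auto simp: ennreal_le_iff2 le_max_iff_disj)
      then show ?thesis by (simp add: ln_ge_iff[symmetric])
    qed
  qed
  moreover have "\<psi> l = a 1"
  proof -
    have "(\<integral>\<omega>. exp (l * X 1 \<omega>) \<partial>P 0) = enn2real (?m 1)"
      by (rule integral_eq_nn_integral) auto
    then show ?thesis by (simp add: laplace_exponent_def a_def)
  qed
  ultimately show ?thesis using m(2)[OF t] by simp
qed

end

section \<open>The damped exponential martingales\<close>

lemma set_integrable_bounded_Icc:
  fixes f :: "real \<Rightarrow> real"
  assumes "f \<in> borel_measurable borel" and "\<And>u. s \<le> u \<Longrightarrow> u \<le> t \<Longrightarrow> \<bar>f u\<bar> \<le> C"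
  shows "set_integrable lborel {s..t} f"
  unfolding set_integrable_def
  by (rule integrableI_bounded_set_indicator[where B=C])
    (use assms in \<open>auto simp: emeasure_lborel_Icc_eq less_top[symmetric]\<close>)

lemma set_integral_Icc_combine:
  fixes f :: "real \<Rightarrow> real"
  assumes "set_integrable lborel {r..t} f" "r \<le> s" "s \<le> t"
  shows "(LBINT u:{r..t}. f u) = (LBINT u:{r..s}. f u) + (LBINT u:{s..t}. f u)"
proof -
  have "set_integrable lborel {r..s} f" "set_integrable lborel {s..t} f"
    using assms by (auto intro: set_integrable_subset)
  then show ?thesis
    using assms Henstock_Kurzweil_Integration.integral_combine[of r s t f]
    by (simp add: set_borel_integral_eq_integral)
qed

lemma set_integral_Icc_right_continuous:
  fixes f :: "real \<Rightarrow> real"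
  assumes "set_integrable lborel {s..t} f" "s \<le> r" "r < t"
  shows "((\<lambda>r. LBINT u:{s..r}. f u) \<longlongrightarrow> (LBINT u:{s..r}. f u)) (at_right r)"
proof -
  have "continuous_on {s..t} (\<lambda>r. integral {s..r} f)"
    by (rule indefinite_integral_continuous_1) (use set_borel_integral_eq_integral(1)[OF assms(1)] in simp)
  then have "continuous_on {r..t} (\<lambda>r. integral {s..r} f)"
    by (rule continuous_on_subset) (use assms in auto)
  then have "((\<lambda>r. integral {s..r} f) \<longlongrightarrow> integral {s..r} f) (at_right r)"
    using assms(3) by (rule continuous_on_Icc_at_rightD)
  moreover have eq: "(LBINT u:{s..r}. f u) = integral {s..r} f" if "r \<le> t" for r
    using set_integrable_subset[OF assms(1), of "{s..r}"] that by (simp add: set_borel_integral_eq_integral)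
  moreover have "\<forall>\<^sub>F r in at_right r. integral {s..r} f = (LBINT u:{s..r}. f u)"
    unfolding eventually_at_right_field using assms(3) eq by (intro exI[of _ t]) auto
  ultimately show ?thesis using assms(3) by (auto intro: Lim_transform_eventually)
qed

text \<open>The hypothesis is the variation-of-constants formula for v' = \<kappa> v - w, the
  conclusion that equation in integrated form. As \<open>w\<close> is only measurable,
  \<open>v\<close> is not differentiated; instead the formula is multiplied by
  \<open>\<kappa>\<close>, integrated over \<open>r\<close>, and the double integral is evaluated in
  the other order.\<close>

lemma duhamel_imp_integral_equation:
  fixes v w :: "real \<Rightarrow> real"
  assumes v_eq: "\<And>r. s \<le> r \<Longrightarrow> r \<le> t \<Longrightarrow> v s * exp (\<kappa> * (r - s)) = v r + (LBINT u:{s..r}. exp (\<kappa> * (r - u)) * w u)"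
    and w [measurable]: "w \<in> borel_measurable borel"
    and w_bound: "\<And>u. s \<le> u \<Longrightarrow> u \<le> t \<Longrightarrow> \<bar>w u\<bar> \<le> C"
    and st: "s \<le> t"
  shows "v t = v s + \<kappa> * (LBINT r:{s..t}. v r) - (LBINT u:{s..t}. w u)"
proof -
  have C: "0 \<le> C" using w_bound[of s] st by simp
  define f where "f r u = indicator {x :: real \<times> real. s \<le> snd x \<and> snd x \<le> fst x \<and> fst x \<le> t} (r, u) *
      (\<kappa> * exp (\<kappa> * (r - u)) * w u)" for r u
  have f_meas [measurable]: "(\<lambda>(r, u). f r u) \<in> borel_measurable (borel \<Otimes>\<^sub>M borel)"
    unfolding f_def by measurable
  have "integrable (lborel \<Otimes>\<^sub>M lborel) (\<lambda>(r, u). f r u)"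
  proof (rule integrableI_bounded_set[where A="{s..t} \<times> {s..t}" and B="\<bar>\<kappa>\<bar> * exp (\<bar>\<kappa>\<bar> * (t - s)) * C"])
    show "emeasure (lborel \<Otimes>\<^sub>M lborel) ({s..t} \<times> {s..t}) < \<infinity>"
      by (subst lborel.emeasure_pair_measure_Times) (auto simp: emeasure_lborel_Icc_eq ennreal_mult_less_top)
    show "AE x in lborel \<Otimes>\<^sub>M lborel. x \<in> {s..t} \<times> {s..t} \<longrightarrow> norm (case x of (r, u) \<Rightarrow> f r u) \<le> \<bar>\<kappa>\<bar> * exp (\<bar>\<kappa>\<bar> * (t - s)) * C"
    proof (intro AE_I2 impI)
      fix x assume "x \<in> {s..t} \<times> {s..t}"
      then obtain r u where x: "x = (r, u)" "s \<le> r" "r \<le> t" "s \<le> u" "u \<le> t" by auto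
      have "\<bar>f r u\<bar> \<le> \<bar>\<kappa>\<bar> * exp (\<bar>\<kappa>\<bar> * (t - s)) * C"
      proof (cases "u \<le> r")
        case True
        have "\<kappa> * (r - u) \<le> \<bar>\<kappa>\<bar> * (t - s)"
          using x True by (intro mult_mono) auto
        then show ?thesis
          using True x w_bound[of u] by (auto simp: f_def abs_mult intro!: mult_mono)
      qed (use C in \<open>simp add: f_def\<close>)
      then show "norm (case x of (r, u) \<Rightarrow> f r u) \<le> \<bar>\<kappa>\<bar> * exp (\<bar>\<kappa>\<bar> * (t - s)) * C"
        by (simp add: x)
    qed
    show "AE x in lborel \<Otimes>\<^sub>M lborel. x \<notin> {s..t} \<times> {s..t} \<longrightarrow> (case x of (r, u) \<Rightarrow> f r u) = 0"
      by (intro AE_I2) (auto simp: f_def indicator_def)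
  qed (auto simp: split_beta')
  then have Fubini: "(\<integral>u. \<integral>r. f r u \<partial>lborel \<partial>lborel) = (\<integral>r. \<integral>u. f r u \<partial>lborel \<partial>lborel)"
    by (rule lborel_pair.Fubini_integral)
  have inner1: "(\<integral>u. f r u \<partial>lborel) = indicator {s..t} r * (\<kappa> * (LBINT u:{s..r}. exp (\<kappa> * (r - u)) * w u))" for r
  proof -
    have "(\<integral>u. f r u \<partial>lborel) = (\<integral>u. (indicator {s..t} r * \<kappa>) * (indicator {s..r} u * (exp (\<kappa> * (r - u)) * w u)) \<partial>lborel)"
      by (rule Bochner_Integration.integral_cong) (auto simp: f_def indicator_def)
    then show ?thesis by (simp add: set_lebesgue_integral_def)
  qed
  have inner2: "(\<integral>r. f r u \<partial>lborel) = indicator {s..t} u * (exp (\<kappa> * (t - u)) * w u - w u)" for u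
  proof (cases "u \<in> {s..t}")
    case True
    have "(\<integral>r. f r u \<partial>lborel) = (\<integral>r. w u * (indicator {u..t} r *\<^sub>R (\<kappa> * exp (\<kappa> * (r - u)))) \<partial>lborel)"
      by (rule Bochner_Integration.integral_cong) (use True in \<open>auto simp: f_def indicator_def\<close>)
    also have "\<dots> = w u * (exp (\<kappa> * (t - u)) - exp (\<kappa> * (u - u)))"
      using True
      by (subst integral_mult_right_zero, subst integral_FTC_Icc[where F="\<lambda>r. exp (\<kappa> * (r - u))"])
        (auto intro!: derivative_eq_intros continuous_intros simp: has_real_derivative_iff_has_vector_derivative[symmetric])
    finally show ?thesis using True by (simp add: algebra_simps)
  next
    case False
    then have "(\<integral>r. f r u \<partial>lborel) = (\<integral>(r::real). 0 \<partial>lborel)"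
      by (intro Bochner_Integration.integral_cong) (auto simp: f_def indicator_def)
    then show ?thesis using False by simp
  qed
  have w_int: "set_integrable lborel {s..t} w" by (rule set_integrable_bounded_Icc[OF w w_bound])
  have ew_int: "set_integrable lborel {s..t} (\<lambda>u. exp (\<kappa> * (t - u)) * w u)"
  proof (rule set_integrable_bounded_Icc[where C="exp (\<bar>\<kappa>\<bar> * (t - s)) * C"])
    fix u assume u: "s \<le> u" "u \<le> t"
    have "\<kappa> * (t - u) \<le> \<bar>\<kappa>\<bar> * (t - s)" using u by (intro mult_mono) auto
    then show "\<bar>exp (\<kappa> * (t - u)) * w u\<bar> \<le> exp (\<bar>\<kappa>\<bar> * (t - s)) * C"
      using w_bound[OF u] by (auto simp: abs_mult intro!: mult_mono)
  qed simp
  have outer2: "(\<integral>u. \<integral>r. f r u \<partial>lborel \<partial>lborel) = (LBINT u:{s..t}. exp (\<kappa> * (t - u)) * w u) - (LBINT u:{s..t}. w u)"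
    unfolding inner2 set_integral_diff(2)[OF ew_int w_int, symmetric] by (simp add: set_lebesgue_integral_def)
  let ?L = "\<lambda>r. LBINT u:{s..r}. exp (\<kappa> * (r - u)) * w u"
  have L_meas: "(\<lambda>r. \<integral>u. f r u \<partial>lborel) \<in> borel_measurable borel"
    by (rule lborel.borel_measurable_lebesgue_integral) (use f_meas in simp)
  have L_int: "integrable lborel (\<lambda>r. \<integral>u. f r u \<partial>lborel)"
    by (rule lborel_pair.integrable_fst) fact
  have e_int: "set_integrable lborel {s..t} (\<lambda>r. \<kappa> * exp (\<kappa> * (r - s)))"
    by (rule borel_integrable_atLeastAtMost') (intro continuous_intros)
  have e_val: "(LBINT r:{s..t}. \<kappa> * exp (\<kappa> * (r - s))) = exp (\<kappa> * (t - s)) - 1"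
    unfolding set_lebesgue_integral_def
    by (subst integral_FTC_Icc[where F="\<lambda>r. exp (\<kappa> * (r - s))"])
      (use st in \<open>auto intro!: derivative_eq_intros continuous_intros simp: has_real_derivative_iff_has_vector_derivative[symmetric]\<close>)
  have "\<kappa> * (LBINT r:{s..t}. v r) = (LBINT r:{s..t}. \<kappa> * v r)" by simp
  also have "\<dots> = (LBINT r:{s..t}. v s * (\<kappa> * exp (\<kappa> * (r - s))) - (\<integral>u. f r u \<partial>lborel))"
  proof (rule set_lebesgue_integral_cong)
    show "\<forall>r. r \<in> {s..t} \<longrightarrow> \<kappa> * v r = v s * (\<kappa> * exp (\<kappa> * (r - s))) - (\<integral>u. f r u \<partial>lborel)"
    proof (intro allI impI)
      fix r assume r: "r \<in> {s..t}"
      have "v r = v s * exp (\<kappa> * (r - s)) - ?L r" using v_eq[of r] r by simp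
      then have "\<kappa> * v r = v s * (\<kappa> * exp (\<kappa> * (r - s))) - \<kappa> * ?L r"
        by (simp only: right_diff_distrib mult.left_commute)
      then show "\<kappa> * v r = v s * (\<kappa> * exp (\<kappa> * (r - s))) - (\<integral>u. f r u \<partial>lborel)"
        unfolding inner1 using r by simp
    qed
  qed simp
  also have "\<dots> = v s * (exp (\<kappa> * (t - s)) - 1) - (LBINT r:{s..t}. \<integral>u. f r u \<partial>lborel)"
  proof (subst set_integral_diff(2))
    show "set_integrable lborel {s..t} (\<lambda>r. v s * (\<kappa> * exp (\<kappa> * (r - s))))"
      using e_int by simp
    show "set_integrable lborel {s..t} (\<lambda>r. \<integral>u. f r u \<partial>lborel)"
      using L_int unfolding set_integrable_def by (rule integrable_mult_indicator[rotated]) simp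
  qed (use e_val in simp)
  also have "(LBINT r:{s..t}. \<integral>u. f r u \<partial>lborel) = (\<integral>r. \<integral>u. f r u \<partial>lborel \<partial>lborel)"
    unfolding set_lebesgue_integral_def inner1
    by (rule Bochner_Integration.integral_cong) (auto simp: indicator_def)
  also have "\<dots> = (LBINT u:{s..t}. exp (\<kappa> * (t - u)) * w u) - (LBINT u:{s..t}. w u)"
    using Fubini outer2 by simp
  finally show ?thesis using v_eq[of t] st by (simp add: algebra_simps)
qed

context killed_spectrally_negative_Levy
begin

lemma X_path_measurable: "\<omega> \<in> space (P x) \<Longrightarrow> (\<lambda>u. X (max 0 u) \<omega>) \<in> borel_measurable borel"
proof -
  assume \<omega>: "\<omega> \<in> space (P x)"
  have "(\<lambda>(u, \<omega>). X (max 0 u) \<omega>) \<in> borel_measurable (borel \<Otimes>\<^sub>M P x)"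
    by (rule jointly_measurable) (use X_right in auto)
  from measurable_compose[OF measurable_Pair2'[OF \<omega>] this] show ?thesis by simp
qed

text \<open>Paths are constrained at nonnegative times only; \<open>max 0 u\<close> makes them Borel on the whole line.\<close>

definition clock :: "real \<Rightarrow> real \<Rightarrow> 'a \<Rightarrow> real" where
  "clock \<alpha> t \<omega> = (LBINT u:{0..t}. exp (\<alpha> * X (max 0 u) \<omega>))"

definition damped :: "real \<Rightarrow> real \<Rightarrow> real \<Rightarrow> real \<Rightarrow> 'a \<Rightarrow> real" where
  "damped \<alpha> \<beta> l t \<omega> = exp (l * X t \<omega>) * alive t \<omega> * exp (- (\<beta> * clock \<alpha> t \<omega>))"

definition occupation :: "real \<Rightarrow> real \<Rightarrow> real \<Rightarrow> real \<Rightarrow> real \<Rightarrow> 'a \<Rightarrow> real" where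
  "occupation \<alpha> \<beta> l s t \<omega> = (LBINT u:{s..t}. damped \<alpha> \<beta> l (max 0 u) \<omega>)"

lemma exp_X_path_integrable:
  assumes "\<omega> \<in> space (P x)" shows "set_integrable lborel {0..t} (\<lambda>u. exp (\<alpha> * X (max 0 u) \<omega>))"
proof (cases "0 \<le> t")
  case True
  obtain B where B: "\<And>u. 0 \<le> u \<Longrightarrow> u \<le> t \<Longrightarrow> \<bar>X u \<omega>\<bar> \<le> B" using X_bounded[OF assms True] by blast
  note [measurable] = X_path_measurable[OF assms]
  show ?thesis
  proof (rule set_integrable_bounded_Icc[where C="exp (\<bar>\<alpha>\<bar> * B)"])
    fix u :: real assume u: "0 \<le> u" "u \<le> t"
    have "\<alpha> * X u \<omega> \<le> \<bar>\<alpha>\<bar> * \<bar>X u \<omega>\<bar>" by (metis abs_ge_self abs_mult)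
    also have "\<dots> \<le> \<bar>\<alpha>\<bar> * B" using B[OF u] by (intro mult_left_mono) auto
    finally show "\<bar>exp (\<alpha> * X (max 0 u) \<omega>)\<bar> \<le> exp (\<bar>\<alpha>\<bar> * B)" using u by simp
  qed simp
qed (simp add: set_integrable_def)

lemma clock_nonneg: "0 \<le> clock \<alpha> t \<omega>"
  unfolding clock_def set_lebesgue_integral_def by (rule Bochner_Integration.integral_nonneg) simp

lemma clock_0 [simp]: "clock \<alpha> 0 \<omega> = 0"
proof -
  have "(\<lambda>u. indicator {0..0} u *\<^sub>R exp (\<alpha> * X (max 0 u) \<omega>)) = (\<lambda>u. indicator {0} u *\<^sub>R exp (\<alpha> * X 0 \<omega>))"
    by (auto simp: indicator_def fun_eq_iff)
  then show ?thesis unfolding clock_def set_lebesgue_integral_def by simp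
qed

lemma clock_F: "0 \<le> s \<Longrightarrow> s \<le> t \<Longrightarrow> clock \<alpha> s \<in> borel_measurable (F t)"
proof (rule measurable_F_mono[of _ s])
  assume s: "0 \<le> s"
  have m: "(\<lambda>(u, \<omega>). X (max 0 (min s u)) \<omega>) \<in> borel_measurable (borel \<Otimes>\<^sub>M F s)"
    by (rule progressive_measurable) (use s X_F X_right space_F in auto)
  have "(\<lambda>x. (snd x, fst x)) \<in> F s \<Otimes>\<^sub>M borel \<rightarrow>\<^sub>M borel \<Otimes>\<^sub>M F s" by measurable
  from measurable_compose[OF this m]
  have [measurable]: "(\<lambda>x. X (max 0 (min s (snd x))) (fst x)) \<in> borel_measurable (F s \<Otimes>\<^sub>M borel)"
    by simp
  have "(\<lambda>\<omega>. \<integral>u. indicator {0..s} u *\<^sub>R exp (\<alpha> * X (max 0 (min s u)) \<omega>) \<partial>lborel) \<in> borel_measurable (F s)"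
    by (rule lborel.borel_measurable_lebesgue_integral) (simp add: split_beta')
  moreover have "clock \<alpha> s = (\<lambda>\<omega>. \<integral>u. indicator {0..s} u *\<^sub>R exp (\<alpha> * X (max 0 (min s u)) \<omega>) \<partial>lborel)"
    unfolding clock_def[abs_def] set_lebesgue_integral_def
    by (intro ext Bochner_Integration.integral_cong) (auto simp: indicator_def)
  ultimately show "clock \<alpha> s \<in> borel_measurable (F s)" by simp
qed

lemma clock_P [measurable]: "0 \<le> s \<Longrightarrow> clock \<alpha> s \<in> borel_measurable (P x)"
  by (rule measurable_P[OF clock_F[OF _ order_refl]])

lemma clock_right:
  assumes "\<omega> \<in> space (P x)" "0 \<le> t" shows "((\<lambda>t. clock \<alpha> t \<omega>) \<longlongrightarrow> clock \<alpha> t \<omega>) (at_right t)"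
  unfolding clock_def by (rule set_integral_Icc_right_continuous[where t="t+1", OF exp_X_path_integrable[OF assms(1)]])
    (use assms in auto)

lemma damping_step:
  assumes \<omega>: "\<omega> \<in> space (P x)" and \<beta>: "0 \<le> \<beta>" and st: "0 \<le> s" "s \<le> t"
  shows "set_integrable lborel {s..t} (\<lambda>u. \<beta> * exp (\<alpha> * X (max 0 u) \<omega>) * exp (- (\<beta> * clock \<alpha> u \<omega>)))"
    and "exp (- (\<beta> * clock \<alpha> s \<omega>)) = exp (- (\<beta> * clock \<alpha> t \<omega>)) +
      (LBINT u:{s..t}. \<beta> * exp (\<alpha> * X (max 0 u) \<omega>) * exp (- (\<beta> * clock \<alpha> u \<omega>)))"
proof -
  note [measurable] = X_path_measurable[OF \<omega>]
  define a where "a u = \<beta> * exp (\<alpha> * X (max 0 u) \<omega>)" for u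
  have a_meas: "a \<in> borel_measurable borel" unfolding a_def by measurable
  have a_int: "(LBINT v:{0..u}. a v) = \<beta> * clock \<alpha> u \<omega>" for u by (simp add: a_def clock_def)
  have *: "set_integrable lborel {0..r} (\<lambda>u. a u * exp (- (\<beta> * clock \<alpha> u \<omega>)))"
      "(LBINT u:{0..r}. a u * exp (- (\<beta> * clock \<alpha> u \<omega>))) = 1 - exp (- (\<beta> * clock \<alpha> r \<omega>))" if r: "0 \<le> r" for r
  proof -
    obtain B where B: "\<And>u. 0 \<le> u \<Longrightarrow> u \<le> r \<Longrightarrow> \<bar>X u \<omega>\<bar> \<le> B" using X_bounded[OF \<omega> r] by blast
    have bd: "0 \<le> a u \<and> a u \<le> \<beta> * exp (\<bar>\<alpha>\<bar> * B)" if u: "0 \<le> u" "u \<le> r" for u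
    proof -
      have "\<alpha> * X u \<omega> \<le> \<bar>\<alpha>\<bar> * \<bar>X u \<omega>\<bar>" by (metis abs_ge_self abs_mult)
      also have "\<dots> \<le> \<bar>\<alpha>\<bar> * B" using B[OF u] by (intro mult_left_mono) auto
      finally show ?thesis using u \<beta> by (simp add: a_def mult_left_mono)
    qed
    from integral_exp_neg_primitive[of a r, OF a_meas bd r]
    show "set_integrable lborel {0..r} (\<lambda>u. a u * exp (- (\<beta> * clock \<alpha> u \<omega>)))"
      "(LBINT u:{0..r}. a u * exp (- (\<beta> * clock \<alpha> u \<omega>))) = 1 - exp (- (\<beta> * clock \<alpha> r \<omega>))"
      unfolding a_int by (simp_all add: a_def)
  qed
  have t: "0 \<le> t" using st by simp
  show "set_integrable lborel {s..t} (\<lambda>u. \<beta> * exp (\<alpha> * X (max 0 u) \<omega>) * exp (- (\<beta> * clock \<alpha> u \<omega>)))"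
    using set_integrable_subset[OF *(1)[OF t], of "{s..t}"] st by (simp add: a_def)
  show "exp (- (\<beta> * clock \<alpha> s \<omega>)) = exp (- (\<beta> * clock \<alpha> t \<omega>)) +
      (LBINT u:{s..t}. \<beta> * exp (\<alpha> * X (max 0 u) \<omega>) * exp (- (\<beta> * clock \<alpha> u \<omega>)))"
    using set_integral_Icc_combine[OF *(1)[OF t] st] *(2)[OF t] *(2)[OF st(1)] by (simp add: a_def)
qed

lemma damped_nonneg [simp]: "0 \<le> damped \<alpha> \<beta> l t \<omega>"
  by (simp add: damped_def)

lemma damped_le: "0 \<le> \<beta> \<Longrightarrow> damped \<alpha> \<beta> l t \<omega> \<le> exp (l * X t \<omega>) * alive t \<omega>"
  unfolding damped_def by (rule mult_left_le) (auto simp: clock_nonneg)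

lemma damped_le_exp: "0 \<le> \<beta> \<Longrightarrow> damped \<alpha> \<beta> l t \<omega> \<le> exp (l * X t \<omega>)"
  by (rule order_trans[OF damped_le]) (auto intro!: mult_left_le)

lemma damped_F: "0 \<le> s \<Longrightarrow> s \<le> t \<Longrightarrow> damped \<alpha> \<beta> l s \<in> borel_measurable (F t)"
  unfolding damped_def[abs_def] using X_F[of s t] alive_F[of s t] clock_F[of s t \<alpha>] by measurable

lemma damped_P [measurable]: "0 \<le> s \<Longrightarrow> damped \<alpha> \<beta> l s \<in> borel_measurable (P x)"
  by (rule measurable_P[OF damped_F[OF _ order_refl]])

lemma damped_right:
  assumes "\<omega> \<in> space (P x)" "0 \<le> t"
  shows "((\<lambda>t. damped \<alpha> \<beta> l t \<omega>) \<longlongrightarrow> damped \<alpha> \<beta> l t \<omega>) (at_right t)"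
  unfolding damped_def
  by (intro tendsto_intros X_right[OF assms] alive_right[OF assms(2)] clock_right[OF assms])

lemma damped_joint: "(\<lambda>(u, \<omega>). damped \<alpha> \<beta> l (max 0 u) \<omega>) \<in> borel_measurable (borel \<Otimes>\<^sub>M P x)"
  by (rule jointly_measurable) (use damped_right in auto)

lemma damped_path_measurable:
  assumes "\<omega> \<in> space (P x)" shows "(\<lambda>u. damped \<alpha> \<beta> l (max 0 u) \<omega>) \<in> borel_measurable borel"
  using measurable_compose[OF measurable_Pair2'[OF assms] damped_joint] by simp

lemma damped_path_integrable:
  assumes "\<omega> \<in> space (P x)" "0 \<le> \<beta>"
  shows "set_integrable lborel {0..t} (\<lambda>u. damped \<alpha> \<beta> l (max 0 u) \<omega>)"
proof (rule set_integrable_bound[OF exp_X_path_integrable[OF assms(1), of t l]])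
  show "set_borel_measurable lborel {0..t} (\<lambda>u. damped \<alpha> \<beta> l (max 0 u) \<omega>)"
    using damped_path_measurable[OF assms(1)] by (simp add: set_borel_measurable_def)
qed (use damped_le_exp[OF assms(2)] in auto)

abbreviation rate :: "real \<Rightarrow> real" where "rate l \<equiv> \<psi> l - p"

lemma exp_X_alive_moment:
  assumes "0 \<le> l" "0 \<le> t"
  shows "(\<integral>\<^sup>+\<omega>. ennreal (exp (l * X t \<omega>) * alive t \<omega>) \<partial>P x) = ennreal (exp (l * x + rate l * t))"
proof -
  have "(\<integral>\<^sup>+\<omega>. ennreal (exp (l * X t \<omega>) * alive t \<omega>) \<partial>P x) =
    (\<integral>\<^sup>+\<omega>. ennreal (exp (l * X t \<omega>)) * ennreal (alive t \<omega>) \<partial>P x)"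
    by (simp add: ennreal_mult')
  also have "\<dots> = (\<integral>\<^sup>+\<omega>. ennreal (exp (l * (x + X t \<omega>))) \<partial>P 0) * ennreal (exp (- p * t))"
    by (rule nn_integral_alive) (use assms in auto)
  also have "(\<integral>\<^sup>+\<omega>. ennreal (exp (l * (x + X t \<omega>))) \<partial>P 0) = (\<integral>\<^sup>+\<omega>. ennreal (exp (l * x)) * ennreal (exp (l * X t \<omega>)) \<partial>P 0)"
    by (rule nn_integral_cong) (simp add: distrib_left exp_add ennreal_mult')
  also have "\<dots> = ennreal (exp (l * x)) * ennreal (exp (t * \<psi> l))"
    using assms by (subst nn_integral_cmult) (auto simp: exp_moment)
  also have "\<dots> * ennreal (exp (- p * t)) = ennreal (exp (l * x) * exp (t * \<psi> l) * exp (- p * t))"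
    by (simp only: ennreal_mult' exp_ge_zero mult_nonneg_nonneg)
  also have "exp (l * x) * exp (t * \<psi> l) * exp (- p * t) = exp (l * x + rate l * t)"
    by (simp add: exp_add[symmetric] algebra_simps)
  finally show ?thesis .
qed

lemma exp_X_alive_markov:
  assumes "0 \<le> l" "0 \<le> s" "s \<le> t" and G: "G \<in> borel_measurable (F s)"
  shows "(\<integral>\<^sup>+\<omega>. G \<omega> * ennreal (exp (l * X t \<omega>) * alive t \<omega>) \<partial>P x) =
    (\<integral>\<^sup>+\<omega>. G \<omega> * ennreal (exp (l * X s \<omega>) * alive s \<omega>) \<partial>P x) * ennreal (exp (rate l * (t - s)))"
proof -
  note [measurable] = G X_F[OF assms(2) order_refl]
  have "(\<integral>\<^sup>+\<omega>. G \<omega> * ennreal (exp (l * X t \<omega>) * alive t \<omega>) \<partial>P x) =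
    (\<integral>\<^sup>+\<omega>. (G \<omega> * ennreal (exp (l * X s \<omega>))) * (ennreal (exp (l * (X (s + (t - s)) \<omega> - X s \<omega>))) * ennreal (alive (s + (t - s)) \<omega>)) \<partial>P x)"
  proof (rule nn_integral_cong)
    fix \<omega>
    have "exp (l * X t \<omega>) = exp (l * X s \<omega>) * exp (l * (X t \<omega> - X s \<omega>))"
      by (simp add: exp_add[symmetric] right_diff_distrib)
    then show "G \<omega> * ennreal (exp (l * X t \<omega>) * alive t \<omega>) = (G \<omega> * ennreal (exp (l * X s \<omega>))) * (ennreal (exp (l * (X (s + (t - s)) \<omega> - X s \<omega>))) * ennreal (alive (s + (t - s)) \<omega>))"
      by (simp add: ennreal_mult' mult.assoc)
  qed
  also have "\<dots> = (\<integral>\<^sup>+\<omega>. (G \<omega> * ennreal (exp (l * X s \<omega>))) * ennreal (alive s \<omega>) \<partial>P x) * ((\<integral>\<^sup>+\<omega>. ennreal (exp (l * X (t - s) \<omega>)) \<partial>P 0) * ennreal (exp (- p * (t - s))))"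
    by (rule e_memoryless_nn_integral[where g="\<lambda>y. ennreal (exp (l * y))"]) (use assms in auto)
  also have "(\<integral>\<^sup>+\<omega>. ennreal (exp (l * X (t - s) \<omega>)) \<partial>P 0) = ennreal (exp ((t - s) * \<psi> l))"
    using assms by (intro exp_moment) auto
  also have "ennreal (exp ((t - s) * \<psi> l)) * ennreal (exp (- p * (t - s))) = ennreal (exp (rate l * (t - s)))"
    by (simp add: ennreal_mult'[symmetric] exp_add[symmetric] algebra_simps)
  finally show ?thesis by (simp add: ennreal_mult' mult.assoc)
qed


text \<open>The discount at \<open>s\<close> is written as the discount at \<open>t\<close> plus the
  integral of its rate of decrease \<open>K u\<close> over \<open>{s..t}\<close>. For fixed
  \<open>u\<close> the weight \<open>K u\<close> belongs to the past at \<open>u\<close>, so the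
  Markov property there pulls \<open>exp (l * X t) * alive t\<close> back to time \<open>u\<close>
  at the cost of \<open>exp (rate l * (t - u))\<close>, and the factor
  \<open>exp (\<alpha> * X u)\<close> in \<open>K u\<close> raises the exponent to
  \<open>l + \<alpha>\<close>. Stating it as a sum of nonnegative integrals makes the exchange of
  integrals free of integrability conditions.\<close>

lemma damped_duhamel_nn:
  fixes G :: "'a \<Rightarrow> ennreal"
  assumes l: "0 \<le> l" and \<beta>: "0 \<le> \<beta>" and st: "0 \<le> s" "s \<le> t" and G: "G \<in> borel_measurable (F s)"
  shows "(\<integral>\<^sup>+\<omega>. G \<omega> * ennreal (damped \<alpha> \<beta> l s \<omega>) \<partial>P x) * ennreal (exp (rate l * (t - s))) =
    (\<integral>\<^sup>+\<omega>. G \<omega> * ennreal (damped \<alpha> \<beta> l t \<omega>) \<partial>P x) +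
    (\<integral>\<^sup>+u. indicator {s..t} u * (ennreal (\<beta> * exp (rate l * (t - u))) *
       (\<integral>\<^sup>+\<omega>. G \<omega> * ennreal (damped \<alpha> \<beta> (l + \<alpha>) (max 0 u) \<omega>) \<partial>P x)) \<partial>lborel)"
proof -
  interpret pair: pair_sigma_finite lborel "P x" ..
  have t: "0 \<le> t" using st by simp
  define D where "D u \<omega> = exp (- (\<beta> * clock \<alpha> u \<omega>))" for u \<omega>
  define K where "K u \<omega> = \<beta> * exp (\<alpha> * X u \<omega>) * D u \<omega>" for u \<omega>
  define A where "A \<omega> = exp (l * X t \<omega>) * alive t \<omega>" for \<omega>
  have A0: "0 \<le> A \<omega>" and D0: "0 \<le> D u \<omega>" and K0: "0 \<le> K u \<omega>" for u \<omega> using \<beta> by (auto simp: A_def D_def K_def)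
  have D_F: "D u \<in> borel_measurable (F u)" if "0 \<le> u" for u
    unfolding D_def using clock_F[OF that order_refl, of \<alpha>] by measurable
  have K_F: "K u \<in> borel_measurable (F u)" if "0 \<le> u" for u
    unfolding K_def using D_F[OF that] X_F[OF that order_refl] by measurable
  have [measurable]: "G \<in> borel_measurable (P x)" by (rule measurable_P[OF G st(1)])
  have [measurable]: "A \<in> borel_measurable (P x)"
    unfolding A_def using X_P[OF t, of x] alive_P[OF t, of x] by measurable
  have [measurable]: "D t \<in> borel_measurable (P x)" by (rule measurable_P[OF D_F[OF t] t])
  have K_joint: "(\<lambda>(u, \<omega>). K (max 0 u) \<omega>) \<in> borel_measurable (borel \<Otimes>\<^sub>M P x)"
  proof (rule jointly_measurable)
    show "K u \<in> borel_measurable (P x)" if "0 \<le> u" for u by (rule measurable_P[OF K_F[OF that] that])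
    show "((\<lambda>u. K u \<omega>) \<longlongrightarrow> K u \<omega>) (at_right u)" if "\<omega> \<in> space (P x)" "0 \<le> u" for u \<omega>
      unfolding K_def D_def by (intro tendsto_intros X_right[OF that] clock_right[OF that])
  qed
  then have [measurable]: "(\<lambda>z. K (max 0 (fst z)) (snd z)) \<in> borel_measurable (lborel \<Otimes>\<^sub>M P x)"
    by (simp add: split_beta')
  have "(\<lambda>z. (snd z, fst z)) \<in> P x \<Otimes>\<^sub>M borel \<rightarrow>\<^sub>M borel \<Otimes>\<^sub>M P x" by measurable
  from measurable_compose[OF this K_joint]
  have [measurable]: "(\<lambda>z. K (max 0 (snd z)) (fst z)) \<in> borel_measurable (P x \<Otimes>\<^sub>M borel)" by simp
  have damped_eq: "ennreal (damped \<alpha> \<beta> l t \<omega>) = ennreal (D t \<omega>) * ennreal (A \<omega>)" for \<omega>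
    using A0 D0 by (simp add: damped_def D_def A_def ennreal_mult'[symmetric] mult_ac)
  have "(\<integral>\<^sup>+\<omega>. G \<omega> * ennreal (damped \<alpha> \<beta> l s \<omega>) \<partial>P x) =
      (\<integral>\<^sup>+\<omega>. (G \<omega> * ennreal (D s \<omega>)) * ennreal (exp (l * X s \<omega>) * alive s \<omega>) \<partial>P x)"
    by (rule nn_integral_cong) (simp add: damped_def D_def ennreal_mult' mult_ac)
  then have "(\<integral>\<^sup>+\<omega>. G \<omega> * ennreal (damped \<alpha> \<beta> l s \<omega>) \<partial>P x) * ennreal (exp (rate l * (t - s))) =
      (\<integral>\<^sup>+\<omega>. (G \<omega> * ennreal (D s \<omega>)) * ennreal (A \<omega>) \<partial>P x)"
    using exp_X_alive_markov[of l s t "\<lambda>\<omega>. G \<omega> * ennreal (D s \<omega>)" x] l st G D_F[OF st(1)]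
    by (simp add: A_def)
  also have "\<dots> = (\<integral>\<^sup>+\<omega>. G \<omega> * ennreal (damped \<alpha> \<beta> l t \<omega>) +
      (\<integral>\<^sup>+u. indicator {s..t} u * ((G \<omega> * ennreal (A \<omega>)) * ennreal (K (max 0 u) \<omega>)) \<partial>lborel) \<partial>P x)"
  proof (rule nn_integral_cong)
    fix \<omega> assume \<omega>: "\<omega> \<in> space (P x)"
    have meas: "(\<lambda>u. K (max 0 u) \<omega>) \<in> borel_measurable borel"
      using measurable_compose[OF measurable_Pair2'[OF \<omega>] K_joint] by simp
    have K_eq: "indicator {s..t} u *\<^sub>R K (max 0 u) \<omega> = indicator {s..t} u *\<^sub>R (\<beta> * exp (\<alpha> * X (max 0 u) \<omega>) * exp (- (\<beta> * clock \<alpha> u \<omega>)))" for u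
      using st by (auto simp: K_def D_def indicator_def)
    have "(\<integral>\<^sup>+u. indicator {s..t} u * ennreal (K (max 0 u) \<omega>) \<partial>lborel) = (\<integral>\<^sup>+u. ennreal (indicator {s..t} u *\<^sub>R K (max 0 u) \<omega>) \<partial>lborel)"
      by (rule nn_integral_cong) (auto simp: indicator_def)
    also have "\<dots> = ennreal (LBINT u:{s..t}. \<beta> * exp (\<alpha> * X (max 0 u) \<omega>) * exp (- (\<beta> * clock \<alpha> u \<omega>)))"
      unfolding set_lebesgue_integral_def K_eq
      by (rule nn_integral_eq_integral)
        (use damping_step(1)[OF \<omega> \<beta> st, of \<alpha>] \<beta> in \<open>auto simp: set_integrable_def\<close>)
    finally have I: "(\<integral>\<^sup>+u. indicator {s..t} u * ennreal (K (max 0 u) \<omega>) \<partial>lborel) =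
        ennreal (LBINT u:{s..t}. \<beta> * exp (\<alpha> * X (max 0 u) \<omega>) * exp (- (\<beta> * clock \<alpha> u \<omega>)))" .
    have "0 \<le> (LBINT u:{s..t}. \<beta> * exp (\<alpha> * X (max 0 u) \<omega>) * exp (- (\<beta> * clock \<alpha> u \<omega>)))"
      unfolding set_lebesgue_integral_def by (rule Bochner_Integration.integral_nonneg) (use \<beta> in auto)
    then have D_eq: "ennreal (D s \<omega>) = ennreal (D t \<omega>) + (\<integral>\<^sup>+u. indicator {s..t} u * ennreal (K (max 0 u) \<omega>) \<partial>lborel)"
      unfolding I using damping_step(2)[OF \<omega> \<beta> st, of \<alpha>] D0 by (simp add: D_def)
    have "(\<integral>\<^sup>+u. indicator {s..t} u * ((G \<omega> * ennreal (A \<omega>)) * ennreal (K (max 0 u) \<omega>)) \<partial>lborel) =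
        (\<integral>\<^sup>+u. (G \<omega> * ennreal (A \<omega>)) * (indicator {s..t} u * ennreal (K (max 0 u) \<omega>)) \<partial>lborel)"
      by (rule nn_integral_cong) (simp only: mult_ac)
    also have "\<dots> = (G \<omega> * ennreal (A \<omega>)) * (\<integral>\<^sup>+u. indicator {s..t} u * ennreal (K (max 0 u) \<omega>) \<partial>lborel)"
      by (rule nn_integral_cmult) (use meas in simp)
    finally show "(G \<omega> * ennreal (D s \<omega>)) * ennreal (A \<omega>) = G \<omega> * ennreal (damped \<alpha> \<beta> l t \<omega>) +
      (\<integral>\<^sup>+u. indicator {s..t} u * ((G \<omega> * ennreal (A \<omega>)) * ennreal (K (max 0 u) \<omega>)) \<partial>lborel)"
      unfolding damped_eq D_eq by (simp only: distrib_left distrib_right mult_ac)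
  qed
  also have "\<dots> = (\<integral>\<^sup>+\<omega>. G \<omega> * ennreal (damped \<alpha> \<beta> l t \<omega>) \<partial>P x) +
      (\<integral>\<^sup>+\<omega>. (\<integral>\<^sup>+u. indicator {s..t} u * ((G \<omega> * ennreal (A \<omega>)) * ennreal (K (max 0 u) \<omega>)) \<partial>lborel) \<partial>P x)"
    by (rule nn_integral_add) (use damped_P[OF t] in measurable)
  also have "(\<integral>\<^sup>+\<omega>. (\<integral>\<^sup>+u. indicator {s..t} u * ((G \<omega> * ennreal (A \<omega>)) * ennreal (K (max 0 u) \<omega>)) \<partial>lborel) \<partial>P x) =
      (\<integral>\<^sup>+u. (\<integral>\<^sup>+\<omega>. indicator {s..t} u * ((G \<omega> * ennreal (A \<omega>)) * ennreal (K (max 0 u) \<omega>)) \<partial>P x) \<partial>lborel)"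
    by (rule pair.Fubini') measurable
  also have "\<dots> = (\<integral>\<^sup>+u. indicator {s..t} u * (ennreal (\<beta> * exp (rate l * (t - u))) *
       (\<integral>\<^sup>+\<omega>. G \<omega> * ennreal (damped \<alpha> \<beta> (l + \<alpha>) (max 0 u) \<omega>) \<partial>P x)) \<partial>lborel)"
  proof (rule nn_integral_cong)
    fix u :: real
    show "(\<integral>\<^sup>+\<omega>. indicator {s..t} u * ((G \<omega> * ennreal (A \<omega>)) * ennreal (K (max 0 u) \<omega>)) \<partial>P x) =
      indicator {s..t} u * (ennreal (\<beta> * exp (rate l * (t - u))) *
       (\<integral>\<^sup>+\<omega>. G \<omega> * ennreal (damped \<alpha> \<beta> (l + \<alpha>) (max 0 u) \<omega>) \<partial>P x))"
    proof (cases "u \<in> {s..t}")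
      case True
      then have u: "s \<le> u" "u \<le> t" "0 \<le> u" using st by auto
      note [measurable] = measurable_F_mono[OF G st(1) u(1)] K_F[OF u(3)]
      have [measurable]: "damped \<alpha> \<beta> (l + \<alpha>) u \<in> borel_measurable (P x)" using u by auto
      have "(\<integral>\<^sup>+\<omega>. (G \<omega> * ennreal (A \<omega>)) * ennreal (K u \<omega>) \<partial>P x) =
        (\<integral>\<^sup>+\<omega>. (G \<omega> * ennreal (K u \<omega>)) * ennreal (exp (l * X t \<omega>) * alive t \<omega>) \<partial>P x)"
        by (rule nn_integral_cong) (simp only: A_def mult_ac)
      also have "\<dots> = (\<integral>\<^sup>+\<omega>. (G \<omega> * ennreal (K u \<omega>)) * ennreal (exp (l * X u \<omega>) * alive u \<omega>) \<partial>P x) * ennreal (exp (rate l * (t - u)))"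
        by (rule exp_X_alive_markov) (use l u in auto)
      also have "(\<integral>\<^sup>+\<omega>. (G \<omega> * ennreal (K u \<omega>)) * ennreal (exp (l * X u \<omega>) * alive u \<omega>) \<partial>P x) =
        (\<integral>\<^sup>+\<omega>. ennreal \<beta> * (G \<omega> * ennreal (damped \<alpha> \<beta> (l + \<alpha>) u \<omega>)) \<partial>P x)"
      proof (rule nn_integral_cong)
        fix \<omega>
        have "K u \<omega> * (exp (l * X u \<omega>) * alive u \<omega>) = \<beta> * damped \<alpha> \<beta> (l + \<alpha>) u \<omega>"
          by (simp add: K_def D_def damped_def distrib_right exp_add mult_ac)
        then have "ennreal (K u \<omega>) * ennreal (exp (l * X u \<omega>) * alive u \<omega>) = ennreal \<beta> * ennreal (damped \<alpha> \<beta> (l + \<alpha>) u \<omega>)"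
          using K0 \<beta> by (simp only: ennreal_mult'[symmetric] damped_nonneg)
        then show "(G \<omega> * ennreal (K u \<omega>)) * ennreal (exp (l * X u \<omega>) * alive u \<omega>) = ennreal \<beta> * (G \<omega> * ennreal (damped \<alpha> \<beta> (l + \<alpha>) u \<omega>))"
          by (metis mult.assoc mult.left_commute)
      qed
      also have "\<dots> = ennreal \<beta> * (\<integral>\<^sup>+\<omega>. G \<omega> * ennreal (damped \<alpha> \<beta> (l + \<alpha>) u \<omega>) \<partial>P x)"
        by (rule nn_integral_cmult) measurable
      finally show ?thesis using True u \<beta> by (simp add: ennreal_mult' mult_ac)
    qed simp
  qed
  finally show ?thesis .
qed

lemma damped_integrable: "0 \<le> l \<Longrightarrow> 0 \<le> \<beta> \<Longrightarrow> 0 \<le> t \<Longrightarrow> integrable (P x) (damped \<alpha> \<beta> l t)"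
  and damped_expectation_le: "0 \<le> l \<Longrightarrow> 0 \<le> \<beta> \<Longrightarrow> 0 \<le> t \<Longrightarrow> (\<integral>\<omega>. damped \<alpha> \<beta> l t \<omega> \<partial>P x) \<le> exp (l * x + rate l * t)"
proof -
  assume a: "0 \<le> l" "0 \<le> \<beta>" "0 \<le> t"
  have "(\<integral>\<^sup>+\<omega>. ennreal (damped \<alpha> \<beta> l t \<omega>) \<partial>P x) \<le> (\<integral>\<^sup>+\<omega>. ennreal (exp (l * X t \<omega>) * alive t \<omega>) \<partial>P x)"
    by (intro nn_integral_mono ennreal_leI damped_le a)
  also have "\<dots> = ennreal (exp (l * x + rate l * t))" by (rule exp_X_alive_moment) fact+
  finally have le: "(\<integral>\<^sup>+\<omega>. ennreal (damped \<alpha> \<beta> l t \<omega>) \<partial>P x) \<le> ennreal (exp (l * x + rate l * t))" .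
  show int: "integrable (P x) (damped \<alpha> \<beta> l t)"
    by (rule integrableI_nonneg) (use a le in \<open>auto intro: order_le_less_trans\<close>)
  show "(\<integral>\<omega>. damped \<alpha> \<beta> l t \<omega> \<partial>P x) \<le> exp (l * x + rate l * t)"
    using le by (subst (asm) nn_integral_eq_integral[OF int]) auto
qed

section \<open>Expectations of the damped process under a weight from the past\<close>

context
  fixes G :: "'a \<Rightarrow> real" and x :: real
  assumes G [measurable]: "G \<in> borel_measurable (P x)" and G01: "\<And>\<omega>. 0 \<le> G \<omega> \<and> G \<omega> \<le> 1"
begin

lemma weighted_damped_integrable:
  assumes "0 \<le> l" "0 \<le> \<beta>" "0 \<le> t" shows "integrable (P x) (\<lambda>\<omega>. G \<omega> * damped \<alpha> \<beta> l t \<omega>)"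
proof (rule Bochner_Integration.integrable_bound[OF damped_integrable[OF assms, of x \<alpha>]])
  show "(\<lambda>\<omega>. G \<omega> * damped \<alpha> \<beta> l t \<omega>) \<in> borel_measurable (P x)"
    using damped_P[OF assms(3), of \<alpha> \<beta> l x] by measurable
qed (use G01 in \<open>auto simp: abs_mult intro!: mult_left_le_one_le\<close>)

lemma weighted_damped_bounds:
  assumes "0 \<le> l" "0 \<le> \<beta>" "0 \<le> t"
  shows "0 \<le> (\<integral>\<omega>. G \<omega> * damped \<alpha> \<beta> l t \<omega> \<partial>P x)"
    and "(\<integral>\<omega>. G \<omega> * damped \<alpha> \<beta> l t \<omega> \<partial>P x) \<le> exp (l * x + rate l * t)"
proof -
  show "0 \<le> (\<integral>\<omega>. G \<omega> * damped \<alpha> \<beta> l t \<omega> \<partial>P x)"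
    by (rule Bochner_Integration.integral_nonneg) (use G01 in auto)
  have "(\<integral>\<omega>. G \<omega> * damped \<alpha> \<beta> l t \<omega> \<partial>P x) \<le> (\<integral>\<omega>. damped \<alpha> \<beta> l t \<omega> \<partial>P x)"
    by (intro integral_mono weighted_damped_integrable damped_integrable assms)
      (use G01 in \<open>auto intro!: mult_left_le_one_le\<close>)
  also have "\<dots> \<le> exp (l * x + rate l * t)" by (rule damped_expectation_le) fact+
  finally show "(\<integral>\<omega>. G \<omega> * damped \<alpha> \<beta> l t \<omega> \<partial>P x) \<le> exp (l * x + rate l * t)" .
qed

lemma weighted_damped_time_measurable:
  "(\<lambda>u. \<integral>\<omega>. G \<omega> * damped \<alpha> \<beta> l (max 0 u) \<omega> \<partial>P x) \<in> borel_measurable borel"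
proof -
  have "(\<lambda>z. damped \<alpha> \<beta> l (max 0 (fst z)) (snd z)) \<in> borel_measurable (borel \<Otimes>\<^sub>M P x)"
    using damped_joint by (simp add: split_beta')
  then show ?thesis by (intro borel_measurable_lebesgue_integral) (simp add: split_beta')
qed

lemma weighted_damped_time_bound:
  assumes "0 \<le> l" "0 \<le> \<beta>" "0 \<le> s" "s \<le> u" "u \<le> t"
  shows "\<bar>\<integral>\<omega>. G \<omega> * damped \<alpha> \<beta> l (max 0 u) \<omega> \<partial>P x\<bar> \<le> exp (l * x + \<bar>rate l\<bar> * t)"
proof -
  have "rate l * u \<le> \<bar>rate l\<bar> * t" using assms by (intro mult_mono) auto
  then have le: "exp (l * x + rate l * u) \<le> exp (l * x + \<bar>rate l\<bar> * t)" by simp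
  have u: "0 \<le> u" using assms by simp
  show ?thesis
    using weighted_damped_bounds(1)[OF assms(1,2) u, of \<alpha>] order_trans[OF weighted_damped_bounds(2)[OF assms(1,2) u, of \<alpha>] le] u
    by simp
qed

lemma weighted_occupation:
  assumes "0 \<le> l" "0 \<le> \<beta>" "0 \<le> s"
  shows "integrable (P x) (\<lambda>\<omega>. G \<omega> * occupation \<alpha> \<beta> l s t \<omega>)" (is ?I)
    and "(\<integral>\<omega>. G \<omega> * occupation \<alpha> \<beta> l s t \<omega> \<partial>P x) = (LBINT u:{s..t}. \<integral>\<omega>. G \<omega> * damped \<alpha> \<beta> l (max 0 u) \<omega> \<partial>P x)" (is ?E)
proof -
  interpret pair: pair_sigma_finite lborel "P x" ..
  define f where "f u \<omega> = indicator {s..t} u * (G \<omega> * damped \<alpha> \<beta> l (max 0 u) \<omega>)" for u \<omega>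
  have [measurable]: "(\<lambda>z. damped \<alpha> \<beta> l (max 0 (fst z)) (snd z)) \<in> borel_measurable (lborel \<Otimes>\<^sub>M P x)"
    using damped_joint by (simp add: split_beta')
  have f_meas: "(\<lambda>(u, \<omega>). f u \<omega>) \<in> borel_measurable (lborel \<Otimes>\<^sub>M P x)"
    unfolding f_def by (simp add: split_beta')
  have f0: "0 \<le> f u \<omega>" for u \<omega> using G01 by (simp add: f_def)
  have inner: "(\<integral>\<omega>. f u \<omega> \<partial>P x) = indicator {s..t} u *\<^sub>R (\<integral>\<omega>. G \<omega> * damped \<alpha> \<beta> l (max 0 u) \<omega> \<partial>P x)" for u
    by (simp add: f_def)
  have outer: "integrable lborel (\<lambda>u. \<integral>\<omega>. f u \<omega> \<partial>P x)"
    unfolding inner set_integrable_def[symmetric]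
    by (rule set_integrable_bounded_Icc[OF weighted_damped_time_measurable weighted_damped_time_bound])
      (use assms in auto)
  have int: "integrable (lborel \<Otimes>\<^sub>M P x) (\<lambda>(u, \<omega>). f u \<omega>)"
  proof (rule pair.Fubini_integrable[OF f_meas])
    show "integrable lborel (\<lambda>u. \<integral>\<omega>. norm (case (u, \<omega>) of (u, \<omega>) \<Rightarrow> f u \<omega>) \<partial>P x)"
      using outer f0 by simp
    show "AE u in lborel. integrable (P x) (\<lambda>\<omega>. case (u, \<omega>) of (u, \<omega>) \<Rightarrow> f u \<omega>)"
      unfolding f_def using assms by (auto intro!: weighted_damped_integrable)
  qed
  have eq: "(\<integral>u. f u \<omega> \<partial>lborel) = G \<omega> * occupation \<alpha> \<beta> l s t \<omega>" for \<omega>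
  proof -
    have "(\<integral>u. f u \<omega> \<partial>lborel) = (\<integral>u. G \<omega> * (indicator {s..t} u *\<^sub>R damped \<alpha> \<beta> l (max 0 u) \<omega>) \<partial>lborel)"
      by (rule Bochner_Integration.integral_cong) (auto simp: f_def)
    then show ?thesis by (simp add: occupation_def set_lebesgue_integral_def)
  qed
  show ?I using pair.integrable_snd[OF int] by (simp add: eq)
  show ?E using pair.Fubini_integral[OF int] by (simp add: eq inner set_lebesgue_integral_def)
qed

text \<open>The martingale property on \<open>{s..t}\<close>, tested against a weight from the past
  at \<open>s\<close>. With \<open>v l u\<close> the weighted expectation at time \<open>u\<close>,
  the Duhamel identity is the hypothesis of \<open>duhamel_imp_integral_equation\<close> for
  \<open>\<kappa> = rate l\<close> and \<open>w = \<beta> * v (l + \<alpha>)\<close>.\<close>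

lemma weighted_damped_evolution:
  assumes "0 \<le> l" "0 \<le> \<alpha>" "0 \<le> \<beta>" "0 \<le> s" "s \<le> t" and G_F: "G \<in> borel_measurable (F s)"
  shows "(\<integral>\<omega>. G \<omega> * (damped \<alpha> \<beta> l t \<omega> - damped \<alpha> \<beta> l s \<omega> +
      (\<beta> * occupation \<alpha> \<beta> (l + \<alpha>) s t \<omega> - rate l * occupation \<alpha> \<beta> l s t \<omega>)) \<partial>P x) = 0"
proof -
  have l\<alpha>: "0 \<le> l + \<alpha>" using assms by simp
  define v where "v l u = (\<integral>\<omega>. G \<omega> * damped \<alpha> \<beta> l (max 0 u) \<omega> \<partial>P x)" for l u
  have v_meas [measurable]: "v l \<in> borel_measurable borel" for l
    unfolding v_def by (rule weighted_damped_time_measurable)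
  have v0: "0 \<le> v l u" if "0 \<le> l" for l u
    unfolding v_def by (rule weighted_damped_bounds) (use that assms in auto)
  have nn: "(\<integral>\<^sup>+\<omega>. ennreal (G \<omega>) * ennreal (damped \<alpha> \<beta> l (max 0 u) \<omega>) \<partial>P x) = ennreal (v l u)" if "0 \<le> l" for l u
  proof -
    have "(\<integral>\<^sup>+\<omega>. ennreal (G \<omega>) * ennreal (damped \<alpha> \<beta> l (max 0 u) \<omega>) \<partial>P x) = (\<integral>\<^sup>+\<omega>. ennreal (G \<omega> * damped \<alpha> \<beta> l (max 0 u) \<omega>) \<partial>P x)"
      using G01 by (intro nn_integral_cong) (simp add: ennreal_mult')
    also have "\<dots> = ennreal (v l u)"
      unfolding v_def by (rule nn_integral_eq_integral[OF weighted_damped_integrable]) (use that assms G01 in auto)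
    finally show ?thesis .
  qed
  have "v l t = v l s + rate l * (LBINT r:{s..t}. v l r) - (LBINT u:{s..t}. \<beta> * v (l + \<alpha>) u)"
  proof (rule duhamel_imp_integral_equation)
    fix r assume r: "s \<le> r" "r \<le> t"
    let ?g = "\<lambda>u. exp (rate l * (r - u)) * (\<beta> * v (l + \<alpha>) u)"
    have g0: "0 \<le> ?g u" for u using assms v0[OF l\<alpha>] by simp
    have g_int: "set_integrable lborel {s..r} ?g"
    proof (rule set_integrable_bounded_Icc[where C="exp (\<bar>rate l\<bar> * r) * (\<beta> * exp ((l + \<alpha>) * x + \<bar>rate (l + \<alpha>)\<bar> * r))"])
      fix u assume u: "s \<le> u" "u \<le> r"
      have "rate l * (r - u) \<le> \<bar>rate l\<bar> * r" using u assms by (intro mult_mono) auto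
      moreover have "v (l + \<alpha>) u \<le> exp ((l + \<alpha>) * x + \<bar>rate (l + \<alpha>)\<bar> * r)"
        using weighted_damped_time_bound[of "l + \<alpha>" \<beta> s u r \<alpha>] u assms by (simp add: v_def)
      ultimately have "?g u \<le> exp (\<bar>rate l\<bar> * r) * (\<beta> * exp ((l + \<alpha>) * x + \<bar>rate (l + \<alpha>)\<bar> * r))"
        using assms v0[OF l\<alpha>, of u] by (intro mult_mono) auto
      then show "\<bar>?g u\<bar> \<le> exp (\<bar>rate l\<bar> * r) * (\<beta> * exp ((l + \<alpha>) * x + \<bar>rate (l + \<alpha>)\<bar> * r))"
        using g0[of u] by (simp only: abs_of_nonneg)
    qed measurable
    have "(\<integral>\<^sup>+u. indicator {s..r} u * (ennreal (\<beta> * exp (rate l * (r - u))) * ennreal (v (l + \<alpha>) u)) \<partial>lborel) =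
      (\<integral>\<^sup>+u. ennreal (indicator {s..r} u *\<^sub>R ?g u) \<partial>lborel)"
      by (rule nn_integral_cong) (use assms v0[OF l\<alpha>] in \<open>auto simp: indicator_def ennreal_mult'[symmetric] mult_ac\<close>)
    also have "\<dots> = ennreal (LBINT u:{s..r}. ?g u)"
      unfolding set_lebesgue_integral_def
      by (rule nn_integral_eq_integral) (use g_int g0 in \<open>auto simp: set_integrable_def\<close>)
    finally have I: "(\<integral>\<^sup>+u. indicator {s..r} u * (ennreal (\<beta> * exp (rate l * (r - u))) * ennreal (v (l + \<alpha>) u)) \<partial>lborel) =
      ennreal (LBINT u:{s..r}. ?g u)" .
    have pos: "0 \<le> (LBINT u:{s..r}. ?g u)"
      unfolding set_lebesgue_integral_def by (rule Bochner_Integration.integral_nonneg) (use g0 in auto)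
    have "ennreal (v l s) * ennreal (exp (rate l * (r - s))) = ennreal (v l r) + ennreal (LBINT u:{s..r}. ?g u)"
      using damped_duhamel_nn[of l \<beta> s r "\<lambda>\<omega>. ennreal (G \<omega>)" x \<alpha>] G_F assms r nn[of l s] nn[of l r] nn[OF l\<alpha>] I
      by simp
    then have "ennreal (v l s * exp (rate l * (r - s))) = ennreal (v l r + (LBINT u:{s..r}. ?g u))"
      using v0[OF assms(1)] pos by (simp add: ennreal_mult')
    then show "v l s * exp (rate l * (r - s)) = v l r + (LBINT u:{s..r}. ?g u)"
      using v0[OF assms(1)] pos by (subst (asm) ennreal_inj) auto
  next
    fix u assume u: "s \<le> u" "u \<le> t"
    show "\<bar>\<beta> * v (l + \<alpha>) u\<bar> \<le> \<beta> * exp ((l + \<alpha>) * x + \<bar>rate (l + \<alpha>)\<bar> * t)"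
      using weighted_damped_time_bound[of "l + \<alpha>" \<beta> s u t \<alpha>] u assms
      by (simp add: v_def abs_mult mult_left_mono)
  qed (use assms in measurable)
  then have *: "v l t - v l s + (\<beta> * (LBINT u:{s..t}. v (l + \<alpha>) u) - rate l * (LBINT r:{s..t}. v l r)) = 0"
    by simp
  note int = weighted_damped_integrable[OF assms(1,3), of t \<alpha>] weighted_damped_integrable[OF assms(1,3,4), of \<alpha>]
    weighted_occupation(1)[OF l\<alpha> assms(3,4), of \<alpha> t] weighted_occupation(1)[OF assms(1,3,4), of \<alpha> t]
  have "(\<integral>\<omega>. G \<omega> * (damped \<alpha> \<beta> l t \<omega> - damped \<alpha> \<beta> l s \<omega> +
      (\<beta> * occupation \<alpha> \<beta> (l + \<alpha>) s t \<omega> - rate l * occupation \<alpha> \<beta> l s t \<omega>)) \<partial>P x) =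
    (\<integral>\<omega>. G \<omega> * damped \<alpha> \<beta> l t \<omega> - G \<omega> * damped \<alpha> \<beta> l s \<omega> +
      (\<beta> * (G \<omega> * occupation \<alpha> \<beta> (l + \<alpha>) s t \<omega>) - rate l * (G \<omega> * occupation \<alpha> \<beta> l s t \<omega>)) \<partial>P x)"
    by (rule Bochner_Integration.integral_cong) (auto simp: algebra_simps)
  also have "\<dots> = v l t - v l s + (\<beta> * (LBINT u:{s..t}. v (l + \<alpha>) u) - rate l * (LBINT r:{s..t}. v l r))"
    using int assms weighted_occupation(2)[OF l\<alpha> assms(3,4), of \<alpha> t] weighted_occupation(2)[OF assms(1,3,4), of \<alpha> t]
    by (simp add: v_def)
  finally show ?thesis using * by simp
qed

end


section \<open>Optional stopping at first passage\<close>

lemma occupation_split: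
  assumes "\<omega> \<in> space (P x)" "0 \<le> \<beta>" "0 \<le> r" "r \<le> t"
  shows "occupation \<alpha> \<beta> l 0 t \<omega> = occupation \<alpha> \<beta> l 0 r \<omega> + occupation \<alpha> \<beta> l r t \<omega>"
  unfolding occupation_def
  by (rule set_integral_Icc_combine[OF damped_path_integrable[OF assms(1,2)] assms(3,4)])

lemma occupation_nonneg: "0 \<le> occupation \<alpha> \<beta> l s t \<omega>"
  unfolding occupation_def set_lebesgue_integral_def by (rule Bochner_Integration.integral_nonneg) simp

lemma occupation_mono:
  assumes "\<omega> \<in> space (P x)" "0 \<le> \<beta>" "0 \<le> r" "r \<le> t"
  shows "occupation \<alpha> \<beta> l 0 r \<omega> \<le> occupation \<alpha> \<beta> l 0 t \<omega>" "occupation \<alpha> \<beta> l r t \<omega> \<le> occupation \<alpha> \<beta> l 0 t \<omega>"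
  using occupation_split[OF assms, of \<alpha> l] occupation_nonneg[of \<alpha> \<beta> l r t \<omega>] occupation_nonneg[of \<alpha> \<beta> l 0 r \<omega>] by auto

lemma occupation_right:
  assumes "\<omega> \<in> space (P x)" "0 \<le> \<beta>" "0 \<le> r" "r < t"
  shows "((\<lambda>r. occupation \<alpha> \<beta> l r t \<omega>) \<longlongrightarrow> occupation \<alpha> \<beta> l r t \<omega>) (at_right r)"
proof -
  have "((\<lambda>r. occupation \<alpha> \<beta> l 0 t \<omega> - occupation \<alpha> \<beta> l 0 r \<omega>) \<longlongrightarrow> occupation \<alpha> \<beta> l 0 t \<omega> - occupation \<alpha> \<beta> l 0 r \<omega>) (at_right r)"
    unfolding occupation_def
    by (intro tendsto_intros set_integral_Icc_right_continuous[OF damped_path_integrable[OF assms(1,2)] assms(3,4)])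
  moreover have "occupation \<alpha> \<beta> l 0 t \<omega> - occupation \<alpha> \<beta> l 0 s \<omega> = occupation \<alpha> \<beta> l s t \<omega>" if "0 \<le> s" "s \<le> t" for s
    using occupation_split[OF assms(1,2) that, of \<alpha> l] by simp
  moreover from this have "\<forall>\<^sub>F s in at_right r. occupation \<alpha> \<beta> l 0 t \<omega> - occupation \<alpha> \<beta> l 0 s \<omega> = occupation \<alpha> \<beta> l s t \<omega>"
    unfolding eventually_at_right_field using assms by (intro exI[of _ t]) auto
  ultimately show ?thesis
    using assms by (auto intro: Lim_transform_eventually)
qed

lemma occupation_P:
  assumes "0 \<le> \<beta>" and [measurable]: "S \<in> borel_measurable (P x)" "T \<in> borel_measurable (P x)"
  shows "(\<lambda>\<omega>. occupation \<alpha> \<beta> l (S \<omega>) (T \<omega>) \<omega>) \<in> borel_measurable (P x)"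
proof -
  have "(\<lambda>z. (snd z, fst z)) \<in> P x \<Otimes>\<^sub>M borel \<rightarrow>\<^sub>M borel \<Otimes>\<^sub>M P x" by measurable
  from measurable_compose[OF this damped_joint[of \<alpha> \<beta> l x]]
  have [measurable]: "(\<lambda>z. damped \<alpha> \<beta> l (max 0 (snd z)) (fst z)) \<in> borel_measurable (P x \<Otimes>\<^sub>M borel)" by simp
  have "(\<lambda>\<omega>. \<integral>u. (if S \<omega> \<le> u \<and> u \<le> T \<omega> then damped \<alpha> \<beta> l (max 0 u) \<omega> else 0) \<partial>lborel) \<in> borel_measurable (P x)"
    by (rule lborel.borel_measurable_lebesgue_integral) (simp add: split_beta')
  moreover have "(\<lambda>\<omega>. occupation \<alpha> \<beta> l (S \<omega>) (T \<omega>) \<omega>) = (\<lambda>\<omega>. \<integral>u. (if S \<omega> \<le> u \<and> u \<le> T \<omega> then damped \<alpha> \<beta> l (max 0 u) \<omega> else 0) \<partial>lborel)"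
    unfolding occupation_def set_lebesgue_integral_def
    by (intro ext Bochner_Integration.integral_cong) (auto simp: indicator_def)
  ultimately show ?thesis by simp
qed

lemma damped_stopped_P:
  assumes "0 \<le> t" shows "(\<lambda>\<omega>. damped \<alpha> \<beta> l (stopped_time c t \<omega>) \<omega>) \<in> borel_measurable (P x)"
proof -
  have "(\<lambda>\<omega>. (stopped_time c t \<omega>, \<omega>)) \<in> P x \<rightarrow>\<^sub>M borel \<Otimes>\<^sub>M P x" by measurable
  from measurable_compose[OF this damped_joint[of \<alpha> \<beta> l x]] show ?thesis
    using stopped_time_bounds(1)[OF assms, of c] by simp
qed

lemma occupation_integrable:
  assumes "0 \<le> l" "0 \<le> \<beta>" "0 \<le> t" shows "integrable (P x) (occupation \<alpha> \<beta> l 0 t)"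
  using weighted_occupation(1)[of "\<lambda>_. 1" x l \<beta> 0 \<alpha> t] assms by simp

lemma regular_path:
  assumes "x \<le> c"
  shows "AE \<omega> in P x. \<omega> \<in> space (P x) \<and> no_positive_jumps (\<lambda>t. X t \<omega>) \<and> X 0 \<omega> = x \<and> X 0 \<omega> \<le> c \<and> alive 0 \<omega> = 1"
  using AE_space no_pos_jumps[of x] X_0[of x] alive_0[of x] by eventually_elim (use assms in auto)

text \<open>The increment after the stopped time is treated, not the one before it: which cell
  contains the passage is known at the right end of that cell, so on each cell
  \<open>weighted_damped_evolution\<close> applies from the grid point up to \<open>t\<close> and
  gives expectation 0. Refining the grid moves the starting point down to the stopped time; paths
  without passage before \<open>t\<close> contribute 0 on both sides.\<close>

lemma stopped_drift_expectation:
  assumes l: "0 \<le> l" and \<alpha>: "0 \<le> \<alpha>" and \<beta>: "0 \<le> \<beta>" and t: "0 < t" and xc: "x \<le> c"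
  defines "D \<equiv> \<lambda>r \<omega>. damped \<alpha> \<beta> l t \<omega> - damped \<alpha> \<beta> l r \<omega> +
      (\<beta> * occupation \<alpha> \<beta> (l + \<alpha>) r t \<omega> - rate l * occupation \<alpha> \<beta> l r t \<omega>)"
  shows "(\<integral>\<omega>. D (stopped_time c t \<omega>) \<omega> \<partial>P x) = 0"
proof -
  have t': "0 \<le> t" using t by simp
  have l\<alpha>: "0 \<le> l + \<alpha>" using l \<alpha> by simp
  \<comment> \<open>At the grid point the path may already be above \<open>c\<close>. Truncation at
    \<open>c + 1\<close> bounds \<open>damped \<alpha> \<beta> l\<close> there by
    \<open>exp (l * (c + 1))\<close>, which provides the majorant \<open>W\<close>; it disappears in
    the limit because the path tends to \<open>c\<close> from the right of the passage.\<close>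
  define G where "G n k \<omega> = indicator (passage_in_cell c t n k) \<omega> * (indicator {..c + 1} (X (grid t n k) \<omega>) :: real)" for n k \<omega>
  define R where "R n \<omega> = (\<Sum>k=1..Suc n. indicator (passage_in_cell c t n k) \<omega> *
      (indicator {..c + 1} (X (grid t n k) \<omega>) * D (grid t n k) \<omega>))" for n \<omega>
  have G_F: "G n k \<in> borel_measurable (F (grid t n k))" for n k
    unfolding G_def using passage_in_cell_F[OF t', of c n k] X_F[OF grid_nonneg[OF t'] order_refl, of n k] by measurable
  have G_P: "G n k \<in> borel_measurable (P x)" for n k
    by (rule measurable_P[OF G_F grid_nonneg[OF t']])
  have G01: "0 \<le> G n k \<omega> \<and> G n k \<omega> \<le> 1" for n k \<omega> by (simp add: G_def indicator_def)
  have GD_int: "integrable (P x) (\<lambda>\<omega>. G n k \<omega> * D (grid t n k) \<omega>)" and GD_0: "(\<integral>\<omega>. G n k \<omega> * D (grid t n k) \<omega> \<partial>P x) = 0"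
    if k: "k \<in> {1..Suc n}" for n k
  proof -
    let ?r = "grid t n k"
    have r: "0 \<le> ?r" "?r \<le> t" using grid_nonneg[OF t'] grid_le[OF t', of k n] k by auto
    note int = weighted_damped_integrable[OF G_P[of n k] G01 l \<beta> t', of \<alpha>] weighted_damped_integrable[OF G_P[of n k] G01 l \<beta> r(1), of \<alpha>]
      weighted_occupation(1)[OF G_P[of n k] G01 l\<alpha> \<beta> r(1), of \<alpha> t] weighted_occupation(1)[OF G_P[of n k] G01 l \<beta> r(1), of \<alpha> t]
    have "integrable (P x) (\<lambda>\<omega>. G n k \<omega> * damped \<alpha> \<beta> l t \<omega> - G n k \<omega> * damped \<alpha> \<beta> l ?r \<omega> +
      (\<beta> * (G n k \<omega> * occupation \<alpha> \<beta> (l + \<alpha>) ?r t \<omega>) - rate l * (G n k \<omega> * occupation \<alpha> \<beta> l ?r t \<omega>)))"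
      using int by (intro Bochner_Integration.integrable_add Bochner_Integration.integrable_diff integrable_mult_right) auto
    then show "integrable (P x) (\<lambda>\<omega>. G n k \<omega> * D (grid t n k) \<omega>)"
      by (rule Bochner_Integration.integrable_cong[THEN iffD1, rotated 2]) (auto simp: D_def algebra_simps)
    show "(\<integral>\<omega>. G n k \<omega> * D (grid t n k) \<omega> \<partial>P x) = 0"
      unfolding D_def by (rule weighted_damped_evolution[OF G_P G01 l \<alpha> \<beta> r G_F])
  qed
  have R_eq: "R n \<omega> = (\<Sum>k=1..Suc n. G n k \<omega> * D (grid t n k) \<omega>)" for n \<omega>
    unfolding R_def G_def by (simp only: mult.assoc)
  have R_int: "integrable (P x) (R n)" for n
    unfolding R_eq[abs_def] by (rule Bochner_Integration.integrable_sum) (rule GD_int)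
  have R_0: "(\<integral>\<omega>. R n \<omega> \<partial>P x) = 0" for n
    unfolding R_eq by (subst Bochner_Integration.integral_sum) (use GD_int GD_0 in auto)
  define W where "W \<omega> = damped \<alpha> \<beta> l t \<omega> + exp (l * (c + 1)) + (\<beta> * occupation \<alpha> \<beta> (l + \<alpha>) 0 t \<omega> + \<bar>rate l\<bar> * occupation \<alpha> \<beta> l 0 t \<omega>)" for \<omega>
  have "(\<lambda>n. \<integral>\<omega>. R n \<omega> \<partial>P x) \<longlonglongrightarrow> (\<integral>\<omega>. D (stopped_time c t \<omega>) \<omega> \<partial>P x)"
  proof (rule integral_dominated_convergence[where w=W])
    have m: "damped \<alpha> \<beta> l t \<in> borel_measurable (P x)"
      "(\<lambda>\<omega>. damped \<alpha> \<beta> l (stopped_time c t \<omega>) \<omega>) \<in> borel_measurable (P x)"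
      "(\<lambda>\<omega>. occupation \<alpha> \<beta> (l + \<alpha>) (stopped_time c t \<omega>) t \<omega>) \<in> borel_measurable (P x)"
      "(\<lambda>\<omega>. occupation \<alpha> \<beta> l (stopped_time c t \<omega>) t \<omega>) \<in> borel_measurable (P x)"
      using damped_stopped_P[OF t'] damped_P[OF t'] by (auto intro!: occupation_P \<beta>)
    then show "(\<lambda>\<omega>. D (stopped_time c t \<omega>) \<omega>) \<in> borel_measurable (P x)"
      unfolding D_def by measurable
    show "R n \<in> borel_measurable (P x)" for n using R_int by auto
    show "integrable (P x) W"
      unfolding W_def[abs_def] using damped_integrable[OF l \<beta> t'] occupation_integrable[OF l\<alpha> \<beta> t'] occupation_integrable[OF l \<beta> t']
      by (intro Bochner_Integration.integrable_add integrable_mult_right) auto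
    show "AE \<omega> in P x. (\<lambda>n. R n \<omega>) \<longlonglongrightarrow> D (stopped_time c t \<omega>) \<omega>"
      using regular_path[OF xc]
    proof eventually_elim
      case (elim \<omega>)
      then have \<omega>: "\<omega> \<in> space (P x)" and npj: "no_positive_jumps (\<lambda>t. X t \<omega>)" and X0: "X 0 \<omega> \<le> c" by auto
      let ?T = "stopped_time c t \<omega>"
      show ?case
      proof (cases "first_passage_above X c \<omega> < ennreal t")
        case True
        have T: "0 \<le> ?T" "?T < t"
        proof -
          show T0: "0 \<le> ?T" by (rule stopped_time_bounds[OF t'])
          have "ennreal ?T < ennreal t" using True by (simp add: ennreal_stopped_time[OF t'] min_def)
          then show "?T < t" using T0 by (simp add: ennreal_less_iff)
        qed
        have "((\<lambda>t. X t \<omega>) \<longlongrightarrow> c) (at_right ?T)"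
          using X_right[OF \<omega> T(1)] X_stopped_eq[OF \<omega> npj X0 t' True] by simp
        then have "\<forall>\<^sub>F r in at_right ?T. X r \<omega> < c + 1"
          by (rule order_tendstoD(2)) simp
        then have ev: "\<forall>\<^sub>F r in at_right ?T. D r \<omega> = indicator {..c + 1} (X r \<omega>) * D r \<omega>"
          by eventually_elim simp
        have "((\<lambda>r. D r \<omega>) \<longlongrightarrow> D ?T \<omega>) (at_right ?T)"
          unfolding D_def by (intro tendsto_intros damped_right[OF \<omega> T(1)] occupation_right[OF \<omega> \<beta> T])
        then have "((\<lambda>r. indicator {..c + 1} (X r \<omega>) * D r \<omega>) \<longlongrightarrow> D ?T \<omega>) (at_right ?T)"
          by (rule Lim_transform_eventually[OF _ ev])
        then show ?thesis unfolding R_def by (rule grid_limit[OF t True])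
      next
        case False
        then have ge: "ennreal t \<le> first_passage_above X c \<omega>" by simp
        have "occupation \<alpha> \<beta> l t t \<omega> = 0" for l
          using occupation_split[OF \<omega> \<beta> t' order_refl, of \<alpha> l] by simp
        then have "D ?T \<omega> = 0" by (simp add: D_def stopped_time_eq[OF t' ge])
        moreover have "R n \<omega> = 0" for n unfolding R_def by (rule grid_sum_eq_0[OF t' ge])
        ultimately show ?thesis by simp
      qed
    qed
    show "AE \<omega> in P x. norm (R n \<omega>) \<le> W \<omega>" for n
      using AE_space
    proof eventually_elim
      case (elim \<omega>)
      have "\<bar>indicator {..c + 1} (X (grid t n k) \<omega>) * D (grid t n k) \<omega>\<bar> \<le> W \<omega>" if k: "1 \<le> k" "k \<le> Suc n" for k
      proof (cases "X (grid t n k) \<omega> \<le> c + 1")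
        case True
        let ?r = "grid t n k"
        have r: "0 \<le> ?r" "?r \<le> t" using grid_nonneg[OF t'] grid_le[OF t', of k n] k by auto
        have a: "damped \<alpha> \<beta> l ?r \<omega> \<le> exp (l * (c + 1))"
          by (rule order_trans[OF damped_le_exp[OF \<beta>]]) (use True l in \<open>auto intro: mult_left_mono\<close>)
        have b: "\<beta> * occupation \<alpha> \<beta> (l + \<alpha>) ?r t \<omega> \<le> \<beta> * occupation \<alpha> \<beta> (l + \<alpha>) 0 t \<omega>"
          "\<bar>rate l\<bar> * occupation \<alpha> \<beta> l ?r t \<omega> \<le> \<bar>rate l\<bar> * occupation \<alpha> \<beta> l 0 t \<omega>"
          using occupation_mono(2)[OF elim \<beta> r] \<beta> by (auto intro!: mult_left_mono)
        have c: "\<bar>rate l * occupation \<alpha> \<beta> l ?r t \<omega>\<bar> = \<bar>rate l\<bar> * occupation \<alpha> \<beta> l ?r t \<omega>"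
          using occupation_nonneg by (simp add: abs_mult)
        have d: "0 \<le> \<beta> * occupation \<alpha> \<beta> (l + \<alpha>) ?r t \<omega>" using \<beta> occupation_nonneg by simp
        have "\<bar>D ?r \<omega>\<bar> \<le> W \<omega>"
          unfolding D_def W_def using a b c d damped_nonneg[of \<alpha> \<beta> l t \<omega>] damped_nonneg[of \<alpha> \<beta> l ?r \<omega>] by linarith
        then show ?thesis using True by simp
      next
        case False
        have "0 \<le> W \<omega>" unfolding W_def using \<beta> by (intro add_nonneg_nonneg mult_nonneg_nonneg occupation_nonneg) auto
        then show ?thesis using False by simp
      qed
      moreover have "0 \<le> W \<omega>" unfolding W_def using \<beta> by (intro add_nonneg_nonneg mult_nonneg_nonneg occupation_nonneg) auto
      ultimately show ?case unfolding R_def using t' by (simp only: real_norm_def) (rule grid_sum_le)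
    qed
  qed
  then show ?thesis unfolding R_0 by (simp add: LIMSEQ_const_iff)
qed

lemma stopped_occupation_integrable:
  assumes "0 \<le> l" "0 \<le> \<beta>" "0 \<le> t"
  shows "integrable (P x) (\<lambda>\<omega>. occupation \<alpha> \<beta> l 0 (stopped_time c t \<omega>) \<omega>)"
proof (rule Bochner_Integration.integrable_bound[OF occupation_integrable[OF assms, of x \<alpha>]])
  show "(\<lambda>\<omega>. occupation \<alpha> \<beta> l 0 (stopped_time c t \<omega>) \<omega>) \<in> borel_measurable (P x)"
    by (rule occupation_P) (use assms in auto)
  show "AE \<omega> in P x. norm (occupation \<alpha> \<beta> l 0 (stopped_time c t \<omega>) \<omega>) \<le> norm (occupation \<alpha> \<beta> l 0 t \<omega>)"
    using AE_space
    by eventually_elim (use occupation_mono(1)[OF _ assms(2) stopped_time_bounds[OF assms(3)]] occupation_nonneg in auto)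
qed

lemma stopped_damped_le:
  assumes "0 \<le> l" "0 \<le> \<beta>" "0 \<le> t" "x \<le> c"
  shows "AE \<omega> in P x. damped \<alpha> \<beta> l (stopped_time c t \<omega>) \<omega> \<le> exp (l * c)"
  using regular_path[OF assms(4)]
proof eventually_elim
  case (elim \<omega>)
  then have "l * X (stopped_time c t \<omega>) \<omega> \<le> l * c"
    using X_stopped_le[of \<omega> x c t] assms by (intro mult_left_mono) auto
  then show ?case using damped_le_exp[OF assms(2), of \<alpha> l "stopped_time c t \<omega>" \<omega>] by (meson exp_le_cancel_iff order_trans)
qed

lemma stopped_damped_integrable:
  assumes "0 \<le> l" "0 \<le> \<beta>" "0 \<le> t" "x \<le> c"
  shows "integrable (P x) (\<lambda>\<omega>. damped \<alpha> \<beta> l (stopped_time c t \<omega>) \<omega>)"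
  by (rule integrable_const_bound[where B="exp (l * c)"])
    (use stopped_damped_le[OF assms, of \<alpha>] damped_stopped_P[OF assms(3)] in \<open>auto elim!: eventually_mono\<close>)

text \<open>The evolution over all of \<open>{0..t}\<close> minus the part after the stopped time,
  whose expectation is 0 by \<open>stopped_drift_expectation\<close>.\<close>

lemma stopped_identity:
  assumes l: "0 \<le> l" and \<alpha>: "0 \<le> \<alpha>" and \<beta>: "0 \<le> \<beta>" and t: "0 < t" and xc: "x \<le> c"
  shows "(\<integral>\<omega>. damped \<alpha> \<beta> l (stopped_time c t \<omega>) \<omega> \<partial>P x) +
      \<beta> * (\<integral>\<omega>. occupation \<alpha> \<beta> (l + \<alpha>) 0 (stopped_time c t \<omega>) \<omega> \<partial>P x) -
      rate l * (\<integral>\<omega>. occupation \<alpha> \<beta> l 0 (stopped_time c t \<omega>) \<omega> \<partial>P x) = exp (l * x)"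
proof -
  have t': "0 \<le> t" and l\<alpha>: "0 \<le> l + \<alpha>" using t l \<alpha> by auto
  let ?T = "stopped_time c t"
  let ?W = "\<lambda>S \<omega>. damped \<alpha> \<beta> l (S \<omega>) \<omega> + (\<beta> * occupation \<alpha> \<beta> (l + \<alpha>) 0 (S \<omega>) \<omega> - rate l * occupation \<alpha> \<beta> l 0 (S \<omega>) \<omega>)"
  note int = damped_integrable[OF l \<beta> t', of x \<alpha>] damped_integrable[OF l \<beta> order_refl, of x \<alpha>]
    occupation_integrable[OF l\<alpha> \<beta> t', of x \<alpha>] occupation_integrable[OF l \<beta> t', of x \<alpha>]
    stopped_damped_integrable[OF l \<beta> t' xc, of \<alpha>] stopped_occupation_integrable[OF l\<alpha> \<beta> t', of x \<alpha> c] stopped_occupation_integrable[OF l \<beta> t', of x \<alpha> c]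
  have W_int: "integrable (P x) (?W ?T)" "integrable (P x) (?W (\<lambda>_. t))"
    using int by (auto intro!: Bochner_Integration.integrable_add Bochner_Integration.integrable_diff integrable_mult_right)
  have "(\<integral>\<omega>. ?W (\<lambda>_. t) \<omega> - ?W ?T \<omega> \<partial>P x) =
    (\<integral>\<omega>. damped \<alpha> \<beta> l t \<omega> - damped \<alpha> \<beta> l (?T \<omega>) \<omega> +
      (\<beta> * occupation \<alpha> \<beta> (l + \<alpha>) (?T \<omega>) t \<omega> - rate l * occupation \<alpha> \<beta> l (?T \<omega>) t \<omega>) \<partial>P x)"
  proof (rule Bochner_Integration.integral_cong)
    fix \<omega> assume \<omega>: "\<omega> \<in> space (P x)"
    have "occupation \<alpha> \<beta> l 0 t \<omega> = occupation \<alpha> \<beta> l 0 (?T \<omega>) \<omega> + occupation \<alpha> \<beta> l (?T \<omega>) t \<omega>" for l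
      by (rule occupation_split[OF \<omega> \<beta> stopped_time_bounds[OF t']])
    then show "?W (\<lambda>_. t) \<omega> - ?W ?T \<omega> = damped \<alpha> \<beta> l t \<omega> - damped \<alpha> \<beta> l (?T \<omega>) \<omega> +
      (\<beta> * occupation \<alpha> \<beta> (l + \<alpha>) (?T \<omega>) t \<omega> - rate l * occupation \<alpha> \<beta> l (?T \<omega>) t \<omega>)"
      by (simp add: distrib_left)
  qed simp
  also have "\<dots> = 0" by (rule stopped_drift_expectation[OF l \<alpha> \<beta> t xc])
  finally have 1: "(\<integral>\<omega>. ?W (\<lambda>_. t) \<omega> \<partial>P x) = (\<integral>\<omega>. ?W ?T \<omega> \<partial>P x)"
    using Bochner_Integration.integral_diff[OF W_int(2,1)] by simp
  have "(\<integral>\<omega>. ?W (\<lambda>_. t) \<omega> - damped \<alpha> \<beta> l 0 \<omega> \<partial>P x) = 0"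
  proof -
    have "(\<integral>\<omega>. ?W (\<lambda>_. t) \<omega> - damped \<alpha> \<beta> l 0 \<omega> \<partial>P x) = (\<integral>\<omega>. 1 * (damped \<alpha> \<beta> l t \<omega> - damped \<alpha> \<beta> l 0 \<omega> +
      (\<beta> * occupation \<alpha> \<beta> (l + \<alpha>) 0 t \<omega> - rate l * occupation \<alpha> \<beta> l 0 t \<omega>)) \<partial>P x)"
      by (rule Bochner_Integration.integral_cong) auto
    also have "\<dots> = 0" by (rule weighted_damped_evolution) (use l \<alpha> \<beta> t' in auto)
    finally show ?thesis .
  qed
  then have 2: "(\<integral>\<omega>. ?W (\<lambda>_. t) \<omega> \<partial>P x) = (\<integral>\<omega>. damped \<alpha> \<beta> l 0 \<omega> \<partial>P x)"
    using Bochner_Integration.integral_diff[OF W_int(2) int(2)] by simp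
  have "(\<integral>\<omega>. damped \<alpha> \<beta> l 0 \<omega> \<partial>P x) = (\<integral>\<omega>. exp (l * x) \<partial>P x)"
  proof (rule integral_cong_AE)
    show "AE \<omega> in P x. damped \<alpha> \<beta> l 0 \<omega> = exp (l * x)"
      using regular_path[OF xc] by eventually_elim (simp add: damped_def)
  qed auto
  then have 3: "(\<integral>\<omega>. damped \<alpha> \<beta> l 0 \<omega> \<partial>P x) = exp (l * x)" by (simp add: prob_space)
  show ?thesis using 1 2 3 int(5-7) by simp
qed

end

section \<open>The Laplace exponent\<close>

text \<open>Convexity with \<open>\<psi> 0 = 0\<close> makes \<open>\<psi> l / l\<close>
  nondecreasing, so above \<Phi> the level stays exceeded. Below \<Phi>, strictness comes from
  interpolating between a point near 0 where \<open>\<psi> < p\<close> and a point just below \<Phi>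
  where \<open>\<psi> \<le> p\<close>. A convex function is continuous inside its domain, and \<Phi>
  > 0, so the level is attained at \<Phi>. The hypothesis \<open>neg\<close> concerns only
  \<open>p = 0\<close>; for positive \<open>p\<close> the point near 0 comes from
  \<open>\<psi> l \<le> l * \<psi> 1\<close>.\<close>

lemma convex_level_crossing:
  fixes \<psi> :: "real \<Rightarrow> real"
  assumes cvx: "convex_on {0..} \<psi>" and \<psi>0: "\<psi> 0 = 0" and p: "0 \<le> p"
    and unb: "\<exists>l\<ge>0. p < \<psi> l" and neg: "p = 0 \<Longrightarrow> \<exists>l>0. \<psi> l < 0"
  defines "\<Phi> \<equiv> Inf {l. 0 \<le> l \<and> \<psi> l > p}"
  shows "0 < \<Phi>" and "\<psi> \<Phi> = p" and "\<And>l. 0 < l \<Longrightarrow> l < \<Phi> \<Longrightarrow> \<psi> l < p" and "\<And>l. \<Phi> < l \<Longrightarrow> p < \<psi> l"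
proof -
  let ?S = "{l. 0 \<le> l \<and> \<psi> l > p}"
  have ne: "?S \<noteq> {}" using unb by auto
  have bdd: "bdd_below ?S" by (rule bdd_belowI[of _ 0]) auto
  have conv: "\<psi> ((1 - s) * a + s * b) \<le> (1 - s) * \<psi> a + s * \<psi> b" if "0 \<le> a" "0 \<le> b" "0 \<le> s" "s \<le> 1" for a b s
    using convex_onD[OF cvx, of s a b] that by simp
  have scale: "\<psi> (s * b) \<le> s * \<psi> b" if "0 \<le> b" "0 \<le> s" "s \<le> 1" for s b
    using conv[of 0 b s] that \<psi>0 by simp
  show above: "p < \<psi> l" if l: "\<Phi> < l" for l
  proof -
    obtain l' where l': "l' \<in> ?S" "l' < l"
      using l cInf_less_iff[OF ne bdd] unfolding \<Phi>_def by auto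
    have "l' \<noteq> 0" using l' \<psi>0 p by auto
    then have pos: "0 < l'" "0 < l" using l' by auto
    have "\<psi> l' \<le> (l' / l) * \<psi> l" using scale[of l "l' / l"] pos l' by simp
    moreover have "0 < \<psi> l'" using l' p by simp
    ultimately have "0 < \<psi> l" using pos by (meson less_le_trans not_less zero_less_mult_pos divide_pos_pos)
    then have "(l' / l) * \<psi> l \<le> 1 * \<psi> l" using pos l' by (intro mult_right_mono) auto
    then show ?thesis using \<open>\<psi> l' \<le> (l' / l) * \<psi> l\<close> l' by simp
  qed
  have below: "\<psi> l \<le> p" if "0 \<le> l" "l < \<Phi>" for l
    using cInf_lower[OF _ bdd, of l] that unfolding \<Phi>_def by force
  obtain l0 where l0: "0 < l0" "\<psi> l0 < p"
  proof (cases "p = 0")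
    case True
    then show ?thesis using neg that by auto
  next
    case False
    \<comment> \<open>The second argument of the minimum forces
      \<open>l * \<psi> 1 \<le> p / 2\<close>; adding 1 to the absolute value keeps the denominator
      positive.\<close>
    define l where "l = min 1 (p / (2 * (\<bar>\<psi> 1\<bar> + 1)))"
    have l: "0 < l" "l \<le> 1" using False p by (auto simp: l_def)
    have "\<psi> l \<le> l * \<psi> 1" using scale[of 1 l] l by simp
    also have "\<dots> \<le> l * (\<bar>\<psi> 1\<bar> + 1)" using l by (intro mult_left_mono) auto
    also have "\<dots> \<le> (p / (2 * (\<bar>\<psi> 1\<bar> + 1))) * (\<bar>\<psi> 1\<bar> + 1)" by (intro mult_right_mono) (auto simp: l_def)
    also have "\<dots> = p / 2" by (simp add: field_simps)
    also have "\<dots> < p" using False p by simp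
    finally show ?thesis using l that by blast
  qed
  have "l0 \<le> \<Phi>" using above[of l0] l0 by force
  then show pos: "0 < \<Phi>" using l0 by simp
  show strict: "\<psi> l < p" if l: "0 < l" "l < \<Phi>" for l
  proof -
    \<comment> \<open>The point \<open>l0\<close> may lie to the right of \<open>l\<close>.
      Shrinking it by \<open>s\<close> moves it to the left of \<open>l\<close>, and convexity
      together with \<open>\<psi> 0 = 0\<close> keeps the value below \<open>p\<close>.\<close>
    define s where "s = min 1 (l / (2 * l0))"
    have s: "0 < s" "s \<le> 1" "s * l0 < l"
    proof -
      show "0 < s" "s \<le> 1" using l l0 by (auto simp: s_def)
      have "s * l0 \<le> (l / (2 * l0)) * l0" using l0 by (intro mult_right_mono) (auto simp: s_def)
      then show "s * l0 < l" using l l0 by simp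
    qed
    have l1: "\<psi> (s * l0) < p"
    proof (cases "\<psi> l0 \<le> 0")
      case True
      have "\<psi> (s * l0) \<le> s * \<psi> l0" by (rule scale) (use s l0 in auto)
      also have "s * \<psi> l0 < p"
      proof (cases "\<psi> l0 = 0")
        case False
        then have "s * \<psi> l0 < 0" using True s by (simp add: mult_pos_neg)
        then show ?thesis using p by simp
      qed (use l0 in simp)
      finally show ?thesis .
    next
      case False
      have "\<psi> (s * l0) \<le> s * \<psi> l0" by (rule scale) (use s l0 in auto)
      also have "\<dots> \<le> 1 * \<psi> l0" using s False by (intro mult_right_mono) auto
      finally show ?thesis using l0 by simp
    qed
    obtain m where m: "l < m" "m < \<Phi>" using dense l by blast
    define a where "a = s * l0"
    have a: "0 \<le> a" "a < l" "\<psi> a < p" using s l0 l1 by (auto simp: a_def)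
    define r where "r = (l - a) / (m - a)"
    have r: "0 \<le> r" "r < 1" using a m by (auto simp: r_def)
    have "(1 - r) * a + r * m = a + r * (m - a)" by (simp add: algebra_simps)
    also have "\<dots> = l" using a m by (simp add: r_def)
    finally have "\<psi> l \<le> (1 - r) * \<psi> a + r * \<psi> m" using conv[of a m r] a m r l by simp
    also have "\<dots> \<le> (1 - r) * \<psi> a + r * p" using below[of m] m l r by (intro add_left_mono mult_left_mono) auto
    also have "\<dots> < (1 - r) * p + r * p" using r a by simp
    finally show ?thesis by (simp add: algebra_simps)
  qed
  have cont: "isCont \<psi> \<Phi>"
  proof -
    have "convex_on {0<..} \<psi>" by (rule convex_on_subset[OF cvx]) auto
    then have "continuous_on {0<..} \<psi>" by (rule convex_on_continuous[OF open_greaterThan])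
    then show ?thesis using pos by (simp add: continuous_on_eq_continuous_at)
  qed
  show "\<psi> \<Phi> = p"
  proof (rule antisym)
    have "(\<psi> \<longlongrightarrow> \<psi> \<Phi>) (at_left \<Phi>)" using cont by (simp add: isCont_def filterlim_at_split)
    moreover have "\<forall>\<^sub>F l in at_left \<Phi>. \<psi> l \<le> p"
      unfolding eventually_at_left_field using below pos by (intro exI[of _ 0]) auto
    ultimately show "\<psi> \<Phi> \<le> p" by (rule tendsto_upperbound) simp
    have "(\<psi> \<longlongrightarrow> \<psi> \<Phi>) (at_right \<Phi>)" using cont by (simp add: isCont_def filterlim_at_split)
    moreover have "\<forall>\<^sub>F l in at_right \<Phi>. p \<le> \<psi> l"
      unfolding eventually_at_right_field using above by (intro exI[of _ "\<Phi> + 1"]) (auto intro: less_imp_le)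
    ultimately show "p \<le> \<psi> \<Phi>" by (rule tendsto_lowerbound) simp
  qed
qed

section \<open>Convexity, growth and sign of the Laplace exponent of \<open>X\<close>\<close>

context killed_spectrally_negative_Levy
begin

lemma \<psi>_0: "\<psi> 0 = 0"
  by (simp add: laplace_exponent_def prob_space)

text \<open>Hoelder's inequality in the form of its usual proof: the normalised variables
  \<open>exp (l * X 1 - \<psi> l)\<close> have mean 1, and convexity of the exponential is applied
  pointwise to their exponents at \<open>a\<close> and \<open>b\<close>.\<close>

lemma \<psi>_convex: "convex_on {0..} \<psi>"
proof (rule convex_onI)
  fix s a b :: real
  assume s: "0 < s" "s < 1" and ab: "a \<in> {0..}" "b \<in> {0..}"
  define c where "c = (1 - s) * a + s * b"
  define d where "d = (1 - s) * \<psi> a + s * \<psi> b"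
  have c: "0 \<le> c" using s ab by (simp add: c_def)
  have norm: "(\<integral>\<^sup>+\<omega>. ennreal (exp (l * X 1 \<omega> - \<psi> l)) \<partial>P 0) = 1" if "0 \<le> l" for l
  proof -
    have "(\<integral>\<^sup>+\<omega>. ennreal (exp (l * X 1 \<omega> - \<psi> l)) \<partial>P 0) = (\<integral>\<^sup>+\<omega>. ennreal (exp (- \<psi> l)) * ennreal (exp (l * X 1 \<omega>)) \<partial>P 0)"
      by (rule nn_integral_cong) (simp add: ennreal_mult'[symmetric] exp_add[symmetric])
    also have "\<dots> = ennreal (exp (- \<psi> l)) * ennreal (exp (1 * \<psi> l))"
      by (subst nn_integral_cmult) (use exp_moment[OF that, of 1] in auto)
    also have "\<dots> = 1" by (simp add: ennreal_mult'[symmetric] exp_add[symmetric])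
    finally show ?thesis .
  qed
  have pw: "ennreal (exp (c * y - d)) \<le> ennreal (1 - s) * ennreal (exp (a * y - \<psi> a)) + ennreal s * ennreal (exp (b * y - \<psi> b))" for y
  proof -
    have "exp ((1 - s) *\<^sub>R (a * y - \<psi> a) + s *\<^sub>R (b * y - \<psi> b)) \<le> (1 - s) * exp (a * y - \<psi> a) + s * exp (b * y - \<psi> b)"
      using convex_onD[OF exp_convex, of s "a * y - \<psi> a" "b * y - \<psi> b"] s by simp
    moreover have "(1 - s) *\<^sub>R (a * y - \<psi> a) + s *\<^sub>R (b * y - \<psi> b) = c * y - d"
      by (simp add: c_def d_def algebra_simps)
    ultimately have "ennreal (exp (c * y - d)) \<le> ennreal ((1 - s) * exp (a * y - \<psi> a) + s * exp (b * y - \<psi> b))"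
      by (intro ennreal_leI) simp
    then show ?thesis using s by (simp add: ennreal_plus ennreal_mult')
  qed
  have [measurable]: "X 1 \<in> borel_measurable (P 0)" by auto
  have "ennreal (exp (\<psi> c)) * ennreal (exp (- d)) = (\<integral>\<^sup>+\<omega>. ennreal (exp (c * X 1 \<omega>)) * ennreal (exp (- d)) \<partial>P 0)"
    using exp_moment[OF c, of 1] by (subst nn_integral_multc) auto
  also have "\<dots> = (\<integral>\<^sup>+\<omega>. ennreal (exp (c * X 1 \<omega> - d)) \<partial>P 0)"
    by (rule nn_integral_cong) (simp add: ennreal_mult'[symmetric] exp_add[symmetric])
  also have "\<dots> \<le> (\<integral>\<^sup>+\<omega>. ennreal (1 - s) * ennreal (exp (a * X 1 \<omega> - \<psi> a)) + ennreal s * ennreal (exp (b * X 1 \<omega> - \<psi> b)) \<partial>P 0)"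
    by (intro nn_integral_mono pw)
  also have "\<dots> = ennreal (1 - s) + ennreal s"
    using norm ab by (simp add: nn_integral_add nn_integral_cmult)
  also have "\<dots> = ennreal 1" using s by (subst ennreal_plus[symmetric]) auto
  finally have "ennreal (exp (\<psi> c + - d)) \<le> ennreal 1"
    by (simp only: exp_add ennreal_mult' exp_ge_zero)
  then have "\<psi> c \<le> d" by simp
  then show "\<psi> ((1 - s) *\<^sub>R a + s *\<^sub>R b) \<le> (1 - s) * \<psi> a + s * \<psi> b"
    by (simp add: c_def d_def)
qed auto

text \<open>Otherwise, by stationarity, almost surely no increment between grid times is positive.
  Right continuity extends this to all times, and the path would be nonincreasing.\<close>

lemma increments_not_all_nonpos:
  "\<exists>t>0. \<not> (AE \<omega> in P 0. X t \<omega> \<le> 0)"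
proof (rule ccontr)
  assume neg: "\<not> (\<exists>t>0. \<not> (AE \<omega> in P 0. X t \<omega> \<le> 0))"
  have nonpos: "AE \<omega> in P 0. X t \<omega> - X 0 \<omega> \<le> 0" if "0 < t" for t
  proof -
    have "AE \<omega> in P 0. X t \<omega> \<le> 0" using neg that by auto
    then show ?thesis using start by eventually_elim simp
  qed
  have incr: "AE \<omega> in P 0. X (s + t) \<omega> - X s \<omega> \<le> 0" if st: "0 \<le> s" "0 \<le> t" for s t
  proof (cases "t = 0")
    case False
    have m: "(\<lambda>\<omega>. X (s + t) \<omega> - X s \<omega>) \<in> borel_measurable (P 0)" "(\<lambda>\<omega>. X t \<omega> - X 0 \<omega>) \<in> borel_measurable (P 0)"
      using X_P[of "s + t" 0] X_P[of s 0] X_P[of t 0] X_P[of 0 0] st by auto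
    have "AE y in distr (P 0) borel (\<lambda>\<omega>. X t \<omega> - X 0 \<omega>). y \<le> 0"
      using nonpos[of t] False st m by (subst AE_distr_iff) auto
    then have "AE y in distr (P 0) borel (\<lambda>\<omega>. X (s + t) \<omega> - X s \<omega>). y \<le> 0"
      unfolding stationary_increments[OF st, of 0] .
    then show ?thesis using m by (subst (asm) AE_distr_iff) auto
  qed simp
  \<comment> \<open>Pairs of times with a common denominator suffice, since two times are
    approximated from the right on the same grid, where their order is preserved. There are
    countably many such pairs, so one null set serves for all.\<close>
  have "AE \<omega> in P 0. \<forall>n i j :: nat. X (real i / real (Suc n) + real j / real (Suc n)) \<omega> - X (real i / real (Suc n)) \<omega> \<le> 0"
    unfolding AE_all_countable by (intro allI incr) auto
  then have "AE \<omega> in P 0. False"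
    using nonmonotone_paths[of 0] AE_space
  proof eventually_elim
    case (elim \<omega>)
    have "X v \<omega> \<le> X u \<omega>" if uv: "0 \<le> u" "u \<le> v" for u v
    proof (rule LIMSEQ_le)
      let ?d = "\<lambda>u n. (of_int \<lfloor>real (Suc n) * u\<rfloor> + 1) / real (Suc n)"
      show "(\<lambda>n. X (?d v n) \<omega>) \<longlonglongrightarrow> X v \<omega>" "(\<lambda>n. X (?d u n) \<omega>) \<longlonglongrightarrow> X u \<omega>"
        using ceiling_approx_at_right[of "\<lambda>s. X s \<omega>", OF X_right[OF elim(3)]] uv by auto
      have "X (?d v n) \<omega> \<le> X (?d u n) \<omega>" for n
      proof -
        define i where "i = nat (\<lfloor>real (Suc n) * u\<rfloor> + 1)"
        define j where "j = nat (\<lfloor>real (Suc n) * v\<rfloor> - \<lfloor>real (Suc n) * u\<rfloor>)"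
        have fl: "0 \<le> \<lfloor>real (Suc n) * u\<rfloor>" "\<lfloor>real (Suc n) * u\<rfloor> \<le> \<lfloor>real (Suc n) * v\<rfloor>"
          using uv by (auto intro!: floor_mono mult_left_mono simp del: of_nat_Suc)
        have "?d u n = real i / real (Suc n)" "?d v n = real i / real (Suc n) + real j / real (Suc n)"
          using fl unfolding i_def j_def by (simp_all add: add_divide_distrib[symmetric] del: of_nat_Suc)
        then show ?thesis using elim(1) by simp
      qed
      then show "\<exists>N. \<forall>n\<ge>N. X (?d v n) \<omega> \<le> X (?d u n) \<omega>" by blast
    qed
    then have "monotone_on {0..} (\<le>) (\<ge>) (\<lambda>t. X t \<omega>)" by (auto simp: monotone_on_def)
    then show False using elim(2) by (simp add: nonmonotone_def)
  qed
  then show False by simp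
qed

text \<open>A Chernoff bound read backwards: if \<open>X t\<close> exceeds \<delta> > 0 with
  probability \<eta> > 0, then \<open>exp (t * \<psi> l)\<close> is at least
  \<open>exp (l * \<delta>) * \<eta>\<close>. This yields unboundedness of \<open>\<psi>\<close> and
  later the convergence of both power series for every argument.\<close>

lemma \<psi>_linear_growth:
  obtains a b where "0 < a" "\<And>l. 0 \<le> l \<Longrightarrow> a * l + b \<le> \<psi> l"
proof -
  obtain t where t: "0 < t" "\<not> (AE \<omega> in P 0. X t \<omega> \<le> 0)" using increments_not_all_nonpos by blast
  have [measurable]: "X t \<in> borel_measurable (P 0)" using t by auto
  have "\<exists>n::nat. measure (P 0) {\<omega> \<in> space (P 0). 1 / real (Suc n) < X t \<omega>} \<noteq> 0"
  proof (rule ccontr)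
    assume "\<not> ?thesis"
    then have "AE \<omega> in P 0. \<not> 1 / real (Suc n) < X t \<omega>" for n
      by (subst AE_iff_measurable[OF _ refl]) (auto simp: emeasure_eq_measure)
    then have "AE \<omega> in P 0. \<forall>n. \<not> 1 / real (Suc n) < X t \<omega>" unfolding AE_all_countable by blast
    then have "AE \<omega> in P 0. X t \<omega> \<le> 0"
    proof eventually_elim
      case (elim \<omega>)
      show ?case
      proof (rule ccontr)
        assume "\<not> X t \<omega> \<le> 0"
        then obtain n where "inverse (real (Suc n)) < X t \<omega>" using reals_Archimedean[of "X t \<omega>"] by auto
        then show False using elim by (simp add: inverse_eq_divide)
      qed
    qed
    then show False using t by simp
  qed
  then obtain n :: nat where n: "measure (P 0) {\<omega> \<in> space (P 0). 1 / real (Suc n) < X t \<omega>} \<noteq> 0" by blast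
  define \<delta> where "\<delta> = 1 / real (Suc n)"
  define \<eta> where "\<eta> = measure (P 0) {\<omega> \<in> space (P 0). \<delta> < X t \<omega>}"
  have \<eta>: "0 < \<eta>" using n by (simp add: \<eta>_def \<delta>_def zero_less_measure_iff del: of_nat_Suc)
  have \<delta>: "0 < \<delta>" by (simp add: \<delta>_def)
  have "(\<delta> / t) * l + ln \<eta> / t \<le> \<psi> l" if l: "0 \<le> l" for l
  proof -
    have "ennreal (exp (l * \<delta>) * \<eta>) = ennreal (exp (l * \<delta>)) * emeasure (P 0) {\<omega> \<in> space (P 0). \<delta> < X t \<omega>}"
      by (simp add: \<eta>_def emeasure_eq_measure ennreal_mult')
    also have "\<dots> = (\<integral>\<^sup>+\<omega>. ennreal (exp (l * \<delta>)) * indicator {\<omega> \<in> space (P 0). \<delta> < X t \<omega>} \<omega> \<partial>P 0)"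
      by (subst nn_integral_cmult_indicator) auto
    also have "\<dots> \<le> (\<integral>\<^sup>+\<omega>. ennreal (exp (l * X t \<omega>)) \<partial>P 0)"
      using l by (intro nn_integral_mono) (auto simp: indicator_def intro!: ennreal_leI mult_left_mono)
    also have "\<dots> = ennreal (exp (t * \<psi> l))" using l t by (intro exp_moment) auto
    finally have "exp (l * \<delta>) * \<eta> \<le> exp (t * \<psi> l)" by simp
    then have "ln (exp (l * \<delta>) * \<eta>) \<le> ln (exp (t * \<psi> l))" using \<eta> by (subst ln_le_cancel_iff) auto
    then have "l * \<delta> + ln \<eta> \<le> t * \<psi> l" using \<eta> by (simp add: ln_mult)
    then show ?thesis using t by (simp add: field_simps)
  qed
  then show ?thesis using that[of "\<delta> / t" "ln \<eta> / t"] \<delta> t by auto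
qed

lemma AE_e_infinite: "p = 0 \<Longrightarrow> AE \<omega> in P x. e \<omega> = \<top>"
proof -
  assume p: "p = 0"
  have "AE \<omega> in P x. alive (real n) \<omega> = 1" for n
  proof -
    have [measurable]: "alive (real n) \<in> borel_measurable (P x)" by auto
    have "(\<integral>\<omega>. alive (real n) \<omega> \<partial>P x) = 1"
      using prob_alive[of "real n" x] p by (subst integral_eq_nn_integral) auto
    moreover have int: "integrable (P x) (alive (real n))"
      by (rule integrable_const_bound[where B=1]) auto
    ultimately have "(\<integral>\<omega>. 1 - alive (real n) \<omega> \<partial>P x) = 0" by (simp add: prob_space)
    then have "AE \<omega> in P x. 1 - alive (real n) \<omega> = 0"
      using int by (subst (asm) integral_nonneg_eq_0_iff_AE) auto
    then show ?thesis by eventually_elim simp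
  qed
  then have "AE \<omega> in P x. \<forall>n. alive (real n) \<omega> = 1" by (simp add: AE_all_countable)
  then show ?thesis
  proof eventually_elim
    case (elim \<omega>)
    show ?case
    proof (cases "e \<omega>")
      case (real r)
      obtain n where "r \<le> real n" using real_arch_simple by blast
      then show ?thesis using elim[rule_format, of n] real by (auto simp: alive_def indicator_def ennreal_less_iff split: if_splits)
    qed simp
  qed
qed

lemma AE_e_finite: "p \<noteq> 0 \<Longrightarrow> AE \<omega> in P x. e \<omega> < \<top>"
proof -
  assume "p \<noteq> 0"
  then have p: "0 < p" using rate_nonneg by simp
  have m: "{\<omega> \<in> space (P x). \<not> e \<omega> < \<top>} \<in> sets (P x)" by measurable
  have "emeasure (P x) {\<omega> \<in> space (P x). \<not> e \<omega> < \<top>} \<le> ennreal (exp (- p * real n))" for n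
  proof -
    have "emeasure (P x) {\<omega> \<in> space (P x). \<not> e \<omega> < \<top>} = (\<integral>\<^sup>+\<omega>. indicator {\<omega> \<in> space (P x). \<not> e \<omega> < \<top>} \<omega> \<partial>P x)"
      using m by simp
    also have "\<dots> \<le> (\<integral>\<^sup>+\<omega>. ennreal (alive (real n) \<omega>) \<partial>P x)"
      by (rule nn_integral_mono) (auto simp: indicator_def alive_def less_top[symmetric])
    finally show ?thesis using prob_alive[of "real n" x] by simp
  qed
  moreover have "(\<lambda>n. ennreal (exp (- p * real n))) \<longlonglongrightarrow> ennreal 0"
  proof (rule tendsto_ennrealI)
    have "(\<lambda>n. exp (- p) ^ n) \<longlonglongrightarrow> 0" using p by (intro LIMSEQ_realpow_zero) auto
    then show "(\<lambda>n. exp (- p * real n)) \<longlonglongrightarrow> 0"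
      by (simp add: exp_of_nat_mult[symmetric] mult.commute)
  qed
  ultimately have "emeasure (P x) {\<omega> \<in> space (P x). \<not> e \<omega> < \<top>} \<le> ennreal 0"
    by (intro LIMSEQ_le_const[where X="\<lambda>n. ennreal (exp (- p * real n))"]) auto
  then show ?thesis using m by (subst AE_iff_measurable[OF m refl]) simp
qed

lemma exp_drift_to_0:
  assumes "filterlim (\<lambda>t. X t \<omega>) at_bot at_top" "0 < l"
  shows "(\<lambda>n. exp (l * X (real n) \<omega>)) \<longlonglongrightarrow> 0"
proof -
  have "filterlim (\<lambda>n. X (real n) \<omega>) at_bot sequentially"
    by (rule filterlim_compose[OF assms(1) filterlim_real_sequentially])
  then have "filterlim (\<lambda>n. l * X (real n) \<omega>) at_bot sequentially"
    using assms(2) by (rule filterlim_tendsto_pos_mult_at_bot[OF tendsto_const, rotated])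
  then show ?thesis by (rule filterlim_compose[OF exp_at_bot])
qed

text \<open>If \<open>\<psi> \<ge> 0\<close> everywhere, the stopped exponential submartingales force every level to be
  passed almost surely, which contradicts the drift to \<open>-\<infinity>\<close>.\<close>

lemma \<psi>_negative_somewhere:
  assumes p: "p = 0" shows "\<exists>l>0. \<psi> l < 0"
proof (rule ccontr)
  assume "\<not> ?thesis"
  then have \<psi>_nonneg: "0 \<le> \<psi> l" if "0 < l" for l using that by force
  have hit: "AE \<omega> in P 0. first_passage_above X c \<omega> < \<top>" if c: "0 < c" for c
  proof -
    let ?\<tau> = "first_passage_above X c"
    define q where "q = measure (P 0) {\<omega> \<in> space (P 0). ?\<tau> \<omega> < \<top>}"
    have q: "1 \<le> exp (l * c) * q" if l: "0 < l" for l
    proof -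
      \<comment> \<open>A majorant of the stopped exponential, which is at most
        \<open>exp (l * c)\<close> and, without passage, is taken at time \<open>n\<close>. The cap
        on the second summand gives a constant bound for dominated convergence; the drift sends that
        summand to 0.\<close>
      define H where "H n \<omega> = exp (l * c) * indicator {\<omega> \<in> space (P 0). ?\<tau> \<omega> < \<top>} \<omega> + min (exp (l * X (real n) \<omega>)) (exp (l * c))" for n \<omega>
      have int_l: "1 \<le> (\<integral>\<omega>. H n \<omega> \<partial>P 0)" if n: "1 \<le> n" for n
      proof -
        have [measurable]: "X (real n) \<in> borel_measurable (P 0)" by auto
        let ?T = "stopped_time c (real n)"
        have "0 \<le> rate l * (\<integral>\<omega>. occupation 0 0 l 0 (?T \<omega>) \<omega> \<partial>P 0)"
          using \<psi>_nonneg[OF l] p occupation_nonneg by (intro mult_nonneg_nonneg Bochner_Integration.integral_nonneg) auto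
        then have "1 \<le> (\<integral>\<omega>. damped 0 0 l (?T \<omega>) \<omega> \<partial>P 0)"
          using stopped_identity[of l 0 0 "real n" 0 c] l c n by simp
        also have "\<dots> \<le> (\<integral>\<omega>. H n \<omega> \<partial>P 0)"
        proof (rule integral_mono_AE)
          show "integrable (P 0) (\<lambda>\<omega>. damped 0 0 l (?T \<omega>) \<omega>)"
            by (rule stopped_damped_integrable) (use l c in auto)
          show "integrable (P 0) (H n)"
            unfolding H_def[abs_def]
            by (intro Bochner_Integration.integrable_add integrable_mult_right integrable_const_bound[where B="exp (l * c)"]) (auto intro!: integrable_real_indicator simp: emeasure_eq_measure)
          show "AE \<omega> in P 0. damped 0 0 l (?T \<omega>) \<omega> \<le> H n \<omega>"
          proof -
            have "AE \<omega> in P 0. damped 0 0 l (?T \<omega>) \<omega> \<le> exp (l * c)"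
              by (rule stopped_damped_le) (use l c in auto)
            then show ?thesis using AE_space
            proof eventually_elim
              case (elim \<omega>)
              show ?case
              proof (cases "?\<tau> \<omega> < \<top>")
                case True
                then have "exp (l * c) \<le> H n \<omega>" using elim(2) by (simp add: H_def)
                then show ?thesis using elim(1) by simp
              next
                case False
                then have "?T \<omega> = real n" by (intro stopped_time_eq) (auto simp: not_less top_unique)
                then have "damped 0 0 l (?T \<omega>) \<omega> \<le> min (exp (l * X (real n) \<omega>)) (exp (l * c))"
                  using elim(1) damped_le_exp[of 0 0 l "real n" \<omega>] by simp
                then show ?thesis unfolding H_def by (rule add_increasing[rotated]) simp
              qed
            qed
          qed
        qed
        finally show ?thesis .
      qed
      have "(\<lambda>n. \<integral>\<omega>. H n \<omega> \<partial>P 0) \<longlonglongrightarrow> (\<integral>\<omega>. exp (l * c) * indicator {\<omega> \<in> space (P 0). ?\<tau> \<omega> < \<top>} \<omega> \<partial>P 0)"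
      proof (rule integral_dominated_convergence[where w="\<lambda>_. 2 * exp (l * c)"])
        have [measurable]: "X (real n) \<in> borel_measurable (P 0)" for n by auto
        show "H n \<in> borel_measurable (P 0)" for n unfolding H_def by measurable
        show "AE \<omega> in P 0. (\<lambda>n. H n \<omega>) \<longlonglongrightarrow> exp (l * c) * indicator {\<omega> \<in> space (P 0). ?\<tau> \<omega> < \<top>} \<omega>"
          using drift_to_minus_infinity[OF p, of 0]
        proof eventually_elim
          case (elim \<omega>)
          have "(\<lambda>n. min (exp (l * X (real n) \<omega>)) (exp (l * c))) \<longlonglongrightarrow> min 0 (exp (l * c))"
            by (intro tendsto_intros exp_drift_to_0 elim l)
          then show ?case unfolding H_def
            using tendsto_add[OF tendsto_const, of "\<lambda>n. min (exp (l * X (real n) \<omega>)) (exp (l * c))" 0 sequentially] by simp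
        qed
        show "AE \<omega> in P 0. norm (H n \<omega>) \<le> 2 * exp (l * c)" for n
        proof (rule AE_I2)
          fix \<omega>
          have "exp (l * c) * indicator {\<omega> \<in> space (P 0). ?\<tau> \<omega> < \<top>} \<omega> \<le> exp (l * c)"
            "0 \<le> exp (l * c) * (indicator {\<omega> \<in> space (P 0). ?\<tau> \<omega> < \<top>} \<omega> :: real)"
            "min (exp (l * X (real n) \<omega>)) (exp (l * c)) \<le> exp (l * c)" "0 \<le> min (exp (l * X (real n) \<omega>)) (exp (l * c))"
            by (auto simp: indicator_def)
          then show "norm (H n \<omega>) \<le> 2 * exp (l * c)" unfolding H_def real_norm_def by linarith
        qed
      qed auto
      then have "1 \<le> (\<integral>\<omega>. exp (l * c) * indicator {\<omega> \<in> space (P 0). ?\<tau> \<omega> < \<top>} \<omega> \<partial>P 0)"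
        by (rule LIMSEQ_le_const) (use int_l in auto)
      also have "\<dots> = exp (l * c) * q"
        by (simp add: q_def Int_absorb2 subset_eq)
      finally show ?thesis .
    qed
    \<comment> \<open>The passage probability \<open>q\<close> does not depend on \<open>l\<close>,
      so the bound \<open>1 \<le> exp (l * c) * q\<close> improves to \<open>1 \<le> q\<close> as
      \<open>l\<close> decreases to 0.\<close>
    have "((\<lambda>l. exp (l * c) * q) \<longlongrightarrow> exp (0 * c) * q) (at_right 0)"
      by (intro tendsto_intros)
    then have "1 \<le> exp (0 * c) * q"
      by (rule tendsto_lowerbound) (use q in \<open>auto intro!: exI[of _ 1] simp: eventually_at_right_field\<close>)
    then have "q = 1" using prob_space.prob_le_1[OF prob, of 0 "{\<omega> \<in> space (P 0). ?\<tau> \<omega> < \<top>}"] by (simp add: q_def)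
    then show ?thesis unfolding q_def by (subst (asm) prob_Collect_eq_1) auto
  qed
  have "AE \<omega> in P 0. \<forall>n. first_passage_above X (real (Suc n)) \<omega> < \<top>"
    unfolding AE_all_countable by (intro allI hit) simp
  then have "AE \<omega> in P 0. False"
    using drift_to_minus_infinity[OF p, of 0] AE_space
  proof eventually_elim
    case (elim \<omega>)
    have "\<forall>\<^sub>F t in at_top. X t \<omega> < 0"
      using elim(2) by (simp add: filterlim_at_bot_dense)
    then obtain N where N: "\<And>t. N \<le> t \<Longrightarrow> X t \<omega> < 0" by (auto simp: eventually_at_top_linorder)
    obtain B where B: "\<And>u. 0 \<le> u \<Longrightarrow> u \<le> max 0 N \<Longrightarrow> \<bar>X u \<omega>\<bar> \<le> B"
      using X_bounded[OF elim(3), of "max 0 N"] by auto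
    obtain n :: nat where n: "B < real n" using reals_Archimedean2 by blast
    obtain r where "first_passage_above X (real (Suc n)) \<omega> < ennreal r"
      using elim(1)[rule_format, of n] by (metis ennreal_cases gt_ex ennreal_lessI infinity_ennreal_def less_irrefl ennreal_less_top linorder_not_le order_less_le_trans)
    then obtain s where s: "0 < s" "real (Suc n) < X s \<omega>" by (auto simp: first_passage_less_iff)
    show False
    proof (cases "s \<le> max 0 N")
      case True
      then show ?thesis using B[OF less_imp_le[OF s(1)] True] s n by simp
    next
      case False
      have "N \<le> s" using False by simp
      then show ?thesis using N[of s] s n by simp
    qed
  qed
  then show False by simp
qed

section \<open>The level crossing \<Phi>(p)\<close>

abbreviation \<phi> :: real where "\<phi> \<equiv> laplace_exponent_inverse P X p"

lemma \<phi>_pos: "0 < \<phi>" and \<psi>_\<phi>: "\<psi> \<phi> = p"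
  and \<psi>_below_\<phi>: "0 < l \<Longrightarrow> l < \<phi> \<Longrightarrow> \<psi> l < p" and \<psi>_above_\<phi>: "\<phi> < l \<Longrightarrow> p < \<psi> l"
proof -
  obtain a b where ab: "0 < a" "\<And>l. 0 \<le> l \<Longrightarrow> a * l + b \<le> \<psi> l" using \<psi>_linear_growth by blast
  have "\<exists>l\<ge>0. p < \<psi> l"
  proof (intro exI conjI)
    show "0 \<le> (\<bar>p\<bar> + \<bar>b\<bar> + 1) / a" using ab by simp
    have "p < a * ((\<bar>p\<bar> + \<bar>b\<bar> + 1) / a) + b" using ab by simp
    also have "\<dots> \<le> \<psi> ((\<bar>p\<bar> + \<bar>b\<bar> + 1) / a)" by (rule ab(2)) (use ab in simp)
    finally show "p < \<psi> ((\<bar>p\<bar> + \<bar>b\<bar> + 1) / a)" .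
  qed
  note * = convex_level_crossing[OF \<psi>_convex \<psi>_0 rate_nonneg this \<psi>_negative_somewhere, folded laplace_exponent_inverse_def]
  show "0 < \<phi>" "\<psi> \<phi> = p" using *(1,2) by auto
  show "0 < l \<Longrightarrow> l < \<phi> \<Longrightarrow> \<psi> l < p" "\<phi> < l \<Longrightarrow> p < \<psi> l" using *(3,4) by auto
qed

end

section \<open>The power series\<close>

text \<open>Ratio test, from the index on where \<open>r\<close> is at least
  \<open>max 1 (2 * \<bar>z\<bar>)\<close>. Signs of earlier factors are irrelevant, and a zero
  among them makes all later terms 0 by the convention for \<open>inverse\<close>.\<close>

lemma inverse_prod_series_summable:
  fixes r :: "nat \<Rightarrow> real"
  assumes "filterlim r at_top sequentially"
  shows "summable (\<lambda>k. inverse (\<Prod>l=1..k. r l) * z ^ k)"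
proof -
  have "\<forall>\<^sub>F k in sequentially. max 1 (2 * \<bar>z\<bar>) \<le> r k"
    using assms unfolding filterlim_at_top by blast
  then obtain N where N: "\<And>k. N \<le> k \<Longrightarrow> max 1 (2 * \<bar>z\<bar>) \<le> r k" by (auto simp: eventually_sequentially)
  show ?thesis
  proof (rule summable_ratio_test[where c="1/2" and N=N])
    fix k assume "N \<le> k"
    then have r: "1 \<le> r (Suc k)" "2 * \<bar>z\<bar> \<le> r (Suc k)" using N[of "Suc k"] by auto
    have "norm (inverse (\<Prod>l=1..Suc k. r l) * z ^ Suc k) = norm (inverse (\<Prod>l=1..k. r l) * z ^ k) * (\<bar>z\<bar> / r (Suc k))"
      using r by (simp add: abs_mult divide_inverse mult_ac)
    also have "\<dots> \<le> norm (inverse (\<Prod>l=1..k. r l) * z ^ k) * (1 / 2)"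
      using r by (intro mult_left_mono) (auto simp: divide_le_eq)
    finally show "norm (inverse (\<Prod>l=1..Suc k. r l) * z ^ Suc k) \<le> 1 / 2 * norm (inverse (\<Prod>l=1..k. r l) * z ^ k)"
      by (simp only: mult.commute)
  qed simp
qed

context killed_spectrally_negative_Levy
begin

text \<open>One family for both series: \<open>l0 = 0\<close> gives the coefficients of
  \<open>J_series\<close>, and \<open>l0 = \<phi>\<close> those of \<open>I_series\<close>.\<close>

definition coefficient :: "real \<Rightarrow> real \<Rightarrow> nat \<Rightarrow> real" where
  "coefficient \<alpha> l0 k = inverse (\<Prod>l=1..k. rate (l0 + real l * \<alpha>))"

lemma rate_at_top:
  assumes "0 < \<alpha>" "0 \<le> l0" shows "filterlim (\<lambda>l. rate (l0 + real l * \<alpha>)) at_top sequentially"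
proof -
  obtain a b where ab: "0 < a" "\<And>l. 0 \<le> l \<Longrightarrow> a * l + b \<le> \<psi> l" using \<psi>_linear_growth by blast
  have "filterlim (\<lambda>l. (a * l0 + b - p) + (a * \<alpha>) * real l) at_top sequentially"
    using ab(1) assms(1)
    by (intro filterlim_tendsto_add_at_top[OF tendsto_const] filterlim_tendsto_pos_mult_at_top[OF tendsto_const _ filterlim_real_sequentially]) auto
  then show ?thesis
  proof (rule filterlim_at_top_mono)
    have "(a * l0 + b - p) + (a * \<alpha>) * real l \<le> rate (l0 + real l * \<alpha>)" for l
      using ab(2)[of "l0 + real l * \<alpha>"] assms by (simp add: algebra_simps)
    then show "\<forall>\<^sub>F l in sequentially. (a * l0 + b - p) + (a * \<alpha>) * real l \<le> rate (l0 + real l * \<alpha>)" by simp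
  qed
qed

lemma coefficient_summable:
  "0 < \<alpha> \<Longrightarrow> 0 \<le> l0 \<Longrightarrow> summable (\<lambda>k. coefficient \<alpha> l0 k * z ^ k)"
  unfolding coefficient_def by (rule inverse_prod_series_summable[OF rate_at_top])

lemma coefficient_summable_norm:
  assumes "0 < \<alpha>" "0 \<le> l0" shows "summable (\<lambda>k. \<bar>coefficient \<alpha> l0 k\<bar> * \<bar>z\<bar> ^ k)"
proof -
  have "summable (\<lambda>k. norm (coefficient \<alpha> l0 k * \<bar>z\<bar> ^ k))"
    by (rule powser_insidea[where x="\<bar>z\<bar> + 1"]) (use coefficient_summable[OF assms] in auto)
  then show ?thesis by (simp add: abs_mult power_abs)
qed

lemma coefficient_0 [simp]: "coefficient \<alpha> l0 0 = 1"
  by (simp add: coefficient_def)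

lemma coefficient_Suc:
  "rate (l0 + real (Suc k) * \<alpha>) \<noteq> 0 \<Longrightarrow> coefficient \<alpha> l0 (Suc k) * rate (l0 + real (Suc k) * \<alpha>) = coefficient \<alpha> l0 k"
  by (simp add: coefficient_def del: of_nat_Suc)

text \<open>In the logarithmic variable \<open>y\<close>, this is \<open>J_series\<close> for
  \<open>l0 = 0\<close>, and \<open>I_series\<close> with the factor \<open>exp (\<phi> * y)\<close>
  for \<open>l0 = \<phi>\<close>. Formally, the generator of \<open>X\<close> minus p minus \<beta>
  exp (\<alpha> y) maps it to \<open>rate l0 * exp (l0 * y)\<close>, provided the rates at
  \<open>l0 + real k * \<alpha>\<close>, k \<ge> 1, are nonzero: a zero source for
  \<open>\<phi>\<close>, and \<open>- p\<close> for exponent 0.\<close>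

definition eigen_series :: "real \<Rightarrow> real \<Rightarrow> real \<Rightarrow> real \<Rightarrow> real" where
  "eigen_series \<alpha> \<beta> l0 y = exp (l0 * y) * (\<Sum>k. coefficient \<alpha> l0 k * (\<beta> * exp (\<alpha> * y)) ^ k)"

lemma eigen_series_measurable [measurable]:
  assumes "0 < \<alpha>" "0 \<le> l0" shows "eigen_series \<alpha> \<beta> l0 \<in> borel_measurable borel"
proof -
  have "isCont (\<lambda>z. \<Sum>k. coefficient \<alpha> l0 k * z ^ k) z" for z
    by (rule isCont_powser_converges_everywhere) (rule coefficient_summable[OF assms])
  then have [measurable]: "(\<lambda>z. \<Sum>k. coefficient \<alpha> l0 k * z ^ k) \<in> borel_measurable borel"
    by (intro borel_measurable_continuous_onI continuous_at_imp_continuous_on) auto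
  show ?thesis unfolding eigen_series_def[abs_def] by measurable
qed

lemma eigen_series_bound:
  assumes "0 < \<alpha>" "0 \<le> l0" "0 \<le> \<beta>" "y \<le> c"
  shows "\<bar>eigen_series \<alpha> \<beta> l0 y\<bar> \<le> exp (l0 * c) * (\<Sum>k. \<bar>coefficient \<alpha> l0 k\<bar> * (\<beta> * exp (\<alpha> * c)) ^ k)"
proof -
  let ?z = "\<lambda>y. \<beta> * exp (\<alpha> * y)"
  have z: "0 \<le> ?z y" "?z y \<le> ?z c" using assms by (auto intro!: mult_left_mono)
  have s: "summable (\<lambda>k. \<bar>coefficient \<alpha> l0 k\<bar> * ?z y ^ k)" for y
    using coefficient_summable_norm[OF assms(1,2), of "?z y"] assms(3) by simp
  have "\<bar>\<Sum>k. coefficient \<alpha> l0 k * ?z y ^ k\<bar> \<le> (\<Sum>k. \<bar>coefficient \<alpha> l0 k * ?z y ^ k\<bar>)"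
    by (rule summable_rabs) (use s[of y] assms(3) in \<open>simp add: abs_mult\<close>)
  also have "\<dots> \<le> (\<Sum>k. \<bar>coefficient \<alpha> l0 k\<bar> * ?z c ^ k)"
    using s[of y] s[of c] z assms(3) by (intro suminf_le) (auto simp: abs_mult intro!: mult_left_mono power_mono)
  finally have "\<bar>\<Sum>k. coefficient \<alpha> l0 k * ?z y ^ k\<bar> \<le> (\<Sum>k. \<bar>coefficient \<alpha> l0 k\<bar> * ?z c ^ k)" .
  moreover have "exp (l0 * y) \<le> exp (l0 * c)" using assms by (simp add: mult_left_mono)
  ultimately show ?thesis unfolding eigen_series_def abs_mult by (intro mult_mono) auto
qed

text \<open>Multiplying the stopped identities for \<open>l = l0 + k \<alpha>\<close> by the series coefficients and adding
  them up, the occupation terms telescope.\<close>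

lemma eigen_series_stopped:
  assumes \<alpha>: "0 < \<alpha>" and l0: "0 \<le> l0" and \<beta>: "0 \<le> \<beta>" and t: "0 < t" and xc: "x \<le> c"
    and nonzero: "\<And>k. rate (l0 + real (Suc k) * \<alpha>) \<noteq> 0"
  shows "integrable (P x) (\<lambda>\<omega>. eigen_series \<alpha> \<beta> l0 (X (stopped_time c t \<omega>) \<omega>) * damped \<alpha> \<beta> 0 (stopped_time c t \<omega>) \<omega>)" (is ?I)
    and "(\<integral>\<omega>. eigen_series \<alpha> \<beta> l0 (X (stopped_time c t \<omega>) \<omega>) * damped \<alpha> \<beta> 0 (stopped_time c t \<omega>) \<omega> \<partial>P x) -
      rate l0 * (\<integral>\<omega>. occupation \<alpha> \<beta> l0 0 (stopped_time c t \<omega>) \<omega> \<partial>P x) = eigen_series \<alpha> \<beta> l0 x" (is ?E)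
proof -
  have t': "0 \<le> t" using t by simp
  let ?T = "stopped_time c t"
  define l where "l k = l0 + real k * \<alpha>" for k
  have l_nonneg: "0 \<le> l k" for k using l0 \<alpha> by (simp add: l_def)
  define b where "b k = coefficient \<alpha> l0 k * \<beta> ^ k" for k
  define A where "A k = (\<integral>\<omega>. damped \<alpha> \<beta> (l k) (?T \<omega>) \<omega> \<partial>P x)" for k
  define B where "B k = (\<integral>\<omega>. occupation \<alpha> \<beta> (l k) 0 (?T \<omega>) \<omega> \<partial>P x)" for k
  have id: "A k + \<beta> * B (Suc k) - rate (l k) * B k = exp (l k * x)" for k
  proof -
    have "l (Suc k) = l k + \<alpha>" by (simp add: l_def algebra_simps)
    then show ?thesis
      using stopped_identity[of "l k" \<alpha> \<beta> t x c] l_nonneg \<alpha> \<beta> t xc by (simp add: A_def B_def)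
  qed
  have b_rate: "b (Suc k) * rate (l (Suc k)) = \<beta> * b k" for k
  proof -
    have "b (Suc k) * rate (l (Suc k)) = (coefficient \<alpha> l0 (Suc k) * rate (l (Suc k))) * (\<beta> * \<beta> ^ k)"
      by (simp only: b_def power_Suc mult_ac)
    also have "\<dots> = coefficient \<alpha> l0 k * (\<beta> * \<beta> ^ k)"
      using coefficient_Suc[OF nonzero[of k]] by (simp only: l_def)
    finally show ?thesis by (simp only: b_def mult_ac)
  qed
  \<comment> \<open>The relation \<open>b_rate\<close> cancels the term \<open>B (Suc k)\<close> of
    identity \<open>k\<close> against the one of identity \<open>k + 1\<close>. The first occupation
    term and a remainder at the upper end survive.\<close>
  have tele: "(\<Sum>k<Suc n. b k * exp (l k * x)) = (\<Sum>k<Suc n. b k * A k) + \<beta> * b n * B (Suc n) - rate l0 * B 0" for n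
  proof (induction n)
    case 0
    show ?case using id[of 0] by (simp add: b_def l_def)
  next
    case (Suc n)
    have "b (Suc n) * exp (l (Suc n) * x) = b (Suc n) * A (Suc n) + \<beta> * b (Suc n) * B (Suc (Suc n)) - (b (Suc n) * rate (l (Suc n))) * B (Suc n)"
      unfolding id[of "Suc n", symmetric] by (simp only: algebra_simps)
    then show ?case unfolding sum.lessThan_Suc[of _ "Suc n"] Suc.IH b_rate by simp
  qed
  define C where "C k = \<bar>coefficient \<alpha> l0 k\<bar> * (\<beta> * exp (\<alpha> * c)) ^ k" for k
  have C_summable: "summable C"
    using coefficient_summable_norm[OF \<alpha> l0, of "\<beta> * exp (\<alpha> * c)"] \<beta> by (simp add: C_def[abs_def])
  have exp_l: "exp (l k * y) = exp (l0 * y) * exp (\<alpha> * y) ^ k" for k y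
    by (simp add: l_def exp_add[symmetric] exp_of_nat_mult[symmetric] algebra_simps)
  have bexp: "\<bar>b k\<bar> * exp (l k * c) = exp (l0 * c) * C k" for k
    using \<beta> by (simp add: b_def C_def exp_l abs_mult power_mult_distrib power_abs)
  have B_bound: "0 \<le> B k \<and> B k \<le> t * exp (l k * c)" for k
  proof
    show "0 \<le> B k" unfolding B_def by (rule Bochner_Integration.integral_nonneg) (rule occupation_nonneg)
    have "B k \<le> (\<integral>\<omega>. t * exp (l k * c) \<partial>P x)"
      unfolding B_def
    proof (rule integral_mono_AE)
      show "integrable (P x) (\<lambda>\<omega>. occupation \<alpha> \<beta> (l k) 0 (?T \<omega>) \<omega>)"
        by (rule stopped_occupation_integrable[OF l_nonneg \<beta> t'])
      show "AE \<omega> in P x. occupation \<alpha> \<beta> (l k) 0 (?T \<omega>) \<omega> \<le> t * exp (l k * c)"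
        using regular_path[OF xc]
      proof eventually_elim
        case (elim \<omega>)
        then have \<omega>: "\<omega> \<in> space (P x)" and npj: "no_positive_jumps (\<lambda>t. X t \<omega>)" and X0: "X 0 \<omega> \<le> c" by auto
        have "occupation \<alpha> \<beta> (l k) 0 (?T \<omega>) \<omega> \<le> (LBINT u:{0..?T \<omega>}. exp (l k * c))"
          unfolding occupation_def
        proof (rule set_integral_mono)
          show "set_integrable lborel {0..?T \<omega>} (\<lambda>u. damped \<alpha> \<beta> (l k) (max 0 u) \<omega>)"
            by (rule damped_path_integrable[OF \<omega> \<beta>])
          show "set_integrable lborel {0..?T \<omega>} (\<lambda>u. exp (l k * c))"
            by (rule set_integrable_bounded_Icc[where C="exp (l k * c)"]) auto
          fix u assume u: "u \<in> {0..?T \<omega>}"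
          have "X u \<omega> \<le> c"
          proof (cases "u = ?T \<omega>")
            case True
            then show ?thesis using X_stopped_le[OF \<omega> npj X0 t'] by simp
          next
            case False
            then show ?thesis using X_before_stopped[OF t' _ _ X0, of u] u by simp
          qed
          then have le: "exp (l k * X u \<omega>) \<le> exp (l k * c)" using l_nonneg by (simp add: mult_left_mono)
          then show "damped \<alpha> \<beta> (l k) (max 0 u) \<omega> \<le> exp (l k * c)"
            using order_trans[OF damped_le_exp[OF \<beta>, of \<alpha> "l k" u \<omega>] le] u by simp
        qed
        also have "\<dots> = ?T \<omega> * exp (l k * c)"
          using stopped_time_bounds[OF t', of c \<omega>] by (simp add: set_lebesgue_integral_def)
        also have "\<dots> \<le> t * exp (l k * c)" using stopped_time_bounds[OF t', of c \<omega>] by (intro mult_right_mono) auto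
        finally show ?case .
      qed
    qed simp
    then show "B k \<le> t * exp (l k * c)" by (simp add: prob_space)
  qed
  \<comment> \<open>Up to the stopped time the path is at most \<open>c\<close>, so by
    \<open>B_bound\<close> the remainder is at most a constant times \<open>C n\<close>, a term of a
    convergent series.\<close>
  have rem: "(\<lambda>n. \<beta> * b n * B (Suc n)) \<longlonglongrightarrow> 0"
  proof (rule Lim_null_comparison)
    show "\<forall>\<^sub>F n in sequentially. norm (\<beta> * b n * B (Suc n)) \<le> (\<beta> * t * exp (\<alpha> * c) * exp (l0 * c)) * C n"
    proof (intro always_eventually allI)
      fix n
      have "norm (\<beta> * b n * B (Suc n)) = \<beta> * (\<bar>b n\<bar> * B (Suc n))" using \<beta> B_bound[of "Suc n"] by (simp add: abs_mult)
      also have "\<dots> \<le> \<beta> * (\<bar>b n\<bar> * (t * exp (l (Suc n) * c)))" using B_bound[of "Suc n"] \<beta> by (intro mult_left_mono) auto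
      also have "\<dots> = (\<beta> * t * exp (\<alpha> * c)) * (\<bar>b n\<bar> * exp (l n * c))"
      proof -
        have "exp (l (Suc n) * c) = exp (\<alpha> * c) * exp (l n * c)" unfolding exp_l by simp
        then show ?thesis by (simp only: mult_ac)
      qed
      finally show "norm (\<beta> * b n * B (Suc n)) \<le> (\<beta> * t * exp (\<alpha> * c) * exp (l0 * c)) * C n"
        unfolding bexp by (simp only: mult.assoc)
    qed
    show "(\<lambda>n. (\<beta> * t * exp (\<alpha> * c) * exp (l0 * c)) * C n) \<longlonglongrightarrow> 0"
      using tendsto_mult_right_zero[OF summable_LIMSEQ_zero[OF C_summable]] by simp
  qed
  have series: "(\<lambda>k. b k * exp (l k * y)) sums eigen_series \<alpha> \<beta> l0 y" for y
  proof -
    have "(\<lambda>k. exp (l0 * y) * (coefficient \<alpha> l0 k * (\<beta> * exp (\<alpha> * y)) ^ k)) sums eigen_series \<alpha> \<beta> l0 y"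
      unfolding eigen_series_def by (intro sums_mult summable_sums coefficient_summable \<alpha> l0)
    moreover have "exp (l0 * y) * (coefficient \<alpha> l0 k * (\<beta> * exp (\<alpha> * y)) ^ k) = b k * exp (l k * y)" for k
      by (simp add: b_def exp_l power_mult_distrib)
    ultimately show ?thesis by simp
  qed
  let ?h = "\<lambda>k \<omega>. b k * damped \<alpha> \<beta> (l k) (?T \<omega>) \<omega>"
  have h_eq: "?h k \<omega> = b k * exp (l k * X (?T \<omega>) \<omega>) * damped \<alpha> \<beta> 0 (?T \<omega>) \<omega>" for k \<omega>
    by (simp add: damped_def)
  have h_int: "integrable (P x) (?h k)" for k
    by (intro integrable_mult_right stopped_damped_integrable l_nonneg \<beta> t' xc)
  have h_norm: "(\<integral>\<omega>. norm (?h k \<omega>) \<partial>P x) \<le> exp (l0 * c) * C k" for k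
  proof -
    have "(\<integral>\<omega>. norm (?h k \<omega>) \<partial>P x) \<le> (\<integral>\<omega>. \<bar>b k\<bar> * exp (l k * c) \<partial>P x)"
    proof (rule integral_mono_AE)
      show "AE \<omega> in P x. norm (?h k \<omega>) \<le> \<bar>b k\<bar> * exp (l k * c)"
        using stopped_damped_le[OF l_nonneg \<beta> t' xc, of \<alpha> k] by eventually_elim (auto simp: abs_mult intro!: mult_left_mono)
    qed (use h_int in auto)
    then show ?thesis by (simp add: bexp prob_space)
  qed
  have sum_norm: "summable (\<lambda>k. \<integral>\<omega>. norm (?h k \<omega>) \<partial>P x)"
    by (rule summable_comparison_test'[OF summable_mult[OF C_summable, of "exp (l0 * c)"], of 0]) (use h_norm in auto)
  have AE_sum: "AE \<omega> in P x. summable (\<lambda>k. norm (?h k \<omega>))"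
  proof -
    have "AE \<omega> in P x. \<forall>k. damped \<alpha> \<beta> (l k) (?T \<omega>) \<omega> \<le> exp (l k * c)"
      unfolding AE_all_countable using stopped_damped_le[OF l_nonneg \<beta> t' xc] by blast
    then show ?thesis
    proof eventually_elim
      case (elim \<omega>)
      show ?case
      proof (rule summable_comparison_test'[OF summable_mult[OF C_summable, of "exp (l0 * c)"], of 0])
        fix k
        have "\<bar>b k\<bar> * damped \<alpha> \<beta> (l k) (?T \<omega>) \<omega> \<le> \<bar>b k\<bar> * exp (l k * c)" using elim by (intro mult_left_mono) auto
        then show "norm (norm (?h k \<omega>)) \<le> exp (l0 * c) * C k" by (simp add: abs_mult bexp)
      qed
    qed
  qed
  have sum_eq: "(\<Sum>k. ?h k \<omega>) = eigen_series \<alpha> \<beta> l0 (X (?T \<omega>) \<omega>) * damped \<alpha> \<beta> 0 (?T \<omega>) \<omega>" for \<omega>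
    unfolding h_eq by (rule sums_unique[symmetric]) (rule sums_mult2[OF series])
  show ?I using integrable_suminf[OF h_int AE_sum sum_norm] by (simp only: sum_eq)
  have "(\<lambda>k. \<integral>\<omega>. ?h k \<omega> \<partial>P x) sums (\<integral>\<omega>. (\<Sum>k. ?h k \<omega>) \<partial>P x)"
    by (rule sums_integral[OF h_int AE_sum sum_norm])
  then have Asum: "(\<lambda>k. b k * A k) sums (\<integral>\<omega>. eigen_series \<alpha> \<beta> l0 (X (?T \<omega>) \<omega>) * damped \<alpha> \<beta> 0 (?T \<omega>) \<omega> \<partial>P x)"
    by (simp only: sum_eq A_def integral_mult_right_zero)
  have "(\<lambda>n. (\<Sum>k<Suc n. b k * A k) + \<beta> * b n * B (Suc n) - rate l0 * B 0) \<longlonglongrightarrow>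
    (\<integral>\<omega>. eigen_series \<alpha> \<beta> l0 (X (?T \<omega>) \<omega>) * damped \<alpha> \<beta> 0 (?T \<omega>) \<omega> \<partial>P x) + 0 - rate l0 * B 0"
    by (intro tendsto_intros rem LIMSEQ_Suc) (use Asum in \<open>simp add: sums_def\<close>)
  moreover have "(\<lambda>n. \<Sum>k<Suc n. b k * exp (l k * x)) \<longlonglongrightarrow> eigen_series \<alpha> \<beta> l0 x"
    by (intro LIMSEQ_Suc) (use series in \<open>simp add: sums_def\<close>)
  ultimately have "(\<integral>\<omega>. eigen_series \<alpha> \<beta> l0 (X (?T \<omega>) \<omega>) * damped \<alpha> \<beta> 0 (?T \<omega>) \<omega> \<partial>P x) + 0 - rate l0 * B 0 = eigen_series \<alpha> \<beta> l0 x"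
    unfolding tele by (rule LIMSEQ_unique)
  then show ?E by (simp add: B_def l_def)
qed

section \<open>The killing event expressed through occupation integrals\<close>

definition lifetime_before :: "real \<Rightarrow> 'a \<Rightarrow> real" where
  "lifetime_before r \<omega> = enn2real (min (ennreal r) (e \<omega>))"

text \<open>Up to \<open>lifetime_before r\<close> the occupation integral is that of \<open>- d/du exp (- \<beta> * clock \<alpha> u)\<close>.\<close>

lemma occupation_of_clock:
  assumes \<omega>: "\<omega> \<in> space (P x)" and \<beta>: "0 \<le> \<beta>" and r: "0 \<le> r"
  shows "\<beta> * occupation \<alpha> \<beta> \<alpha> 0 r \<omega> = 1 - exp (- (\<beta> * clock \<alpha> (lifetime_before r \<omega>) \<omega>))"
proof -
  let ?m = "lifetime_before r \<omega>"
  have m: "0 \<le> ?m" "ennreal ?m = min (ennreal r) (e \<omega>)"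
    using r by (auto simp: lifetime_before_def ennreal_enn2real_if min_def top_unique)
  have mr: "?m \<le> r" using m r by (metis ennreal_le_iff min.cobounded1)
  have "\<beta> * occupation \<alpha> \<beta> \<alpha> 0 r \<omega> = (\<integral>u. indicator {0..r} u *\<^sub>R (\<beta> * damped \<alpha> \<beta> \<alpha> (max 0 u) \<omega>) \<partial>lborel)"
    by (simp add: occupation_def set_lebesgue_integral_def flip: integral_mult_right_zero)
      (rule Bochner_Integration.integral_cong, auto)
  also have "\<dots> = (\<integral>u. indicator {0..?m} u *\<^sub>R (\<beta> * exp (\<alpha> * X (max 0 u) \<omega>) * exp (- (\<beta> * clock \<alpha> u \<omega>))) \<partial>lborel)"
  proof (rule integral_cong_AE)
    note [measurable] = damped_path_measurable[OF \<omega>] X_path_measurable[OF \<omega>]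
    show "(\<lambda>u. indicator {0..r} u *\<^sub>R (\<beta> * damped \<alpha> \<beta> \<alpha> (max 0 u) \<omega>)) \<in> borel_measurable lborel" by measurable
    show "(\<lambda>u. indicator {0..?m} u *\<^sub>R (\<beta> * exp (\<alpha> * X (max 0 u) \<omega>) * exp (- (\<beta> * clock \<alpha> u \<omega>)))) \<in> borel_measurable lborel"
      using damping_step(1)[OF \<omega> \<beta> order_refl m(1), of \<alpha>] by (simp add: set_integrable_def)
    \<comment> \<open>The integrands can differ at the single point \<open>u = ?m\<close>: if that
      is the killing time, \<open>alive\<close> is already 0 there, while the closed interval still
      contains it.\<close>
    show "AE u in lborel. indicator {0..r} u *\<^sub>R (\<beta> * damped \<alpha> \<beta> \<alpha> (max 0 u) \<omega>) =
        indicator {0..?m} u *\<^sub>R (\<beta> * exp (\<alpha> * X (max 0 u) \<omega>) * exp (- (\<beta> * clock \<alpha> u \<omega>)))"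
      using AE_lborel_singleton[of ?m]
    proof eventually_elim
      case (elim u)
      show ?case
      proof (cases "0 \<le> u \<and> u \<le> r")
        case True
        then have "ennreal u < e \<omega> \<longleftrightarrow> u \<le> ?m"
        proof -
          have "u \<le> ?m \<longleftrightarrow> u < ?m" using elim by auto
          also have "\<dots> \<longleftrightarrow> ennreal u < min (ennreal r) (e \<omega>)"
            using True m by (simp add: ennreal_less_iff flip: m(2))
          also have "\<dots> \<longleftrightarrow> ennreal u < e \<omega>"
          proof (cases "u = r")
            case ur: True
            then have "?m < r" using elim mr by auto
            then have "e \<omega> < ennreal r"
              using m by (metis ennreal_less_iff min_def less_irrefl not_less)
            then show ?thesis using ur by auto
          next
            case False
            then show ?thesis using True by (auto simp: ennreal_less_iff)
          qed
          finally show ?thesis by simp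
        qed
        then show ?thesis using True mr by (auto simp: damped_def alive_def indicator_def)
      next
        case False
        then show ?thesis using mr by (auto simp: indicator_def)
      qed
    qed
  qed
  also have "\<dots> = 1 - exp (- (\<beta> * clock \<alpha> ?m \<omega>))"
    using damping_step(2)[OF \<omega> \<beta> order_refl m(1), of \<alpha>] by (simp add: set_lebesgue_integral_def)
  finally show ?thesis .
qed

text \<open>Pathwise, 1 splits into the damped process at the stopped time, the part
  \<open>1 - exp (- (\<beta> * clock))\<close> accumulated up to the earlier of that time and
  \<open>e\<close>, and the value \<open>K\<close> on killing. The expectation of the first two is
  known from \<open>stopped_identity\<close> with \<open>l = 0\<close>, where
  \<open>rate 0 = - p\<close>; no separate computation with the exponential law of \<open>e\<close>
  is required.\<close>

lemma killing_compensator: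
  assumes \<alpha>: "0 \<le> \<alpha>" and \<beta>: "0 \<le> \<beta>" and t: "0 < t" and xc: "x \<le> c"
  defines "K \<equiv> \<lambda>\<omega>. if e \<omega> \<le> ennreal (stopped_time c t \<omega>) then exp (- (\<beta> * clock \<alpha> (enn2real (e \<omega>)) \<omega>)) else 0"
  shows "integrable (P x) K"
    and "p * (\<integral>\<omega>. occupation \<alpha> \<beta> 0 0 (stopped_time c t \<omega>) \<omega> \<partial>P x) = (\<integral>\<omega>. K \<omega> \<partial>P x)"
proof -
  have t': "0 \<le> t" using t by simp
  let ?T = "stopped_time c t"
  note int = stopped_damped_integrable[OF order_refl \<beta> t' xc, of \<alpha>] stopped_occupation_integrable[OF \<alpha> \<beta> t', of x \<alpha> c]
  have K_eq: "1 - damped \<alpha> \<beta> 0 (?T \<omega>) \<omega> - \<beta> * occupation \<alpha> \<beta> \<alpha> 0 (?T \<omega>) \<omega> = K \<omega>" if \<omega>: "\<omega> \<in> space (P x)" for \<omega>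
    using stopped_time_bounds(1)[OF t', of c \<omega>]
    unfolding occupation_of_clock[OF \<omega> \<beta> stopped_time_bounds(1)[OF t']]
    by (auto simp: K_def damped_def alive_def lifetime_before_def min_def indicator_def not_le)
  have "integrable (P x) (\<lambda>\<omega>. 1 - damped \<alpha> \<beta> 0 (?T \<omega>) \<omega> - \<beta> * occupation \<alpha> \<beta> \<alpha> 0 (?T \<omega>) \<omega>)"
    using int by (intro Bochner_Integration.integrable_diff integrable_mult_right) auto
  then show "integrable (P x) K"
    using K_eq by (simp cong: Bochner_Integration.integrable_cong)
  have "(\<integral>\<omega>. K \<omega> \<partial>P x) = (\<integral>\<omega>. 1 - damped \<alpha> \<beta> 0 (?T \<omega>) \<omega> - \<beta> * occupation \<alpha> \<beta> \<alpha> 0 (?T \<omega>) \<omega> \<partial>P x)"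
    by (rule Bochner_Integration.integral_cong) (use K_eq in auto)
  also have "\<dots> = 1 - (\<integral>\<omega>. damped \<alpha> \<beta> 0 (?T \<omega>) \<omega> \<partial>P x) - \<beta> * (\<integral>\<omega>. occupation \<alpha> \<beta> \<alpha> 0 (?T \<omega>) \<omega> \<partial>P x)"
    using int by (simp add: prob_space)
  also have "\<dots> = p * (\<integral>\<omega>. occupation \<alpha> \<beta> 0 0 (?T \<omega>) \<omega> \<partial>P x)"
    using stopped_identity[of 0 \<alpha> \<beta> t x c] assms by (simp add: \<psi>_0)
  finally show "p * (\<integral>\<omega>. occupation \<alpha> \<beta> 0 0 (?T \<omega>) \<omega> \<partial>P x) = (\<integral>\<omega>. K \<omega> \<partial>P x)" by simp
qed

end

section \<open>The long-time limit and the resonant case\<close>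

lemma exp_neg_ennreal: "0 \<le> r \<Longrightarrow> exp_neg (ennreal r) = exp (- r)"
  by (simp add: exp_neg_def)

lemma exp_neg_bounds: "0 \<le> exp_neg z" "exp_neg z \<le> 1"
  by (auto simp: exp_neg_def)

lemma exp_neg_measurable [measurable]: "exp_neg \<in> borel_measurable borel"
  unfolding exp_neg_def[abs_def] by measurable

context killed_spectrally_negative_Levy
begin

lemma exp_functional_integrand_measurable:
  assumes "\<omega> \<in> space (P x)"
  shows "(\<lambda>u. ennreal (exp (\<alpha> * X u \<omega>)) * indicator {u. 0 \<le> u \<and> ennreal u \<le> T} u) \<in> borel_measurable lborel"
proof -
  note [measurable] = X_path_measurable[OF assms]
  have "(\<lambda>u. if 0 \<le> u \<and> ennreal u \<le> T then ennreal (exp (\<alpha> * X (max 0 u) \<omega>)) else 0) \<in> borel_measurable borel"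
    by measurable
  moreover have "(\<lambda>u. ennreal (exp (\<alpha> * X u \<omega>)) * indicator {u. 0 \<le> u \<and> ennreal u \<le> T} u) =
      (\<lambda>u. if 0 \<le> u \<and> ennreal u \<le> T then ennreal (exp (\<alpha> * X (max 0 u) \<omega>)) else 0)"
    by (auto simp: indicator_def fun_eq_iff)
  ultimately show ?thesis by simp
qed

lemma exp_functional_eq_clock:
  assumes "\<omega> \<in> space (P x)" "0 \<le> t"
  shows "exp_functional \<alpha> X (ennreal t) \<omega> = ennreal (clock \<alpha> t \<omega>)"
proof -
  have "exp_functional \<alpha> X (ennreal t) \<omega> = (\<integral>\<^sup>+u. ennreal (indicator {0..t} u *\<^sub>R exp (\<alpha> * X (max 0 u) \<omega>)) \<partial>lborel)"
    unfolding exp_functional_def using assms(2)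
    by (intro nn_integral_cong) (auto simp: indicator_def ennreal_le_iff)
  also have "\<dots> = ennreal (clock \<alpha> t \<omega>)"
    unfolding clock_def set_lebesgue_integral_def
    by (rule nn_integral_eq_integral) (use exp_X_path_integrable[OF assms(1), of t \<alpha>] in \<open>auto simp: set_integrable_def\<close>)
  finally show ?thesis .
qed

lemma exp_functional_limit:
  assumes "\<omega> \<in> space (P x)"
  shows "(\<lambda>n. exp_functional \<alpha> X (ennreal (real n)) \<omega>) \<longlonglongrightarrow> exp_functional \<alpha> X \<top> \<omega>"
  unfolding exp_functional_def
proof (rule nn_integral_LIMSEQ)
  show "incseq (\<lambda>n u. ennreal (exp (\<alpha> * X u \<omega>)) * indicator {u. 0 \<le> u \<and> ennreal u \<le> ennreal (real n)} u)"
    by (auto simp: incseq_def le_fun_def indicator_def ennreal_le_iff intro!: mult_left_mono)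
  show "(\<lambda>u. ennreal (exp (\<alpha> * X u \<omega>)) * indicator {u. 0 \<le> u \<and> ennreal u \<le> ennreal (real n)} u) \<in> borel_measurable lborel" for n
    by (rule exp_functional_integrand_measurable[OF assms])
  show "(\<lambda>n. ennreal (exp (\<alpha> * X u \<omega>)) * indicator {u. 0 \<le> u \<and> ennreal u \<le> ennreal (real n)} u) \<longlonglongrightarrow>
      ennreal (exp (\<alpha> * X u \<omega>)) * indicator {u. 0 \<le> u \<and> ennreal u \<le> \<top>} u" for u
  proof (rule tendsto_eventually)
    show "\<forall>\<^sub>F n in sequentially. ennreal (exp (\<alpha> * X u \<omega>)) * indicator {u. 0 \<le> u \<and> ennreal u \<le> ennreal (real n)} u =
      ennreal (exp (\<alpha> * X u \<omega>)) * indicator {u. 0 \<le> u \<and> ennreal u \<le> \<top>} u"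
      using eventually_ge_at_top[of "nat \<lceil>u\<rceil>"]
    proof eventually_elim
      case (elim n)
      then have "u \<le> real n" by linarith
      then show ?case by (auto simp: indicator_def ennreal_leI)
    qed
  qed
qed

lemma exp_neg_clock_limit:
  assumes \<omega>: "\<omega> \<in> space (P x)" and \<beta>: "0 \<le> \<beta>"
  shows "(\<lambda>n. exp (- (\<beta> * clock \<alpha> (real n) \<omega>))) \<longlonglongrightarrow> exp_neg (ennreal \<beta> * exp_functional \<alpha> X \<top> \<omega>)"
proof -
  have lim: "(\<lambda>n. ennreal (clock \<alpha> (real n) \<omega>)) \<longlonglongrightarrow> exp_functional \<alpha> X \<top> \<omega>"
    using exp_functional_limit[OF \<omega>, of \<alpha>] by (simp add: exp_functional_eq_clock[OF \<omega>])
  show ?thesis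
  proof (cases "exp_functional \<alpha> X \<top> \<omega>")
    case (real r)
    then have "(\<lambda>n. clock \<alpha> (real n) \<omega>) \<longlonglongrightarrow> r"
      using lim clock_nonneg by (simp add: tendsto_ennreal_iff)
    then have "(\<lambda>n. exp (- (\<beta> * clock \<alpha> (real n) \<omega>))) \<longlonglongrightarrow> exp (- (\<beta> * r))"
      by (intro tendsto_intros)
    moreover have "exp_neg (ennreal \<beta> * exp_functional \<alpha> X \<top> \<omega>) = exp (- (\<beta> * r))"
      using real \<beta> by (simp add: exp_neg_ennreal flip: ennreal_mult')
    ultimately show ?thesis by simp
  next
    case top
    show ?thesis
    \<comment> \<open>With an infinite total clock the limit is 0 for positive
      \<open>\<beta>\<close> but 1 for \<open>\<beta> = 0\<close>; the latter agrees with
      \<open>exp_neg\<close> because 0 times \<infinity> is 0 in \<open>ennreal\<close>.\<close>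
    proof (cases "\<beta> = 0")
      case True
      then show ?thesis by (simp add: exp_neg_def)
    next
      case False
      have "filterlim (\<lambda>n. clock \<alpha> (real n) \<omega>) at_top sequentially"
        unfolding filterlim_at_top_dense
      proof
        fix Z
        have "\<forall>\<^sub>F n in sequentially. ennreal Z < ennreal (clock \<alpha> (real n) \<omega>)"
          by (rule order_tendstoD(1)[OF lim]) (simp add: top)
        then show "\<forall>\<^sub>F n in sequentially. Z < clock \<alpha> (real n) \<omega>"
          by eventually_elim (metis ennreal_leI not_less)
      qed
      then have "filterlim (\<lambda>n. \<beta> * clock \<alpha> (real n) \<omega>) at_top sequentially"
        using False \<beta> by (intro filterlim_tendsto_pos_mult_at_top[OF tendsto_const]) auto
      then have "filterlim (\<lambda>n. - (\<beta> * clock \<alpha> (real n) \<omega>)) at_bot sequentially"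
        by (simp add: filterlim_uminus_at_bot)
      then have "(\<lambda>n. exp (- (\<beta> * clock \<alpha> (real n) \<omega>))) \<longlonglongrightarrow> 0"
        by (rule filterlim_compose[OF exp_at_bot])
      moreover have "exp_neg (ennreal \<beta> * exp_functional \<alpha> X \<top> \<omega>) = 0"
        using top False \<beta> by (simp add: exp_neg_def ennreal_mult_top)
      ultimately show ?thesis by simp
    qed
  qed
qed

lemma exp_functional_P [measurable]: "(\<lambda>\<omega>. exp_functional \<alpha> X (e \<omega>) \<omega>) \<in> borel_measurable (P x)"
proof -
  have "(\<lambda>(u, \<omega>). X (max 0 u) \<omega>) \<in> borel_measurable (borel \<Otimes>\<^sub>M P x)"
    by (rule jointly_measurable) (use X_right in auto)
  moreover have "(\<lambda>z. (snd z, fst z)) \<in> P x \<Otimes>\<^sub>M borel \<rightarrow>\<^sub>M borel \<Otimes>\<^sub>M P x" by measurable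
  ultimately have [measurable]: "(\<lambda>z. X (max 0 (snd z)) (fst z)) \<in> borel_measurable (P x \<Otimes>\<^sub>M borel)"
    using measurable_compose[of "\<lambda>z. (snd z, fst z)" "P x \<Otimes>\<^sub>M borel" "borel \<Otimes>\<^sub>M P x" "\<lambda>(u, \<omega>). X (max 0 u) \<omega>" borel] by simp
  have "(\<lambda>\<omega>. \<integral>\<^sup>+u. (if 0 \<le> u \<and> ennreal u \<le> e \<omega> then ennreal (exp (\<alpha> * X (max 0 u) \<omega>)) else 0) \<partial>lborel) \<in> borel_measurable (P x)"
    by (rule lborel.borel_measurable_nn_integral) (simp add: split_beta')
  moreover have "(\<lambda>\<omega>. exp_functional \<alpha> X (e \<omega>) \<omega>) = (\<lambda>\<omega>. \<integral>\<^sup>+u. (if 0 \<le> u \<and> ennreal u \<le> e \<omega> then ennreal (exp (\<alpha> * X (max 0 u) \<omega>)) else 0) \<partial>lborel)"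
    unfolding exp_functional_def by (intro ext nn_integral_cong) (auto simp: indicator_def)
  ultimately show ?thesis by simp
qed

definition payoff :: "real \<Rightarrow> real \<Rightarrow> real \<Rightarrow> 'a \<Rightarrow> real" where
  "payoff \<alpha> \<beta> c \<omega> = exp_neg (ennreal \<beta> * exp_functional \<alpha> X (e \<omega>) \<omega>) *
     indicator {\<omega>. first_passage_above X c \<omega> \<ge> e \<omega>} \<omega>"

lemma payoff_P [measurable]: "payoff \<alpha> \<beta> c \<in> borel_measurable (P x)"
proof -
  have "(\<lambda>\<omega>. if first_passage_above X c \<omega> \<ge> e \<omega> then exp_neg (ennreal \<beta> * exp_functional \<alpha> X (e \<omega>) \<omega>) else 0) \<in> borel_measurable (P x)"
    by measurable
  moreover have "payoff \<alpha> \<beta> c = (\<lambda>\<omega>. if first_passage_above X c \<omega> \<ge> e \<omega> then exp_neg (ennreal \<beta> * exp_functional \<alpha> X (e \<omega>) \<omega>) else 0)"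
    by (auto simp: payoff_def fun_eq_iff indicator_def)
  ultimately show ?thesis by simp
qed

lemma rate_above_\<phi>: "0 < \<alpha> \<Longrightarrow> 0 < rate (\<phi> + real (Suc k) * \<alpha>)"
  using \<psi>_above_\<phi>[of "\<phi> + real (Suc k) * \<alpha>"] by (simp del: of_nat_Suc)

text \<open>All rates beyond \<open>\<phi>\<close> are positive, hence so are all coefficients. This
  keeps the denominator in the definition of \<open>M_nonresonant\<close> away from 0.\<close>

lemma eigen_series_\<phi>_pos:
  assumes "0 < \<alpha>" "0 \<le> \<beta>" shows "0 < eigen_series \<alpha> \<beta> \<phi> y"
proof -
  have "0 < rate (\<phi> + real l * \<alpha>)" if "1 \<le> l" for l
    using rate_above_\<phi>[OF assms(1), of "l - 1"] that by simp
  then have pos: "0 < coefficient \<alpha> \<phi> k" for k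
  proof -
    have "0 < (\<Prod>l=1..k. rate (\<phi> + real l * \<alpha>))"
      by (rule prod_pos) (use \<open>\<And>l. 1 \<le> l \<Longrightarrow> 0 < rate (\<phi> + real l * \<alpha>)\<close> in auto)
    then show ?thesis unfolding coefficient_def by (rule positive_imp_inverse_positive)
  qed
  have "0 < (\<Sum>k. coefficient \<alpha> \<phi> k * (\<beta> * exp (\<alpha> * y)) ^ k)"
    by (rule suminf_pos2[where i=0])
      (use coefficient_summable[OF assms(1) less_imp_le[OF \<phi>_pos]] pos assms(2) in \<open>auto intro!: mult_nonneg_nonneg less_imp_le[OF pos]\<close>)
  then show ?thesis by (simp add: eigen_series_def)
qed

text \<open>The power series tends to its constant term 1, and for positive \<open>l0\<close> the
  exponential prefactor sends the product to 0. For \<open>p = 0\<close> this identifies the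
  contribution of paths that never pass the level.\<close>

lemma eigen_series_at_minus_infinity:
  assumes "0 < \<alpha>" "0 \<le> l0" "filterlim (\<lambda>t. X t \<omega>) at_bot at_top"
  shows "(\<lambda>n. eigen_series \<alpha> \<beta> l0 (X (real n) \<omega>)) \<longlonglongrightarrow> (if l0 = 0 then 1 else 0)"
proof -
  have "(\<lambda>n. \<beta> * exp (\<alpha> * X (real n) \<omega>)) \<longlonglongrightarrow> \<beta> * 0"
    by (intro tendsto_intros exp_drift_to_0 assms)
  moreover have "isCont (\<lambda>z. \<Sum>k. coefficient \<alpha> l0 k * z ^ k) 0"
    by (rule isCont_powser_converges_everywhere) (rule coefficient_summable[OF assms(1,2)])
  ultimately have "(\<lambda>n. \<Sum>k. coefficient \<alpha> l0 k * (\<beta> * exp (\<alpha> * X (real n) \<omega>)) ^ k) \<longlonglongrightarrow> (\<Sum>k. coefficient \<alpha> l0 k * 0 ^ k)"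
    by (intro isCont_tendsto_compose[of 0 "\<lambda>z. \<Sum>k. coefficient \<alpha> l0 k * z ^ k"]) auto
  then have S: "(\<lambda>n. \<Sum>k. coefficient \<alpha> l0 k * (\<beta> * exp (\<alpha> * X (real n) \<omega>)) ^ k) \<longlonglongrightarrow> 1"
    by simp
  show ?thesis
  proof (cases "l0 = 0")
    case True
    then show ?thesis using S by (simp add: eigen_series_def)
  next
    case False
    then have "(\<lambda>n. exp (l0 * X (real n) \<omega>)) \<longlonglongrightarrow> 0" using assms by (intro exp_drift_to_0) auto
    from tendsto_mult[OF this S] show ?thesis using False by (simp add: eigen_series_def)
  qed
qed

lemma expectation_payoff_nonresonant:
  assumes \<alpha>: "0 < \<alpha>" and \<beta>: "0 \<le> \<beta>" and xc: "x \<le> c" and nonres: "\<And>m::nat. 1 \<le> m \<Longrightarrow> \<phi> \<noteq> real m * \<alpha>"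
  shows "(\<integral>\<omega>. payoff \<alpha> \<beta> c \<omega> \<partial>P x) = M_nonresonant \<psi> \<phi> p \<alpha> \<beta> (exp x) (exp c)"
proof -
  have \<phi>0: "0 \<le> \<phi>" using \<phi>_pos by simp
  define SJ where "SJ = eigen_series \<alpha> \<beta> 0"
  define SI where "SI = eigen_series \<alpha> \<beta> \<phi>"
  \<comment> \<open>This constant makes the combination \<open>f\<close> vanish at \<open>c\<close>,
    so that a passage contributes nothing to the stopped expectation.\<close>
  define D where "D = SJ c / SI c"
  define f where "f y = SJ y - D * SI y" for y
  have [measurable]: "SJ \<in> borel_measurable borel" "SI \<in> borel_measurable borel"
    unfolding SJ_def SI_def using \<alpha> \<phi>0 by auto
  have f_meas [measurable]: "f \<in> borel_measurable borel" unfolding f_def by measurable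
  have "0 < SI c" unfolding SI_def by (rule eigen_series_\<phi>_pos[OF \<alpha> \<beta>])
  then have f_c: "f c = 0" by (simp add: f_def D_def)
  obtain C where C: "\<And>y. y \<le> c \<Longrightarrow> \<bar>f y\<bar> \<le> C"
  proof -
    define C1 where "C1 = exp (0 * c) * (\<Sum>k. \<bar>coefficient \<alpha> 0 k\<bar> * (\<beta> * exp (\<alpha> * c)) ^ k)"
    define C2 where "C2 = exp (\<phi> * c) * (\<Sum>k. \<bar>coefficient \<alpha> \<phi> k\<bar> * (\<beta> * exp (\<alpha> * c)) ^ k)"
    have "\<bar>f y\<bar> \<le> C1 + \<bar>D\<bar> * C2" if y: "y \<le> c" for y
    proof -
      have "\<bar>SJ y\<bar> \<le> C1" unfolding SJ_def C1_def by (rule eigen_series_bound[OF \<alpha> order_refl \<beta> y])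
      moreover have "\<bar>D * SI y\<bar> \<le> \<bar>D\<bar> * C2"
        unfolding abs_mult SI_def C2_def by (rule mult_left_mono[OF eigen_series_bound[OF \<alpha> \<phi>0 \<beta> y]]) simp
      ultimately show ?thesis unfolding f_def by linarith
    qed
    then show ?thesis using that by blast
  qed
  have C0: "0 \<le> C" using C[of c] by simp
  define K where "K n \<omega> = (if e \<omega> \<le> ennreal (stopped_time c (real (Suc n)) \<omega>) then exp (- (\<beta> * clock \<alpha> (enn2real (e \<omega>)) \<omega>)) else 0)" for n \<omega>
  define S where "S n \<omega> = f (X (stopped_time c (real (Suc n)) \<omega>) \<omega>) * damped \<alpha> \<beta> 0 (stopped_time c (real (Suc n)) \<omega>) \<omega> + K n \<omega>" for n \<omega>
  have S_int: "integrable (P x) (S n)" and S_val: "(\<integral>\<omega>. S n \<omega> \<partial>P x) = f x" for n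
  proof -
    let ?t = "real (Suc n)" and ?T = "stopped_time c (real (Suc n))"
    have t: "0 < ?t" by simp
    \<comment> \<open>A positive exponent has rate 0 only if it equals \<open>\<phi>\<close>,
      because the rate is negative below \<open>\<phi>\<close> and positive above. This is the place
      where resonance is excluded.\<close>
    have nzJ: "rate (0 + real (Suc k) * \<alpha>) \<noteq> 0" for k
    proof -
      have "0 < real (Suc k) * \<alpha>" using \<alpha> by simp
      moreover have "real (Suc k) * \<alpha> \<noteq> \<phi>" using nonres[of "Suc k"] by simp
      ultimately show ?thesis
        using \<psi>_below_\<phi>[of "real (Suc k) * \<alpha>"] \<psi>_above_\<phi>[of "real (Suc k) * \<alpha>"] by (cases "real (Suc k) * \<alpha> < \<phi>") auto
    qed
    have nzI: "rate (\<phi> + real (Suc k) * \<alpha>) \<noteq> 0" for k using rate_above_\<phi>[OF \<alpha>, of k] by simp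
    note J = eigen_series_stopped[OF \<alpha> order_refl \<beta> t xc nzJ, folded SJ_def]
    note I = eigen_series_stopped[OF \<alpha> \<phi>0 \<beta> t xc nzI, folded SI_def]
    note Kc = killing_compensator[OF less_imp_le[OF \<alpha>] \<beta> t xc, folded K_def]
    have S_eq: "S n \<omega> = SJ (X (?T \<omega>) \<omega>) * damped \<alpha> \<beta> 0 (?T \<omega>) \<omega> - D * (SI (X (?T \<omega>) \<omega>) * damped \<alpha> \<beta> 0 (?T \<omega>) \<omega>) + K n \<omega>" for \<omega>
      by (simp only: S_def f_def left_diff_distrib mult.assoc)
    show "integrable (P x) (S n)"
      unfolding S_eq[abs_def] using J(1) I(1) Kc(1)
      by (intro Bochner_Integration.integrable_add Bochner_Integration.integrable_diff integrable_mult_right)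
    have "(\<integral>\<omega>. S n \<omega> \<partial>P x) = (\<integral>\<omega>. SJ (X (?T \<omega>) \<omega>) * damped \<alpha> \<beta> 0 (?T \<omega>) \<omega> \<partial>P x) -
        D * (\<integral>\<omega>. SI (X (?T \<omega>) \<omega>) * damped \<alpha> \<beta> 0 (?T \<omega>) \<omega> \<partial>P x) + (\<integral>\<omega>. K n \<omega> \<partial>P x)"
      unfolding S_eq using J(1) I(1) Kc(1) by simp
    \<comment> \<open>The occupation term of \<open>SI\<close> drops out since
      \<open>rate \<phi> = 0\<close>; that of \<open>SJ\<close> has the factor
      \<open>- rate 0 = p\<close> and is replaced by the expectation of \<open>K n\<close>.\<close>
    also have "\<dots> = f x"
      using J(2) I(2) Kc(2) by (simp add: f_def \<psi>_0 \<psi>_\<phi>)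
    finally show "(\<integral>\<omega>. S n \<omega> \<partial>P x) = f x" .
  qed
  have "(\<lambda>n. \<integral>\<omega>. S n \<omega> \<partial>P x) \<longlonglongrightarrow> (\<integral>\<omega>. payoff \<alpha> \<beta> c \<omega> \<partial>P x)"
  proof (rule integral_dominated_convergence[where w="\<lambda>_. C + 1"])
    show "payoff \<alpha> \<beta> c \<in> borel_measurable (P x)" by (rule payoff_P)
    show "S n \<in> borel_measurable (P x)" for n using S_int by auto
    show "AE \<omega> in P x. norm (S n \<omega>) \<le> C + 1" for n
      using regular_path[OF xc]
    proof eventually_elim
      case (elim \<omega>)
      let ?T = "stopped_time c (real (Suc n)) \<omega>"
      have "X ?T \<omega> \<le> c" using elim X_stopped_le[of \<omega> x c "real (Suc n)"] by simp
      then have "\<bar>f (X ?T \<omega>)\<bar> * damped \<alpha> \<beta> 0 ?T \<omega> \<le> C * 1"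
        using C C0 damped_le_exp[OF \<beta>, of \<alpha> 0 ?T \<omega>] by (intro mult_mono) auto
      moreover have "0 \<le> K n \<omega> \<and> K n \<omega> \<le> 1" using \<beta> clock_nonneg by (simp add: K_def)
      moreover have "\<bar>f (X ?T \<omega>) * damped \<alpha> \<beta> 0 ?T \<omega>\<bar> = \<bar>f (X ?T \<omega>)\<bar> * damped \<alpha> \<beta> 0 ?T \<omega>" by (simp add: abs_mult)
      ultimately show ?case unfolding S_def real_norm_def by linarith
    qed
    have fin: "AE \<omega> in P x. p \<noteq> 0 \<longrightarrow> e \<omega> < \<top>" using AE_e_finite[of x] by (cases "p = 0") auto
    have inf: "AE \<omega> in P x. p = 0 \<longrightarrow> e \<omega> = \<top>" using AE_e_infinite[of x] by (cases "p = 0") auto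
    have drift: "AE \<omega> in P x. p = 0 \<longrightarrow> filterlim (\<lambda>t. X t \<omega>) at_bot at_top"
      using drift_to_minus_infinity[of x] by (cases "p = 0") auto
    show "AE \<omega> in P x. (\<lambda>n. S n \<omega>) \<longlonglongrightarrow> payoff \<alpha> \<beta> c \<omega>"
      using regular_path[OF xc] fin inf drift
    proof eventually_elim
      case (elim \<omega>)
      then have \<omega>: "\<omega> \<in> space (P x)" and npj: "no_positive_jumps (\<lambda>t. X t \<omega>)" and X0: "X 0 \<omega> \<le> c" by auto
      let ?\<tau> = "first_passage_above X c \<omega>"
      have killed: "exp (- (\<beta> * clock \<alpha> r \<omega>)) = exp_neg (ennreal \<beta> * exp_functional \<alpha> X (e \<omega>) \<omega>)"
        if "e \<omega> = ennreal r" "0 \<le> r" for r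
        using that \<beta> clock_nonneg by (simp add: exp_functional_eq_clock[OF \<omega>] exp_neg_ennreal flip: ennreal_mult')
      \<comment> \<open>Three situations. After a finite passage time, \<open>f c = 0\<close> leaves
        only \<open>K n\<close>. Without passage but with finite \<open>e\<close>,
        \<open>alive\<close> becomes 0 and again only \<open>K n\<close> remains. If both times are
        infinite then \<open>p = 0\<close>, \<open>K n\<close> is 0, and the drift sends
        \<open>f\<close> along the path to 1 while the discount converges.\<close>
      show ?case
      proof (cases ?\<tau>)
        case (real r)
        obtain N :: nat where N: "r < real N" using reals_Archimedean2 by blast
        have "S n \<omega> = payoff \<alpha> \<beta> c \<omega>" if n: "N \<le> n" for n
        proof -
          have "r < real (Suc n)" using N n by simp
          then have less: "?\<tau> < ennreal (real (Suc n))" using real by (simp add: ennreal_lessI del: of_nat_Suc)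
          have T: "ennreal (stopped_time c (real (Suc n)) \<omega>) = ?\<tau>"
            using less by (simp only: ennreal_stopped_time of_nat_0_le_iff min.absorb2 less_imp_le)
          have "f (X (stopped_time c (real (Suc n)) \<omega>) \<omega>) = 0"
            using X_stopped_eq[OF \<omega> npj X0 _ less] f_c by simp
          then have "S n \<omega> = (if e \<omega> \<le> ?\<tau> then exp (- (\<beta> * clock \<alpha> (enn2real (e \<omega>)) \<omega>)) else 0)"
            unfolding S_def K_def T by simp
          also have "\<dots> = payoff \<alpha> \<beta> c \<omega>"
          proof (cases "e \<omega> \<le> ?\<tau>")
            case True
            then have "e \<omega> < \<top>" using real by (metis ennreal_less_top order_le_less_trans)
            then obtain s where s: "e \<omega> = ennreal s" "0 \<le> s" by (cases "e \<omega>") auto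
            then show ?thesis using True killed[OF s] by (simp add: payoff_def)
          qed (simp add: payoff_def)
          finally show ?thesis .
        qed
        then show ?thesis by (intro tendsto_eventually) (auto simp: eventually_sequentially)
      next
        case top
        have T: "stopped_time c (real (Suc n)) \<omega> = real (Suc n)" for n
          by (rule stopped_time_eq) (auto simp: top)
        show ?thesis
        proof (cases "e \<omega>")
          case (real r)
          obtain N :: nat where N: "r < real N" using reals_Archimedean2 by blast
          have "S n \<omega> = payoff \<alpha> \<beta> c \<omega>" if n: "N \<le> n" for n
          proof -
            have "r \<le> real (Suc n)" using N n by simp
            then have le: "e \<omega> \<le> ennreal (real (Suc n))" using real by (simp add: ennreal_leI del: of_nat_Suc)
            then have "alive (real (Suc n)) \<omega> = 0" by (simp add: alive_def not_less)
            then have "S n \<omega> = exp (- (\<beta> * clock \<alpha> r \<omega>))"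
              using le real unfolding S_def K_def T damped_def by simp
            then show ?thesis using killed[OF real(2,1)] top by (simp add: payoff_def)
          qed
          then show ?thesis by (intro tendsto_eventually) (auto simp: eventually_sequentially)
        next
          case e_top: top
          then have p: "p = 0" using elim(2) by auto
          have dr: "filterlim (\<lambda>t. X t \<omega>) at_bot at_top" using elim(4) p by simp
          have "(\<lambda>n. f (X (real n) \<omega>)) \<longlonglongrightarrow> 1 - D * 0"
            unfolding f_def SJ_def SI_def
            using eigen_series_at_minus_infinity[OF \<alpha> order_refl dr, of \<beta>] eigen_series_at_minus_infinity[OF \<alpha> \<phi>0 dr, of \<beta>] \<phi>_pos
            by (intro tendsto_intros) auto
          then have "(\<lambda>n. f (X (real n) \<omega>) * exp (- (\<beta> * clock \<alpha> (real n) \<omega>))) \<longlonglongrightarrow> (1 - D * 0) * exp_neg (ennreal \<beta> * exp_functional \<alpha> X \<top> \<omega>)"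
            by (intro tendsto_mult exp_neg_clock_limit[OF \<omega> \<beta>])
          then have "(\<lambda>n. f (X (real (Suc n)) \<omega>) * exp (- (\<beta> * clock \<alpha> (real (Suc n)) \<omega>))) \<longlonglongrightarrow> (1 - D * 0) * exp_neg (ennreal \<beta> * exp_functional \<alpha> X \<top> \<omega>)"
            by (rule LIMSEQ_Suc)
          moreover have "S n \<omega> = f (X (real (Suc n)) \<omega>) * exp (- (\<beta> * clock \<alpha> (real (Suc n)) \<omega>))" for n
            unfolding S_def T K_def using e_top by (simp add: damped_def alive_def top_unique)
          moreover have "payoff \<alpha> \<beta> c \<omega> = exp_neg (ennreal \<beta> * exp_functional \<alpha> X \<top> \<omega>)"
            using e_top top by (simp add: payoff_def)
          ultimately show ?thesis by simp
        qed
      qed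
    qed
  qed simp
  then have "(\<integral>\<omega>. payoff \<alpha> \<beta> c \<omega> \<partial>P x) = f x"
    unfolding S_val by (simp add: LIMSEQ_const_iff)
  also have "f x = M_nonresonant \<psi> \<phi> p \<alpha> \<beta> (exp x) (exp c)"
  proof -
    have pw: "exp y powr \<alpha> = exp (\<alpha> * y)" for y by (simp add: powr_def)
    have J: "SJ y = J_series \<psi> p \<alpha> (\<beta> * exp y powr \<alpha>)" for y
      by (simp add: SJ_def eigen_series_def J_series_def coefficient_def pw)
    have I: "SI y = exp (\<phi> * y) * I_series \<psi> \<phi> p \<alpha> (\<beta> * exp y powr \<alpha>)" for y
      by (simp add: SI_def eigen_series_def I_series_def coefficient_def pw)
    have "(exp x / exp c) powr \<phi> = exp (\<phi> * x) / exp (\<phi> * c)"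
      by (simp add: exp_diff[symmetric] powr_def algebra_simps)
    then show ?thesis
      by (simp add: f_def D_def M_nonresonant_def J I mult_ac)
  qed
  finally show ?thesis .
qed

text \<open>For an exponent strictly between 0 and \<open>\<phi>\<close> the rate is negative, so
  \<open>stopped_identity\<close> with \<open>\<beta> = 0\<close> bounds the expected occupation
  integral by \<open>exp (\<delta> * x) / (- rate \<delta>)\<close>, uniformly in time. On paths
  with neither passage nor killing these integrals increase to the whole exponential functional, and
  Fatou's lemma applies.\<close>

lemma exp_functional_finite:
  assumes \<delta>: "0 < \<delta>" "\<delta> < \<phi>" and xc: "x \<le> c"
  shows "AE \<omega> in P x. first_passage_above X c \<omega> = \<top> \<longrightarrow> e \<omega> = \<top> \<longrightarrow> exp_functional \<delta> X \<top> \<omega> < \<top>"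
proof -
  define M where "M = exp (\<delta> * x) / (- rate \<delta>)"
  have r: "rate \<delta> < 0" using \<psi>_below_\<phi>[OF \<delta>] by simp
  let ?O = "\<lambda>n \<omega>. occupation 0 0 \<delta> 0 (stopped_time c (real (Suc n)) \<omega>) \<omega>"
  have int: "integrable (P x) (?O n)" for n
    by (rule stopped_occupation_integrable) (use \<delta> in auto)
  have le: "(\<integral>\<^sup>+\<omega>. ennreal (?O n \<omega>) \<partial>P x) \<le> ennreal M" for n
  proof -
    have "0 \<le> (\<integral>\<omega>. damped 0 0 \<delta> (stopped_time c (real (Suc n)) \<omega>) \<omega> \<partial>P x)"
      by (rule Bochner_Integration.integral_nonneg) simp
    moreover have "(\<integral>\<omega>. damped 0 0 \<delta> (stopped_time c (real (Suc n)) \<omega>) \<omega> \<partial>P x) - rate \<delta> * (\<integral>\<omega>. ?O n \<omega> \<partial>P x) = exp (\<delta> * x)"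
      using stopped_identity[of \<delta> 0 0 "real (Suc n)" x c] \<delta> xc by (simp del: of_nat_Suc)
    moreover have "(\<integral>\<omega>. ?O n \<omega> \<partial>P x) * (- rate \<delta>) = - (rate \<delta> * (\<integral>\<omega>. ?O n \<omega> \<partial>P x))"
      by (simp only: mult_minus_right mult.commute)
    ultimately have "(\<integral>\<omega>. ?O n \<omega> \<partial>P x) * (- rate \<delta>) \<le> exp (\<delta> * x)"
      by linarith
    then have "(\<integral>\<omega>. ?O n \<omega> \<partial>P x) \<le> M" unfolding M_def using r by (subst pos_le_divide_eq) auto
    then show ?thesis
      by (subst nn_integral_eq_integral[OF int]) (auto simp: occupation_nonneg intro!: ennreal_leI)
  qed
  have m: "(\<lambda>\<omega>. ennreal (?O n \<omega>)) \<in> borel_measurable (P x)" for n using int[of n] by measurable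
  have "(\<integral>\<^sup>+\<omega>. liminf (\<lambda>n. ennreal (?O n \<omega>)) \<partial>P x) \<le> liminf (\<lambda>n. \<integral>\<^sup>+\<omega>. ennreal (?O n \<omega>) \<partial>P x)"
    by (rule nn_integral_liminf[OF m])
  also have "\<dots> \<le> ennreal M" by (rule Liminf_le) (use le in auto)
  finally have "(\<integral>\<^sup>+\<omega>. liminf (\<lambda>n. ennreal (?O n \<omega>)) \<partial>P x) \<noteq> \<infinity>"
    using ennreal_less_top[of M] by (auto simp: top_unique)
  then have "AE \<omega> in P x. liminf (\<lambda>n. ennreal (?O n \<omega>)) \<noteq> \<infinity>"
    using m by (intro nn_integral_PInf_AE borel_measurable_liminf) auto
  then show ?thesis
    using AE_space
  proof eventually_elim
    case (elim \<omega>)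
    show ?case
    proof (intro impI)
      assume top: "first_passage_above X c \<omega> = \<top>" "e \<omega> = \<top>"
      have "stopped_time c (real (Suc n)) \<omega> = real (Suc n)" for n
        by (rule stopped_time_eq) (auto simp: top)
      then have O_eq: "?O n \<omega> = clock \<delta> (real (Suc n)) \<omega>" for n
        using top(2) by (simp add: occupation_def damped_def alive_def clock_def top.not_eq_extremum[symmetric] del: of_nat_Suc)
      have "(\<lambda>n. ennreal (?O n \<omega>)) \<longlonglongrightarrow> exp_functional \<delta> X \<top> \<omega>"
        unfolding O_eq using LIMSEQ_Suc[OF exp_functional_limit[OF elim(2), of \<delta>]]
        by (simp add: exp_functional_eq_clock[OF elim(2)] del: of_nat_Suc)
      then have "liminf (\<lambda>n. ennreal (?O n \<omega>)) = exp_functional \<delta> X \<top> \<omega>"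
        by (rule lim_imp_Liminf[OF sequentially_bot])
      then show "exp_functional \<delta> X \<top> \<omega> < \<top>"
        using elim(1) by (simp add: top.not_eq_extremum[symmetric])
    qed
  qed
qed

lemma exp_functional_tendsto:
  assumes \<omega>: "\<omega> \<in> space (P x)" and lim: "S \<longlonglongrightarrow> \<alpha>" and \<beta>: "0 \<le> \<beta>"
    and W [measurable]: "W \<in> borel_measurable lborel" and W_fin: "(\<integral>\<^sup>+u. W u \<partial>lborel) < \<top>"
    and dom: "\<forall>\<^sub>F i in sequentially. \<forall>u. 0 \<le> u \<longrightarrow> ennreal u \<le> T \<longrightarrow> ennreal (exp (S i * X u \<omega>)) \<le> W u"
  shows "(\<lambda>i. exp_neg (ennreal \<beta> * exp_functional (S i) X T \<omega>)) \<longlonglongrightarrow> exp_neg (ennreal \<beta> * exp_functional \<alpha> X T \<omega>)"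
proof -
  obtain N where N: "\<And>i u. N \<le> i \<Longrightarrow> 0 \<le> u \<Longrightarrow> ennreal u \<le> T \<Longrightarrow> ennreal (exp (S i * X u \<omega>)) \<le> W u"
    using dom by (auto simp: eventually_sequentially)
  define g where "g i u = ennreal (exp (S (i + N) * X u \<omega>)) * indicator {u. 0 \<le> u \<and> ennreal u \<le> T} u" for i u
  define g' where "g' u = ennreal (exp (\<alpha> * X u \<omega>)) * indicator {u. 0 \<le> u \<and> ennreal u \<le> T} u" for u
  have g_meas: "g i \<in> borel_measurable lborel" "g' \<in> borel_measurable lborel" for i
    unfolding g_def g'_def by (rule exp_functional_integrand_measurable[OF \<omega>])+
  have g_W: "g i u \<le> W u" for i u
    using N[of "i + N" u] by (auto simp: g_def indicator_def)
  have g_lim: "(\<lambda>i. g i u) \<longlonglongrightarrow> g' u" for u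
  proof -
    have "(\<lambda>i. ennreal (exp (S (i + N) * X u \<omega>))) \<longlonglongrightarrow> ennreal (exp (\<alpha> * X u \<omega>))"
      by (intro tendsto_ennrealI tendsto_intros LIMSEQ_ignore_initial_segment lim)
    then show ?thesis unfolding g_def g'_def by (cases "0 \<le> u \<and> ennreal u \<le> T") auto
  qed
  have conv: "(\<lambda>i. \<integral>\<^sup>+u. g i u \<partial>lborel) \<longlonglongrightarrow> (\<integral>\<^sup>+u. g' u \<partial>lborel)"
    by (rule nn_integral_dominated_convergence[where w=W]) (use g_meas W W_fin g_W g_lim in auto)
  have g'_W: "g' u \<le> W u" for u
    by (rule LIMSEQ_le_const2[OF g_lim]) (use g_W in auto)
  have fin: "(\<integral>\<^sup>+u. g i u \<partial>lborel) < \<top>" "(\<integral>\<^sup>+u. g' u \<partial>lborel) < \<top>" for i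
    using order_le_less_trans[OF nn_integral_mono W_fin] g_W g'_W by blast+
  have en: "exp_neg (ennreal \<beta> * z) = exp (- (\<beta> * enn2real z))" if z: "z < \<top>" for z
    using z \<beta> by (cases z) (auto simp: exp_neg_ennreal simp flip: ennreal_mult')
  have "(\<lambda>i. exp (- (\<beta> * enn2real (\<integral>\<^sup>+u. g i u \<partial>lborel)))) \<longlonglongrightarrow> exp (- (\<beta> * enn2real (\<integral>\<^sup>+u. g' u \<partial>lborel)))"
  proof -
    have "(\<lambda>i. enn2real (\<integral>\<^sup>+u. g i u \<partial>lborel)) \<longlonglongrightarrow> enn2real (\<integral>\<^sup>+u. g' u \<partial>lborel)"
      by (rule tendsto_enn2real) (use conv fin(2) in auto)
    then show ?thesis by (intro tendsto_exp tendsto_minus tendsto_mult tendsto_const)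
  qed
  then have "(\<lambda>i. exp_neg (ennreal \<beta> * exp_functional (S (i + N)) X T \<omega>)) \<longlonglongrightarrow> exp_neg (ennreal \<beta> * exp_functional \<alpha> X T \<omega>)"
  proof -
    have "exp_functional (S (i + N)) X T \<omega> = (\<integral>\<^sup>+u. g i u \<partial>lborel)" for i
      by (simp add: exp_functional_def g_def)
    moreover have "exp_functional \<alpha> X T \<omega> = (\<integral>\<^sup>+u. g' u \<partial>lborel)"
      by (simp add: exp_functional_def g'_def)
    ultimately show ?thesis
      using \<open>(\<lambda>i. exp (- (\<beta> * enn2real (\<integral>\<^sup>+u. g i u \<partial>lborel)))) \<longlonglongrightarrow> _\<close> by (simp add: en[OF fin(1)] en[OF fin(2)])
  qed
  then show ?thesis by (rule LIMSEQ_offset)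
qed

text \<open>Only the inner time integral is delicate, the payoff itself being at most 1. For finite
  \<open>e\<close> the path is bounded on the range of integration. For infinite \<open>e\<close>
  the payoff is nonzero only without passage; then the path stays at or below \<open>c\<close>, and
  a fixed smaller exponent controls all exponents near \<open>\<alpha>\<close>.\<close>

lemma expectation_payoff_continuous:
  assumes \<alpha>: "0 < \<alpha>" and \<beta>: "0 \<le> \<beta>" and xc: "x \<le> c"
  shows "((\<lambda>\<alpha>. \<integral>\<omega>. payoff \<alpha> \<beta> c \<omega> \<partial>P x) \<longlongrightarrow> (\<integral>\<omega>. payoff \<alpha> \<beta> c \<omega> \<partial>P x)) (at \<alpha>)"
  unfolding tendsto_at_iff_sequentially comp_def
proof (intro allI impI)
  fix S :: "nat \<Rightarrow> real" assume S: "S \<longlonglongrightarrow> \<alpha>"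
  \<comment> \<open>Below \<open>\<phi>\<close>, so that \<open>exp_functional_finite\<close>
    provides an integrable function; below \<open>\<alpha>\<close>, so that eventually
    \<open>\<delta> < S i\<close>.\<close>
  define \<delta> where "\<delta> = min (\<alpha> / 2) (\<phi> / 2)"
  have \<delta>: "0 < \<delta>" "\<delta> < \<phi>" "\<delta> < \<alpha>" using \<alpha> \<phi>_pos by (auto simp: \<delta>_def)
  have "\<forall>\<^sub>F i in sequentially. \<delta> < S i" by (rule order_tendstoD(1)[OF S]) (use \<delta> in simp)
  moreover have "\<forall>\<^sub>F i in sequentially. S i < 2 * \<alpha>" by (rule order_tendstoD(2)[OF S]) (use \<alpha> in simp)
  ultimately have range: "\<forall>\<^sub>F i in sequentially. \<delta> < S i \<and> S i < 2 * \<alpha>" by eventually_elim simp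
  show "(\<lambda>i. \<integral>\<omega>. payoff (S i) \<beta> c \<omega> \<partial>P x) \<longlonglongrightarrow> (\<integral>\<omega>. payoff \<alpha> \<beta> c \<omega> \<partial>P x)"
  proof (rule integral_dominated_convergence[where w="\<lambda>_. 1"])
    show "AE \<omega> in P x. norm (payoff (S i) \<beta> c \<omega>) \<le> 1" for i
      by (auto simp: payoff_def indicator_def exp_neg_bounds)
    show "AE \<omega> in P x. (\<lambda>i. payoff (S i) \<beta> c \<omega>) \<longlonglongrightarrow> payoff \<alpha> \<beta> c \<omega>"
      using regular_path[OF xc] exp_functional_finite[OF \<delta>(1,2) xc]
    proof eventually_elim
      case (elim \<omega>)
      then have \<omega>: "\<omega> \<in> space (P x)" and X0: "X 0 \<omega> \<le> c" by auto
      show ?case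
      proof (cases "first_passage_above X c \<omega> \<ge> e \<omega>")
        case True
        have "(\<lambda>i. exp_neg (ennreal \<beta> * exp_functional (S i) X (e \<omega>) \<omega>)) \<longlonglongrightarrow> exp_neg (ennreal \<beta> * exp_functional \<alpha> X (e \<omega>) \<omega>)"
        proof (cases "e \<omega>")
          case (real r)
          obtain B where B: "\<And>u. 0 \<le> u \<Longrightarrow> u \<le> r \<Longrightarrow> \<bar>X u \<omega>\<bar> \<le> B" using X_bounded[OF \<omega> real(1)] by blast
          show ?thesis
          proof (rule exp_functional_tendsto[OF \<omega> S \<beta>, where W="\<lambda>u. ennreal (exp (2 * \<alpha> * B)) * indicator {0..r} u"])
            show "(\<integral>\<^sup>+u. ennreal (exp (2 * \<alpha> * B)) * indicator {0..r} u \<partial>lborel) < \<top>"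
              using real by (simp add: nn_integral_cmult_indicator ennreal_mult_less_top)
            show "\<forall>\<^sub>F i in sequentially. \<forall>u. 0 \<le> u \<longrightarrow> ennreal u \<le> e \<omega> \<longrightarrow> ennreal (exp (S i * X u \<omega>)) \<le> ennreal (exp (2 * \<alpha> * B)) * indicator {0..r} u"
              using range
            proof (eventually_elim, intro allI impI)
              fix i u assume i: "\<delta> < S i \<and> S i < 2 * \<alpha>" and u: "0 \<le> u" "ennreal u \<le> e \<omega>"
              have ur: "u \<le> r" using u real by (simp add: ennreal_le_iff)
              have "S i * X u \<omega> \<le> S i * \<bar>X u \<omega>\<bar>" using i \<delta> by (intro mult_left_mono) auto
              also have "\<dots> \<le> 2 * \<alpha> * B" using i \<delta> B[OF u(1) ur] by (intro mult_mono) auto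
              finally show "ennreal (exp (S i * X u \<omega>)) \<le> ennreal (exp (2 * \<alpha> * B)) * indicator {0..r} u"
                using u ur by (simp add: ennreal_leI)
            qed
          qed simp
        next
          case top
          then have \<tau>: "first_passage_above X c \<omega> = \<top>" using True by (simp add: top_unique)
          let ?g = "\<lambda>u. ennreal (exp (\<delta> * X u \<omega>)) * indicator {u. 0 \<le> u \<and> ennreal u \<le> \<top>} u"
          have g_meas: "?g \<in> borel_measurable lborel" by (rule exp_functional_integrand_measurable[OF \<omega>])
          show ?thesis
          proof (rule exp_functional_tendsto[OF \<omega> S \<beta>, where W="\<lambda>u. ennreal (exp (2 * \<alpha> * \<bar>c\<bar>)) * ?g u"])
            show "(\<lambda>u. ennreal (exp (2 * \<alpha> * \<bar>c\<bar>)) * ?g u) \<in> borel_measurable lborel"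
              using g_meas by (rule borel_measurable_times_ennreal[rotated]) simp
            have "(\<integral>\<^sup>+u. ?g u \<partial>lborel) < \<top>"
              using elim(2) \<tau> top unfolding exp_functional_def by blast
            then show "(\<integral>\<^sup>+u. ennreal (exp (2 * \<alpha> * \<bar>c\<bar>)) * ?g u \<partial>lborel) < \<top>"
              by (subst nn_integral_cmult[OF g_meas]) (simp add: ennreal_mult_less_top)
            show "\<forall>\<^sub>F i in sequentially. \<forall>u. 0 \<le> u \<longrightarrow> ennreal u \<le> e \<omega> \<longrightarrow> ennreal (exp (S i * X u \<omega>)) \<le> ennreal (exp (2 * \<alpha> * \<bar>c\<bar>)) * ?g u"
              using range
            proof (eventually_elim, intro allI impI)
              fix i u assume i: "\<delta> < S i \<and> S i < 2 * \<alpha>" and u: "0 \<le> u" "ennreal u \<le> e \<omega>"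
              have "X u \<omega> \<le> \<bar>c\<bar>"
                using before_first_passage[of u c \<omega>] X0 \<tau> u(1) by (cases "u = 0") auto
              \<comment> \<open>The surplus exponent \<open>S i - \<delta>\<close> is positive and
                meets a path bounded above, hence costs at most a constant factor; the remaining
                \<open>exp (\<delta> * X u \<omega>)\<close> supplies the decay in time.\<close>
              then have "(S i - \<delta>) * X u \<omega> \<le> (S i - \<delta>) * \<bar>c\<bar>" using i by (intro mult_left_mono) auto
              also have "\<dots> \<le> 2 * \<alpha> * \<bar>c\<bar>" using i \<delta> by (intro mult_right_mono) auto
              finally have "S i * X u \<omega> \<le> 2 * \<alpha> * \<bar>c\<bar> + \<delta> * X u \<omega>" by (simp add: algebra_simps)
              then have "exp (S i * X u \<omega>) \<le> exp (2 * \<alpha> * \<bar>c\<bar>) * exp (\<delta> * X u \<omega>)" by (simp add: exp_add[symmetric])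
              then have "ennreal (exp (S i * X u \<omega>)) \<le> ennreal (exp (2 * \<alpha> * \<bar>c\<bar>)) * ennreal (exp (\<delta> * X u \<omega>))"
                by (simp add: ennreal_leI flip: ennreal_mult')
              then show "ennreal (exp (S i * X u \<omega>)) \<le> ennreal (exp (2 * \<alpha> * \<bar>c\<bar>)) * ?g u"
                using u by simp
            qed
          qed
        qed
        then show ?thesis using True by (simp add: payoff_def)
      qed (simp add: payoff_def)
    qed
  qed auto
qed

lemma expectation_payoff:
  assumes \<alpha>: "0 < \<alpha>" and \<beta>: "0 \<le> \<beta>" and xc: "x \<le> c"
  shows "(\<integral>\<omega>. payoff \<alpha> \<beta> c \<omega> \<partial>P x) = M_function \<psi> \<phi> p \<alpha> \<beta> (exp x) (exp c)"
proof (cases "\<exists>m::nat. 1 \<le> m \<and> \<phi> = real m * \<alpha>")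
  case False
  then show ?thesis
    using expectation_payoff_nonresonant[OF assms] by (auto simp: M_function_def)
next
  case True
  then obtain m :: nat where m: "1 \<le> m" "\<phi> = real m * \<alpha>" by blast
  have "\<forall>\<^sub>F a in at \<alpha>. 0 < a"
    by (rule order_tendstoD(1)[OF tendsto_ident_at \<alpha>])
  \<comment> \<open>Near \<open>\<alpha>\<close> this and the next bound leave \<open>k = m\<close>
    as the only multiple of \<open>a\<close> that could equal \<open>\<phi>\<close>, and
    \<open>a \<noteq> \<alpha>\<close> rules it out. So the nonresonant identity holds on a
    punctured neighbourhood.\<close>
  moreover have "\<forall>\<^sub>F a in at \<alpha>. \<phi> < (real m + 1) * a"
    by (rule order_tendstoD(1)[of _ "(real m + 1) * \<alpha>"]) (use \<alpha> m in \<open>auto intro!: tendsto_intros\<close>)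
  moreover have "\<forall>\<^sub>F a in at \<alpha>. (real m - 1) * a < \<phi>"
    by (rule order_tendstoD(2)[of _ "(real m - 1) * \<alpha>"]) (use \<alpha> m in \<open>auto intro!: tendsto_intros\<close>)
  moreover have "\<forall>\<^sub>F a in at \<alpha>. a \<noteq> \<alpha>" by (simp add: eventually_at_filter)
  ultimately have ev: "\<forall>\<^sub>F a in at \<alpha>. (\<integral>\<omega>. payoff a \<beta> c \<omega> \<partial>P x) = M_nonresonant \<psi> \<phi> p a \<beta> (exp x) (exp c)"
  proof eventually_elim
    case (elim a)
    have "\<phi> \<noteq> real k * a" if k: "1 \<le> k" for k :: nat
    proof
      assume eq: "\<phi> = real k * a"
      have "real k < real m + 1" "real m - 1 < real k"
        using elim(2,3) unfolding eq by (simp_all add: elim(1))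
      then have "k = m" by linarith
      then show False using eq m elim(4) by simp
    qed
    then show ?case by (intro expectation_payoff_nonresonant elim(1) \<beta> xc)
  qed
  have "((\<lambda>a. M_nonresonant \<psi> \<phi> p a \<beta> (exp x) (exp c)) \<longlongrightarrow> (\<integral>\<omega>. payoff \<alpha> \<beta> c \<omega> \<partial>P x)) (at \<alpha>)"
    by (rule Lim_transform_eventually[OF expectation_payoff_continuous[OF assms] ev])
  then have "Lim (at \<alpha>) (\<lambda>a. M_nonresonant \<psi> \<phi> p a \<beta> (exp x) (exp c)) = (\<integral>\<omega>. payoff \<alpha> \<beta> c \<omega> \<partial>P x)"
    by (rule tendsto_Lim[rotated]) simp
  then show ?thesis using True by (simp add: M_function_def)
qed

end

theorem corollary3p7:
  fixes P :: "real \<Rightarrow> 'a measure"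
    and F :: "real \<Rightarrow> 'a measure"
    and X :: "real \<Rightarrow> 'a \<Rightarrow> real"
    and e :: "'a \<Rightarrow> ennreal"
    and p \<alpha> \<beta> x c :: real
  assumes "killed_spectrally_negative_Levy P F X e p"
    and "0 < \<alpha>"
    and "0 \<le> \<beta>"
    and "x \<le> c"
  shows "(\<integral>\<omega>. exp_neg (ennreal \<beta> * exp_functional \<alpha> X (e \<omega>) \<omega>) *
            indicator {\<omega>. first_passage_above X c \<omega> \<ge> e \<omega>} \<omega> \<partial>P x) =
         M_function (laplace_exponent P X) (laplace_exponent_inverse P X p) p \<alpha> \<beta> (exp x) (exp c)"
proof -
  interpret killed_spectrally_negative_Levy P F X e p by fact
  show ?thesis
    using expectation_payoff[OF assms(2-4)] by (simp only: payoff_def)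
qed

end
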